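(* Let $H$ be a finite-dimensional semisimple Hopf algebra over an algebraically closed field $k$ of characteristic zero, with antipode $S$ and Haar integral $\Lambda$. Let $\alpha:H\to k$ be an algebra map such that $\alpha(h_{(1)})h_{(2)}=\alpha(h_{(2)})h_{(1)}$ holds for all $h\in H$ (or, equivalently, let $\alpha$ be a central grouplike element of the dual Hopf algebra $H^\vee$), and let $L$ be the (one-dimensional) left $H$-module corresponding to $\alpha$. Then, for every finite-dimensional simple left $H$-module $V$ with character $\chi_V$, $$\nu(V;L)=\alpha(S(\Lambda_{(1)}))\,\chi_V(\Lambda_{(2)}\Lambda_{(3)})\in\{0,\pm1\}.$$ Moreover, for a finite-dimensional simple left $H$-module $V$, the following statements are equivalent: (1) $\nu(V;L)\neq0$. (2) $V\cong L\otimes V^\vee$. (3) There exists a non-degenerate bilinear form $b:V\otimes V\to k$ satisfying $b(h_{(1)}v,h_{(2)}w)=\alpha(h)b(v,w)$ for all $h\in H$ and $v,w\in V$. If one of the equivalent statements (1), (2), (3) holds, then a non-degenerate bilinear form $b:V\otimes V\to k$ satisfying $b(h_{(1)}v,h_{(2)}w)=\alpha(h)b(v,w)$ for all $h\in H$ and $v,w\in V$ is unique up to scalar multiples and satisfies $b(w,v)=\nu(V;L)\,b(v,w)$ for all $v,w\in V$.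
   Context: Sweedler notation $\Delta(h)=h_{(1)}\otimes h_{(2)}$, etc., is used. The Haar integral $\Lambda\in H$ is the two-sided integral with $\varepsilon(\Lambda)=1$. $V^\vee=\mathrm{Hom}_k(V,k)$ is the dual $H$-module, $\langle hf,v\rangle=\langle f,S(h)v\rangle$ (recall $S^2=\mathrm{id}_H$ by Larson--Radford). The $L$-twisted Frobenius--Schur indicator $\nu(V;L)$ of a finite-dimensional left $H$-module $V$ is the trace of the linear map $\Sigma_V^L:\mathrm{Hom}_H(V\otimes V,L)\to\mathrm{Hom}_H(V\otimes V,L)$, $\Sigma_V^L(b)(v,w)=b(w,v)$ (which is well defined). Equivalently, it is the Frobenius--Schur indicator of $V$ with respect to the twisted duality $V\mapsto L\otimes V^\vee$ on finite-dimensional left $H$-modules, via the natural isomorphism $\mathrm{Hom}_H(V,L\otimes V^\vee)\cong\mathrm{Hom}_H(V\otimes V,L)$. *)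

theory Defs
  imports
    "HOL-Computational_Algebra.Computational_Algebra"
    "HOL-Library.Function_Algebras"
begin

section \<open>Vector spaces with a carrier\<close>

text \<open>
  Duals and tensor products have to be carried by subsets of types, so a vector space is a
  subspace \<open>carr\<close> of an ambient type that is a vector space under \<open>scal\<close>. A map between two such
  spaces is only meaningful on the carrier of its source; where maps are themselves elements of a
  space (dual, Hom), they are normalised to be zero off that carrier.
\<close>

record ('k, 'v) vspace =
  carr :: "'v set"
  scal :: "'k \<Rightarrow> 'v \<Rightarrow> 'v"

definition is_vspace :: "('k::field, 'v::ab_group_add, 'z) vspace_scheme \<Rightarrow> bool" where
  "is_vspace V \<longleftrightarrow> vector_space (scal V) \<and> module.subspace (scal V) (carr V)"

definition fin_dim :: "('k::field, 'v::ab_group_add, 'z) vspace_scheme \<Rightarrow> bool" where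
  "fin_dim V \<longleftrightarrow> (\<exists>B. finite B \<and> B \<subseteq> carr V \<and> carr V \<subseteq> module.span (scal V) B)"

definition ground :: "('k::field, 'k) vspace" where
  "ground = \<lparr>carr = UNIV, scal = (*)\<rparr>"

definition ptscale :: "'k::field \<Rightarrow> ('a \<Rightarrow> 'k) \<Rightarrow> 'a \<Rightarrow> 'k" where
  "ptscale c f = (\<lambda>x. c * f x)"

definition linear_map :: "('k::field, 'u::ab_group_add, 'y) vspace_scheme \<Rightarrow>
    ('k, 'v::ab_group_add, 'z) vspace_scheme \<Rightarrow> ('u \<Rightarrow> 'v) \<Rightarrow> bool" where
  "linear_map U V f \<longleftrightarrow>
     (\<forall>x\<in>carr U. f x \<in> carr V) \<and>
     (\<forall>x\<in>carr U. \<forall>y\<in>carr U. f (x + y) = f x + f y) \<and>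
     (\<forall>c. \<forall>x\<in>carr U. f (scal U c x) = scal V c (f x))"

definition bilinear_map :: "('k::field, 'u::ab_group_add, 'x) vspace_scheme \<Rightarrow>
    ('k, 'v::ab_group_add, 'y) vspace_scheme \<Rightarrow> ('k, 'w::ab_group_add, 'z) vspace_scheme \<Rightarrow>
    ('u \<Rightarrow> 'v \<Rightarrow> 'w) \<Rightarrow> bool" where
  "bilinear_map U V W b \<longleftrightarrow>
     (\<forall>v\<in>carr V. linear_map U W (\<lambda>u. b u v)) \<and> (\<forall>u\<in>carr U. linear_map V W (b u))"

definition linear_trace :: "('k::field, 'v::ab_group_add, 'z) vspace_scheme \<Rightarrow> ('v \<Rightarrow> 'v) \<Rightarrow> 'k" where
  "linear_trace V f =
     (let B = (SOME B. finite B \<and> B \<subseteq> carr V \<and> carr V \<subseteq> module.span (scal V) B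
                  \<and> \<not> module.dependent (scal V) B)
      in \<Sum>b\<in>B. module.representation (scal V) B (f b) b)"

section \<open>Tensor products\<close>

text \<open>
  Over a field, bilinear forms on \<open>U \<times> V\<close> separate the elements of \<open>U \<otimes> V\<close>. Hence \<open>U \<otimes> V\<close> is
  realised as the span of the evaluations \<open>u \<otimes> v : \<beta> \<mapsto> \<beta>(u, v)\<close> in the space of functionals on
  bilinear forms; these are extended by zero to all of \<open>'u \<Rightarrow> 'v \<Rightarrow> 'k\<close>.
\<close>

type_synonym ('k, 'u, 'v) tensor = "('u \<Rightarrow> 'v \<Rightarrow> 'k) \<Rightarrow> 'k"

definition tens :: "('k::field, 'u::ab_group_add, 'y) vspace_scheme \<Rightarrow>
    ('k, 'v::ab_group_add, 'z) vspace_scheme \<Rightarrow> 'u \<Rightarrow> 'v \<Rightarrow> ('k, 'u, 'v) tensor" where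
  "tens U V u v = (\<lambda>\<beta>. if bilinear_map U V ground \<beta> then \<beta> u v else 0)"

definition tensor_space :: "('k::field, 'u::ab_group_add, 'y) vspace_scheme \<Rightarrow>
    ('k, 'v::ab_group_add, 'z) vspace_scheme \<Rightarrow> ('k, ('k, 'u, 'v) tensor) vspace" where
  "tensor_space U V =
     \<lparr>carr = module.span ptscale {tens U V u v | u v. u \<in> carr U \<and> v \<in> carr V},
      scal = ptscale\<rparr>"

text \<open>
  The linear map on \<open>U \<otimes> V\<close> induced by a bilinear map \<open>f\<close>: write the tensor as a finite sum of
  \<open>u \<otimes> v\<close> and sum up \<open>f u v\<close>. For bilinear \<open>f\<close> the chosen decomposition is irrelevant, and
  scalar coefficients can be absorbed into the first factors.
\<close>

definition tensor_lift :: "('k::field, 'u::ab_group_add, 'x) vspace_scheme \<Rightarrow>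
    ('k, 'v::ab_group_add, 'y) vspace_scheme \<Rightarrow>
    ('u \<Rightarrow> 'v \<Rightarrow> 'w::ab_group_add) \<Rightarrow> ('k, 'u, 'v) tensor \<Rightarrow> 'w" where
  "tensor_lift U V f t =
     (\<Sum>(u, v)\<leftarrow>(SOME ps. set ps \<subseteq> carr U \<times> carr V \<and> (\<Sum>(u, v)\<leftarrow>ps. tens U V u v) = t). f u v)"

section \<open>Hopf algebras\<close>

text \<open>The ring structure on the Hopf algebra is that of the type \<open>'h\<close>, so the carrier is all of \<open>'h\<close>.\<close>

record ('k, 'h) hopf = "('k, 'h) vspace" +
  comult :: "'h \<Rightarrow> ('k, 'h, 'h) tensor"
  counit :: "'h \<Rightarrow> 'k"
  antipode :: "'h \<Rightarrow> 'h"

text \<open>\<open>sweedler H (\<lambda>a b. f a b) h\<close> is \<open>f(h\<^sub>(\<^sub>1\<^sub>), h\<^sub>(\<^sub>2\<^sub>))\<close>, and similarly for three factors.\<close>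

definition sweedler :: "('k::field, 'h::ring_1) hopf \<Rightarrow> ('h \<Rightarrow> 'h \<Rightarrow> 'w::ab_group_add) \<Rightarrow> 'h \<Rightarrow> 'w" where
  "sweedler H f h = tensor_lift H H f (comult H h)"

definition sweedler3 :: "('k::field, 'h::ring_1) hopf \<Rightarrow> ('h \<Rightarrow> 'h \<Rightarrow> 'h \<Rightarrow> 'w::ab_group_add) \<Rightarrow>
    'h \<Rightarrow> 'w" where
  "sweedler3 H f h = sweedler H (\<lambda>a b. sweedler H (\<lambda>c d. f a c d) b) h"

definition algebra_map :: "('k::field, 'h::ring_1) hopf \<Rightarrow> ('h \<Rightarrow> 'k) \<Rightarrow> bool" where
  "algebra_map H \<alpha> \<longleftrightarrow>
     linear_map H ground \<alpha> \<and> (\<forall>x y. \<alpha> (x * y) = \<alpha> x * \<alpha> y) \<and> \<alpha> 1 = 1"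

text \<open>Coassociativity is stated in \<open>H \<otimes> (H \<otimes> H)\<close>.\<close>

definition hopf_algebra :: "('k::field, 'h::ring_1) hopf \<Rightarrow> bool" where
  "hopf_algebra H \<longleftrightarrow>
     is_vspace H \<and> carr H = UNIV \<and>
     (\<forall>c x y. scal H c (x * y) = scal H c x * y \<and> scal H c (x * y) = x * scal H c y) \<and>
     linear_map H (tensor_space H H) (comult H) \<and>
     (\<forall>h. sweedler H (\<lambda>a b. sweedler H (\<lambda>b1 b2. tens H (tensor_space H H) a (tens H H b1 b2)) b) h =
          sweedler H (\<lambda>a b. sweedler H (\<lambda>a1 a2. tens H (tensor_space H H) a1 (tens H H a2 b)) a) h) \<and>
     (\<forall>h. sweedler H (\<lambda>a b. scal H (counit H a) b) h = h) \<and>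
     (\<forall>h. sweedler H (\<lambda>a b. scal H (counit H b) a) h = h) \<and>
     (\<forall>x y. comult H (x * y) =
        sweedler H (\<lambda>a b. sweedler H (\<lambda>c d. tens H H (a * c) (b * d)) y) x) \<and>
     comult H 1 = tens H H 1 1 \<and>
     algebra_map H (counit H) \<and>
     linear_map H H (antipode H) \<and>
     (\<forall>h. sweedler H (\<lambda>a b. antipode H a * b) h = scal H (counit H h) 1) \<and>
     (\<forall>h. sweedler H (\<lambda>a b. a * antipode H b) h = scal H (counit H h) 1)"

definition haar_integral :: "('k::field, 'h::ring_1) hopf \<Rightarrow> 'h" where
  "haar_integral H = (THE \<Lambda>.
     (\<forall>h. h * \<Lambda> = scal H (counit H h) \<Lambda> \<and> \<Lambda> * h = scal H (counit H h) \<Lambda>) \<and> counit H \<Lambda> = 1)"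

section \<open>Modules\<close>

record ('k, 'v, 'h) hmod = "('k, 'v) vspace" +
  act :: "'h \<Rightarrow> 'v \<Rightarrow> 'v"

definition is_hmod :: "('k::field, 'h::ring_1) hopf \<Rightarrow> ('k, 'v::ab_group_add, 'h) hmod \<Rightarrow> bool" where
  "is_hmod H M \<longleftrightarrow> is_vspace M \<and> bilinear_map H M M (act M) \<and>
     (\<forall>g h. \<forall>v\<in>carr M. act M (g * h) v = act M g (act M h v)) \<and>
     (\<forall>v\<in>carr M. act M 1 v = v)"

definition submod :: "('k::field, 'v::ab_group_add, 'h) hmod \<Rightarrow> 'v set \<Rightarrow> bool" where
  "submod M W \<longleftrightarrow> W \<subseteq> carr M \<and> module.subspace (scal M) W \<and> (\<forall>h. \<forall>w\<in>W. act M h w \<in> W)"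

definition simple_hmod :: "('k::field, 'h::ring_1) hopf \<Rightarrow> ('k, 'v::ab_group_add, 'h) hmod \<Rightarrow> bool" where
  "simple_hmod H M \<longleftrightarrow> is_hmod H M \<and> carr M \<noteq> {0} \<and> (\<forall>W. submod M W \<longrightarrow> W = {0} \<or> W = carr M)"

definition semisimple_hmod :: "('k::field, 'h::ring_1) hopf \<Rightarrow> ('k, 'v::ab_group_add, 'h) hmod \<Rightarrow> bool" where
  "semisimple_hmod H M \<longleftrightarrow> is_hmod H M \<and>
     (\<forall>W. submod M W \<longrightarrow>
        (\<exists>W'. submod M W' \<and> W \<inter> W' = {0} \<and> {w + w' | w w'. w \<in> W \<and> w' \<in> W'} = carr M))"

definition regular_hmod :: "('k::field, 'h::ring_1) hopf \<Rightarrow> ('k, 'h, 'h) hmod" where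
  "regular_hmod H = \<lparr>carr = carr H, scal = scal H, act = (*)\<rparr>"

definition semisimple :: "('k::field, 'h::ring_1) hopf \<Rightarrow> bool" where
  "semisimple H \<longleftrightarrow> semisimple_hmod H (regular_hmod H)"

definition hmod_map :: "('k::field, 'u::ab_group_add, 'h) hmod \<Rightarrow> ('k, 'v::ab_group_add, 'h) hmod \<Rightarrow>
    ('u \<Rightarrow> 'v) \<Rightarrow> bool" where
  "hmod_map M N f \<longleftrightarrow> linear_map M N f \<and> (\<forall>h. \<forall>v\<in>carr M. f (act M h v) = act N h (f v))"

definition hmod_iso :: "('k::field, 'u::ab_group_add, 'h) hmod \<Rightarrow> ('k, 'v::ab_group_add, 'h) hmod \<Rightarrow>
    bool" where
  "hmod_iso M N \<longleftrightarrow> (\<exists>f. hmod_map M N f \<and> bij_betw f (carr M) (carr N))"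

definition character :: "('k::field, 'v::ab_group_add, 'h) hmod \<Rightarrow> 'h \<Rightarrow> 'k" where
  "character M h = linear_trace M (act M h)"

definition one_dim_hmod :: "('h \<Rightarrow> 'k::field) \<Rightarrow> ('k, 'k, 'h) hmod" where
  "one_dim_hmod \<alpha> = \<lparr>carr = UNIV, scal = (*), act = (\<lambda>h c. \<alpha> h * c)\<rparr>"

definition dual_hmod :: "('k::field, 'h::ring_1) hopf \<Rightarrow> ('k, 'v::ab_group_add, 'h) hmod \<Rightarrow>
    ('k, 'v \<Rightarrow> 'k, 'h) hmod" where
  "dual_hmod H M =
     \<lparr>carr = {f. linear_map M ground f \<and> (\<forall>v. v \<notin> carr M \<longrightarrow> f v = 0)},
      scal = ptscale,
      act = (\<lambda>h f v. if v \<in> carr M then f (act M (antipode H h) v) else 0)\<rparr>"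

definition tensor_hmod :: "('k::field, 'h::ring_1) hopf \<Rightarrow> ('k, 'u::ab_group_add, 'h) hmod \<Rightarrow>
    ('k, 'v::ab_group_add, 'h) hmod \<Rightarrow> ('k, ('k, 'u, 'v) tensor, 'h) hmod" where
  "tensor_hmod H M N =
     \<lparr>carr = carr (tensor_space M N),
      scal = scal (tensor_space M N),
      act = (\<lambda>h. tensor_lift M N (\<lambda>u v. sweedler H (\<lambda>a b. tens M N (act M a u) (act N b v)) h))\<rparr>"

section \<open>Twisted Frobenius--Schur indicator\<close>

text \<open>\<open>Hom\<^sub>H(V \<otimes> V, L)\<close>, where the underlying space of \<open>L\<close> is the ground field.\<close>

definition twisted_forms :: "('k::field, 'h::ring_1) hopf \<Rightarrow> ('h \<Rightarrow> 'k) \<Rightarrow>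
    ('k, 'v::ab_group_add, 'h) hmod \<Rightarrow> ('k, ('k, 'v, 'v) tensor \<Rightarrow> 'k) vspace" where
  "twisted_forms H \<alpha> V =
     \<lparr>carr = {b. hmod_map (tensor_hmod H V V) (one_dim_hmod \<alpha>) b \<and>
                 (\<forall>t. t \<notin> carr (tensor_hmod H V V) \<longrightarrow> b t = 0)},
      scal = ptscale\<rparr>"

definition swap_form :: "('k::field, 'v::ab_group_add, 'h) hmod \<Rightarrow>
    (('k, 'v, 'v) tensor \<Rightarrow> 'k) \<Rightarrow> ('k, 'v, 'v) tensor \<Rightarrow> 'k" where
  "swap_form V b = (\<lambda>t. if t \<in> carr (tensor_space V V)
     then tensor_lift V V (\<lambda>v w. b (tens V V w v)) t else 0)"

definition twisted_indicator :: "('k::field, 'h::ring_1) hopf \<Rightarrow> ('h \<Rightarrow> 'k) \<Rightarrow>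
    ('k, 'v::ab_group_add, 'h) hmod \<Rightarrow> 'k" where
  "twisted_indicator H \<alpha> V = linear_trace (twisted_forms H \<alpha> V) (swap_form V)"

definition nondegenerate :: "('k::field, 'v::ab_group_add, 'h) hmod \<Rightarrow> ('v \<Rightarrow> 'v \<Rightarrow> 'k) \<Rightarrow> bool" where
  "nondegenerate V b \<longleftrightarrow>
     (\<forall>v\<in>carr V. (\<forall>w\<in>carr V. b v w = 0) \<longrightarrow> v = 0) \<and>
     (\<forall>w\<in>carr V. (\<forall>v\<in>carr V. b v w = 0) \<longrightarrow> w = 0)"

definition invariant_pairing :: "('k::field, 'h::ring_1) hopf \<Rightarrow> ('h \<Rightarrow> 'k) \<Rightarrow>
    ('k, 'v::ab_group_add, 'h) hmod \<Rightarrow> ('v \<Rightarrow> 'v \<Rightarrow> 'k) \<Rightarrow> bool" where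
  "invariant_pairing H \<alpha> V b \<longleftrightarrow>
     bilinear_map V V ground b \<and> nondegenerate V b \<and>
     (\<forall>h. \<forall>v\<in>carr V. \<forall>w\<in>carr V.
        sweedler H (\<lambda>x y. b (act V x v) (act V y w)) h = \<alpha> h * b v w)"

end

theory Submission
  imports Defs
begin

text \<open>
  The swap of a form \<open>b : V \<otimes> V \<rightarrow> L\<close> is again \<open>H\<close>-linear because \<open>\<alpha>\<close> is central and \<open>S\<^sup>2 = id\<close>. By Schur's
  lemma, \<open>Hom\<^sub>H(V \<otimes> V, L)\<close> is at most one-dimensional and its non-zero elements are non-degenerate, so
  the swap acts by a sign. Averaging a form against \<open>\<alpha>(S(\<Lambda>\<^sub>1)) \<Lambda>\<^sub>2 \<otimes> \<Lambda>\<^sub>3\<close> projects onto this space, and the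
  trace of swap composed with this projection is \<open>\<alpha>(S(\<Lambda>\<^sub>1)) \<chi>\<^sub>V(\<Lambda>\<^sub>2\<Lambda>\<^sub>3)\<close>.

  The identity \<open>S\<^sup>2 = id\<close> is the theorem of Larson and Radford. The functional
  \<open>\<lambda>(h) = tr(a \<mapsto> h S\<^sup>2(a))\<close> is an integral on \<open>H\<close> with \<open>\<lambda>(\<Lambda>) = 1\<close>, and comparing it with \<open>\<lambda> \<circ> S\<close>
  gives Radford's formula: \<open>S\<^sup>4\<close> is conjugation by a grouplike element \<open>g\<close>, so \<open>S\<close> has finite order. On the
  other hand \<open>S\<^sup>2\<close> is conjugation by some \<open>u\<close>, and in an eigenbasis of \<open>u\<close> the trace of \<open>S\<^sup>2\<close> is a sum
  of \<open>\<bar>tr(u|V)\<bar>\<^sup>2\<close> over the simple modules \<open>V\<close>, where the trivial module contributes \<open>1\<close>. Hence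
  \<open>\<lambda>(1) = tr(S\<^sup>2) \<noteq> 0\<close>, which forces \<open>g = 1\<close> and \<open>S\<^sup>4 = id\<close>. Finally, convolution with the regular
  character, divided by \<open>n = dim H\<close>, is an idempotent \<open>E\<close> commuting with \<open>S\<^sup>2\<close> such that
  \<open>n tr(S\<^sup>2 E) = tr(S\<^sup>2)\<close>. So \<open>n\<close> divides the non-zero integer \<open>tr(S\<^sup>2)\<close>, all eigenvalues of \<open>S\<^sup>2\<close>
  agree, and \<open>S\<^sup>2(1) = 1\<close>.
\<close>

section \<open>Traces of endomorphisms\<close>

text \<open>The proof that \<open>S\<^sup>2 = id\<close> runs inside \<open>H\<close>, without a
  Wedderburn decomposition. Semisimplicity is used in one form: every left ideal is
  \<open>H e\<close> for an idempotent \<open>e\<close>. In characteristic zero the trace of an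
  idempotent is its rank and vanishes only for the zero map; this yields a non-degenerate trace form
  and primitive idempotents with one-dimensional corners, which stand in for simple modules and
  Schur's lemma. Isomorphisms of modules are replaced by traces: an operator is written as a sum of
  \<open>T\<^sub>b \<circ> A \<circ> U\<^sub>b\<close> for which the sum of
  \<open>U\<^sub>b \<circ> T\<^sub>b\<close> is a scalar, and cyclicity of the trace does the rest.
  The factor \<open>S\<^sup>2\<close> in \<open>lam\<close> is dictated by this rewriting, which
  needs the collapse of \<open>S\<^sup>2(a\<^sub>2) S(a\<^sub>1) = S(a\<^sub>1
  S(a\<^sub>2))\<close>. The divisibility argument has to wait for \<open>S\<^sup>4 = id\<close>:
  only then are the eigenvalues of \<open>S\<^sup>2\<close> signs and the traces in question
  integers. Sweedler sums are nested binary sums, so identities are proved by evaluating one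
  expression with surplus legs under two bracketings.\<close>

definition vbasis :: "('k::field, 'v::ab_group_add, 'z) vspace_scheme \<Rightarrow> 'v set" where
  "vbasis V = (SOME B. finite B \<and> B \<subseteq> carr V \<and> carr V \<subseteq> module.span (scal V) B
                  \<and> \<not> module.dependent (scal V) B)"

definition vcoord :: "('k::field, 'v::ab_group_add, 'z) vspace_scheme \<Rightarrow> 'v \<Rightarrow> 'v \<Rightarrow> 'k" where
  "vcoord V b x = module.representation (scal V) (vbasis V) x b"

text \<open>\<open>vbasis\<close> repeats the choice term of \<open>linear_trace\<close> verbatim,
  so both sides agree by unfolding.\<close>

lemma linear_trace_eq: "linear_trace V f = (\<Sum>b\<in>vbasis V. vcoord V b (f b))"
  unfolding linear_trace_def vbasis_def vcoord_def Let_def ..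

lemma is_vspace_vector_space: "is_vspace V \<Longrightarrow> vector_space (scal V)"
  by (simp add: is_vspace_def)

locale vspace_carrier =
  fixes V :: "('k::field, 'v::ab_group_add, 'z) vspace_scheme"
  assumes is_vspace: "is_vspace V"
begin

sublocale vector_space "scal V"
  using is_vspace by (rule is_vspace_vector_space)

lemma subspace_carr: "subspace (carr V)"
  using is_vspace by (simp add: is_vspace_def)

lemma carr_zero [simp]: "0 \<in> carr V"
  and carr_add [intro]: "x \<in> carr V \<Longrightarrow> y \<in> carr V \<Longrightarrow> x + y \<in> carr V"
  and carr_diff [intro]: "x \<in> carr V \<Longrightarrow> y \<in> carr V \<Longrightarrow> x - y \<in> carr V"
  and carr_scale [intro]: "x \<in> carr V \<Longrightarrow> scal V c x \<in> carr V"
  and carr_sum: "(\<And>i. i \<in> I \<Longrightarrow> g i \<in> carr V) \<Longrightarrow> sum g I \<in> carr V"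
  using subspace_carr subspace_0 subspace_add subspace_diff subspace_scale subspace_sum by blast+

end

locale fd_space = vspace_carrier +
  assumes fin_dim: "fin_dim V"
begin

lemma vbasis_props:
  "finite (vbasis V) \<and> vbasis V \<subseteq> carr V \<and> carr V \<subseteq> span (vbasis V) \<and> independent (vbasis V)"
proof -
  obtain C where C: "finite C" "carr V \<subseteq> span C"
    using fin_dim unfolding fin_dim_def by blast
  obtain B where B: "B \<subseteq> carr V" "independent B" "carr V \<subseteq> span B"
    using maximal_independent_subset by blast
  have "finite B"
    using independent_span_bound[OF C(1) B(2)] subset_trans[OF B(1) C(2)] by simp
  with B have "finite B \<and> B \<subseteq> carr V \<and> carr V \<subseteq> span B \<and> independent B" by simp
  then show ?thesis
    unfolding vbasis_def by (rule someI)
qed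

lemma finite_vbasis [simp]: "finite (vbasis V)"
  and vbasis_carr: "b \<in> vbasis V \<Longrightarrow> b \<in> carr V"
  and independent_vbasis: "independent (vbasis V)"
  and carr_span: "x \<in> carr V \<Longrightarrow> x \<in> span (vbasis V)"
  using vbasis_props by blast+

lemma vcoord_add: "x \<in> carr V \<Longrightarrow> y \<in> carr V \<Longrightarrow> vcoord V b (x + y) = vcoord V b x + vcoord V b y"
  unfolding vcoord_def by (simp add: representation_add[OF independent_vbasis] carr_span)

lemma vcoord_scale: "x \<in> carr V \<Longrightarrow> vcoord V b (scal V c x) = c * vcoord V b x"
  unfolding vcoord_def by (simp add: representation_scale[OF independent_vbasis] carr_span)

lemma vcoord_basis: "c \<in> vbasis V \<Longrightarrow> vcoord V b c = (if b = c then 1 else 0)"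
  unfolding vcoord_def by (simp add: representation_basis[OF independent_vbasis])

lemma vcoord_sum:
  "(\<And>i. i \<in> I \<Longrightarrow> g i \<in> carr V) \<Longrightarrow> vcoord V b (sum g I) = (\<Sum>i\<in>I. vcoord V b (g i))"
  unfolding vcoord_def by (simp add: representation_sum[OF independent_vbasis] carr_span)

lemma vcoord_expand: "x \<in> carr V \<Longrightarrow> (\<Sum>b\<in>vbasis V. scal V (vcoord V b x) b) = x"
  unfolding vcoord_def
  by (rule sum_representation_eq[OF independent_vbasis carr_span finite_vbasis order_refl])

lemma linear_vcoord: "linear_map V ground (vcoord V b)"
  by (simp add: linear_map_def ground_def vcoord_add vcoord_scale)

lemma trace_cong: "(\<And>x. x \<in> carr V \<Longrightarrow> f x = g x) \<Longrightarrow> linear_trace V f = linear_trace V g"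
  unfolding linear_trace_eq by (auto intro!: sum.cong simp: vbasis_carr)

lemma trace_add:
  "(\<And>x. x \<in> carr V \<Longrightarrow> f x \<in> carr V) \<Longrightarrow> (\<And>x. x \<in> carr V \<Longrightarrow> g x \<in> carr V) \<Longrightarrow>
    linear_trace V (\<lambda>x. f x + g x) = linear_trace V f + linear_trace V g"
  unfolding linear_trace_eq by (simp add: vcoord_add vbasis_carr sum.distrib)

lemma trace_scale:
  "(\<And>x. x \<in> carr V \<Longrightarrow> f x \<in> carr V) \<Longrightarrow>
    linear_trace V (\<lambda>x. scal V c (f x)) = c * linear_trace V f"
  unfolding linear_trace_eq by (simp add: vcoord_scale vbasis_carr sum_distrib_left)

lemma trace_sum:
  "(\<And>i x. i \<in> I \<Longrightarrow> x \<in> carr V \<Longrightarrow> f i x \<in> carr V) \<Longrightarrow>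
    linear_trace V (\<lambda>x. \<Sum>i\<in>I. f i x) = (\<Sum>i\<in>I. linear_trace V (f i))"
  unfolding linear_trace_eq by (subst sum.swap) (simp add: vcoord_sum vbasis_carr)

lemma trace_id: "linear_trace V (\<lambda>x. x) = of_nat (card (vbasis V))"
  unfolding linear_trace_eq by (simp add: vcoord_basis)

end

lemma linear_map_add: "linear_map U V f \<Longrightarrow> x \<in> carr U \<Longrightarrow> y \<in> carr U \<Longrightarrow> f (x + y) = f x + f y"
  and linear_map_scale: "linear_map U V f \<Longrightarrow> x \<in> carr U \<Longrightarrow> f (scal U c x) = scal V c (f x)"
  and linear_map_carr: "linear_map U V f \<Longrightarrow> x \<in> carr U \<Longrightarrow> f x \<in> carr V"
  by (auto simp: linear_map_def)

lemma linear_map_zero: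
  assumes "is_vspace U" "linear_map U V f" shows "f 0 = 0"
proof -
  interpret vspace_carrier U using assms by unfold_locales
  have "f (0 + 0) = f 0 + f 0" using assms(2) by (intro linear_map_add) auto
  then show ?thesis by simp
qed

lemma linear_map_sum:
  assumes "is_vspace U" "linear_map U V f" "\<And>i. i \<in> I \<Longrightarrow> g i \<in> carr U"
  shows "f (\<Sum>i\<in>I. g i) = (\<Sum>i\<in>I. f (g i))"
proof -
  interpret vspace_carrier U using assms by unfold_locales
  show ?thesis using assms(3)
  proof (induction I rule: infinite_finite_induct)
    case (insert i I)
    then show ?case by (simp add: linear_map_add[OF assms(2)] carr_sum)
  qed (simp_all add: linear_map_zero[OF assms(1,2)])
qed

lemma linear_map_expand:
  assumes "fd_space U" "linear_map U V f" "x \<in> carr U"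
  shows "f x = (\<Sum>b\<in>vbasis U. scal V (vcoord U b x) (f b))"
proof -
  interpret fd_space U by fact
  have "f x = f (\<Sum>b\<in>vbasis U. scal U (vcoord U b x) b)"
    using assms(3) by (simp add: vcoord_expand)
  also have "\<dots> = (\<Sum>b\<in>vbasis U. f (scal U (vcoord U b x) b))"
    by (rule linear_map_sum[OF is_vspace assms(2)]) (auto simp: vbasis_carr)
  finally show ?thesis
    by (simp add: linear_map_scale[OF assms(2)] vbasis_carr)
qed

text \<open>Both sides are the same double sum of products of matrix entries. As the two spaces may
  differ, the trace of a map that factors through a subspace can be computed on that
  subspace.\<close>

lemma linear_trace_comm:
  assumes "fd_space U" "fd_space V" "linear_map U V f" "linear_map V U g"
  shows "linear_trace U (\<lambda>x. g (f x)) = linear_trace V (\<lambda>y. f (g y))"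
proof -
  interpret U: fd_space U by fact
  interpret V: fd_space V by fact
  have 1: "linear_trace U (\<lambda>x. g (f x)) =
    (\<Sum>b\<in>vbasis U. \<Sum>c\<in>vbasis V. vcoord V c (f b) * vcoord U b (g c))"
    unfolding linear_trace_eq
  proof (intro sum.cong refl)
    fix b assume "b \<in> vbasis U"
    then have "f b \<in> carr V" using assms(3) U.vbasis_carr linear_map_carr by blast
    then have "g (f b) = (\<Sum>c\<in>vbasis V. scal U (vcoord V c (f b)) (g c))"
      by (rule linear_map_expand[OF assms(2,4)])
    moreover have "c \<in> vbasis V \<Longrightarrow> g c \<in> carr U" for c
      using assms(4) V.vbasis_carr linear_map_carr by blast
    ultimately show "vcoord U b (g (f b)) = (\<Sum>c\<in>vbasis V. vcoord V c (f b) * vcoord U b (g c))"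
      by (simp add: U.vcoord_sum U.vcoord_scale U.carr_scale)
  qed
  have 2: "linear_trace V (\<lambda>y. f (g y)) =
    (\<Sum>c\<in>vbasis V. \<Sum>b\<in>vbasis U. vcoord U b (g c) * vcoord V c (f b))"
    unfolding linear_trace_eq
  proof (intro sum.cong refl)
    fix c assume "c \<in> vbasis V"
    then have "g c \<in> carr U" using assms(4) V.vbasis_carr linear_map_carr by blast
    then have "f (g c) = (\<Sum>b\<in>vbasis U. scal V (vcoord U b (g c)) (f b))"
      by (rule linear_map_expand[OF assms(1,3)])
    moreover have "b \<in> vbasis U \<Longrightarrow> f b \<in> carr V" for b
      using assms(3) U.vbasis_carr linear_map_carr by blast
    ultimately show "vcoord V c (f (g c)) = (\<Sum>b\<in>vbasis U. vcoord U b (g c) * vcoord V c (f b))"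
      by (simp add: V.vcoord_sum V.vcoord_scale V.carr_scale)
  qed
  show ?thesis unfolding 1 2 by (subst sum.swap) (simp add: mult.commute)
qed

context fd_space begin

lemma trace_rank_one:
  assumes "linear_map V ground p" "v \<in> carr V"
  shows "linear_trace V (\<lambda>x. scal V (p x) v) = p v"
proof -
  have "p v = (\<Sum>b\<in>vbasis V. vcoord V b v * p b)"
    using linear_map_expand[OF fd_space_axioms assms] by (simp add: ground_def)
  then show ?thesis
    unfolding linear_trace_eq by (simp add: vcoord_scale assms(2) mult.commute)
qed

lemma fd_subspace:
  assumes "subspace W" "W \<subseteq> carr V"
  shows "fd_space \<lparr>carr = W, scal = scal V\<rparr>"
proof unfold_locales
  show "is_vspace \<lparr>carr = W, scal = scal V\<rparr>"
    using assms(1) vector_space_axioms by (simp add: is_vspace_def)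
  obtain B where B: "B \<subseteq> W" "independent B" "W \<subseteq> span B"
    using maximal_independent_subset by blast
  have "finite B"
    using independent_span_bound[OF finite_vbasis B(2)] B(1) assms(2) carr_span
    by (meson subset_eq)
  with B show "fin_dim \<lparr>carr = W, scal = scal V\<rparr>"
    by (auto simp: fin_dim_def)
qed

text \<open>Factoring \<open>P\<close> through its image and cycling turns the trace into that of
  the identity of the image. The second part speaks of the natural number \<open>n\<close> because
  its value in the field could vanish in positive characteristic.\<close>

lemma trace_idempotent:
  assumes P: "linear_map V V P" and idem: "\<And>x. x \<in> carr V \<Longrightarrow> P (P x) = P x"
  obtains n where "linear_trace V P = of_nat n" "n = 0 \<Longrightarrow> \<forall>x\<in>carr V. P x = 0"
proof -
  let ?W = "\<lparr>carr = P ` carr V, scal = scal V\<rparr>"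
  have sub: "subspace (P ` carr V)"
  proof (rule subspaceI)
    show "0 \<in> P ` carr V"
      using linear_map_zero[OF is_vspace P] carr_zero by (intro image_eqI[of _ _ 0]) simp_all
    show "x + y \<in> P ` carr V" if "x \<in> P ` carr V" "y \<in> P ` carr V" for x y
      using that by (auto simp flip: linear_map_add[OF P])
    show "scal V c x \<in> P ` carr V" if "x \<in> P ` carr V" for c x
      using that by (auto simp flip: linear_map_scale[OF P])
  qed
  have le: "P ` carr V \<subseteq> carr V" using P linear_map_carr by blast
  interpret W: fd_space ?W by (rule fd_subspace[OF sub le])
  have "linear_trace V (\<lambda>x. (\<lambda>y. y) (P x)) = linear_trace ?W (\<lambda>y. P y)"
    using P le by (intro linear_trace_comm[OF fd_space_axioms W.fd_space_axioms])
      (auto simp: linear_map_def)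
  also have "\<dots> = linear_trace ?W (\<lambda>y. y)"
    using idem by (intro W.trace_cong) auto
  finally have tr: "linear_trace V P = of_nat (card (vbasis ?W))"
    by (simp add: W.trace_id)
  show ?thesis
  proof (rule that[OF tr])
    assume "card (vbasis ?W) = 0"
    then have B: "vbasis ?W = {}" by simp
    show "\<forall>x\<in>carr V. P x = 0"
    proof
      fix x assume "x \<in> carr V"
      then have "P x \<in> span (vbasis ?W)" using W.carr_span[of "P x"] by (simp only: vspace.simps imageI)
      then show "P x = 0" by (simp only: B span_empty singleton_iff)
    qed
  qed
qed

end

lemma (in fd_space) vcoord_lincomb:
  "b \<in> vbasis V \<Longrightarrow> vcoord V b (\<Sum>c\<in>vbasis V. scal V (g c) c) = g b"
  by (simp add: vcoord_sum vcoord_scale carr_scale vbasis_carr vcoord_basis if_distrib cong: if_cong)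

lemma (in fd_space) linear_eq_on_basis:
  assumes "linear_map V W f" "linear_map V W g" "\<And>b. b \<in> vbasis V \<Longrightarrow> f b = g b" "x \<in> carr V"
  shows "f x = g x"
  using linear_map_expand[OF fd_space_axioms assms(1,4)] linear_map_expand[OF fd_space_axioms assms(2,4)]
    assms(3) by simp

text \<open>The image of a basis is independent and of full size, so a vector outside its span would
  give too large an independent set.\<close>

lemma (in fd_space) linear_inj_surj:
  assumes f: "linear_map V V f" and inj: "\<And>x. x \<in> carr V \<Longrightarrow> f x = 0 \<Longrightarrow> x = 0" and y: "y \<in> carr V"
  shows "\<exists>x\<in>carr V. f x = y"
proof -
  let ?B = "vbasis V"
  have inj_on: "inj_on f ?B"
  proof (rule inj_onI)
    fix a b assume ab: "a \<in> ?B" "b \<in> ?B" "f a = f b"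
    then have "f (a - b) + f b = f b"
      using linear_map_add[OF f, of "a - b" b] by (simp add: carr_diff vbasis_carr)
    then have "f (a - b) = 0" by simp
    then show "a = b" using inj[of "a - b"] ab by (simp add: carr_diff vbasis_carr)
  qed
  have sum: "(\<Sum>b\<in>?B. scal V (u b) (f b)) = f (\<Sum>b\<in>?B. scal V (u b) b)" for u
    by (subst linear_map_sum[OF is_vspace f])
      (simp_all add: carr_scale vbasis_carr linear_map_scale[OF f])
  have ind: "independent (f ` ?B)"
  proof
    assume "dependent (f ` ?B)"
    then obtain u where u: "\<exists>w\<in>f ` ?B. u w \<noteq> 0" "(\<Sum>w\<in>f ` ?B. scal V (u w) w) = 0"
      by (subst (asm) dependent_finite) auto
    then have "f (\<Sum>b\<in>?B. scal V (u (f b)) b) = 0"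
      using inj_on by (simp add: sum.reindex sum)
    then have "(\<Sum>b\<in>?B. scal V (u (f b)) b) = 0"
      by (rule inj[rotated]) (simp add: carr_sum carr_scale vbasis_carr)
    then have "\<forall>b\<in>?B. u (f b) = 0"
      using independentD[OF independent_vbasis finite_vbasis order_refl, of "\<lambda>b. u (f b)"] by simp
    with u(1) show False by blast
  qed
  have sub: "f ` ?B \<subseteq> span ?B"
    using carr_span[OF linear_map_carr[OF f vbasis_carr]] by (intro image_subsetI)
  have "y \<in> span (f ` ?B)"
  proof (rule ccontr)
    assume y': "y \<notin> span (f ` ?B)"
    then have "independent (insert y (f ` ?B))" using ind by (rule independent_insertI)
    moreover have "insert y (f ` ?B) \<subseteq> span ?B" using sub carr_span[OF y] by simp
    ultimately have "card (insert y (f ` ?B)) \<le> card ?B"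
      using independent_span_bound[OF finite_vbasis] by simp
    moreover have "y \<notin> f ` ?B" using y' span_base by blast
    ultimately show False using inj_on by (simp add: card_image)
  qed
  then obtain u where "y = (\<Sum>w\<in>f ` ?B. scal V (u w) w)"
    by (auto simp: span_finite)
  then have "f (\<Sum>b\<in>?B. scal V (u (f b)) b) = y"
    using inj_on by (simp add: sum.reindex sum)
  moreover have "(\<Sum>b\<in>?B. scal V (u (f b)) b) \<in> carr V"
    by (simp add: carr_sum carr_scale vbasis_carr)
  ultimately show ?thesis by blast
qed

section \<open>Eigenvectors\<close>

text \<open>With \<open>n\<close> the dimension, the \<open>n + 1\<close> vectors
  \<open>v 0, ..., v n\<close> are too many to be independent.\<close>

lemma (in fd_space) exists_annihilating_poly:
  assumes v: "\<And>i. v i \<in> carr V"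
  shows "\<exists>u n. (\<exists>i\<le>n. u i \<noteq> 0) \<and> (\<Sum>i\<le>(n::nat). scal V (u i) (v i)) = 0"
proof -
  define n where "n = card (vbasis V)"
  show ?thesis
  proof (cases "inj_on v {..n}")
    case True
    have "dependent (v ` {..n})"
    proof (rule ccontr)
      assume "independent (v ` {..n})"
      then have "card (v ` {..n}) \<le> card (vbasis V)"
        using independent_span_bound[OF finite_vbasis] v carr_span by (metis image_subsetI)
      with True show False by (simp add: card_image n_def)
    qed
    then obtain u where u: "\<exists>w\<in>v ` {..n}. u w \<noteq> 0" "(\<Sum>w\<in>v ` {..n}. scal V (u w) w) = 0"
      by (subst (asm) dependent_finite) auto
    then have "(\<Sum>i\<le>n. scal V (u (v i)) (v i)) = 0"
      using True by (simp add: sum.reindex)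
    with u(1) show ?thesis by (intro exI[of _ "\<lambda>i. u (v i)"] exI[of _ n]) auto
  next
    \<comment> \<open>Dependence of a set does not see repetitions, so a repeated vector gets the
      explicit relation with coefficients \<open>1\<close> and \<open>-1\<close>.\<close>
    case False
    then obtain i j where ij: "i \<le> n" "j \<le> n" "i \<noteq> j" "v i = v j"
      by (auto simp: inj_on_def)
    define u :: "nat \<Rightarrow> 'a" where "u = (\<lambda>k. if k = i then 1 else if k = j then -1 else 0)"
    have "(\<Sum>k\<le>n. scal V (u k) (v k)) = (\<Sum>k\<in>{i, j}. scal V (u k) (v k))"
      using ij by (intro sum.mono_neutral_right) (auto simp: u_def)
    also have "\<dots> = 0" using ij by (simp add: u_def)
    finally show ?thesis
      using ij by (intro exI[of _ u] exI[of _ n]) (auto simp: u_def)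
  qed
qed

text \<open>A polynomial of least degree annihilating one vector \<open>x0\<close> has a root
  \<open>z\<close>; its quotient by \<open>X - z\<close> sends \<open>x0\<close> to an eigenvector
  for \<open>z\<close>.\<close>

lemma exists_eigenvector:
  fixes V :: "('k::alg_closed_field, 'v::ab_group_add, 'z) vspace_scheme"
  assumes V: "fd_space V" and f: "linear_map V V f" and ne: "carr V \<noteq> {0}"
  shows "\<exists>c x. x \<in> carr V \<and> x \<noteq> 0 \<and> f x = scal V c x"
proof -
  interpret fd_space V by fact
  obtain x0 where x0: "x0 \<in> carr V" "x0 \<noteq> 0" using ne carr_zero by blast
  have f0: "f 0 = 0" by (rule linear_map_zero[OF is_vspace f])
  \<comment> \<open>\<open>ev p\<close> is the vector \<open>p(f) x0\<close>, computed by Horner's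
    scheme.\<close>
  define ev where "ev p = fold_coeffs (\<lambda>a y. scal V a x0 + f y) p 0" for p :: "'k poly"
  have ev_0: "ev 0 = 0" by (simp add: ev_def)
  have ev_pCons: "ev (pCons a p) = scal V a x0 + f (ev p)" for a p
    by (cases "a = 0 \<and> p = 0") (auto simp: ev_def f0 fold_coeffs_pCons_eq)
  have ev_carr: "ev p \<in> carr V" for p
    by (induction p) (auto simp: ev_0 ev_pCons intro!: carr_add carr_scale x0 linear_map_carr[OF f])
  have ev_add: "ev (p + q) = ev p + ev q" for p q
    by (induction p q rule: poly_induct2)
      (simp_all add: ev_0 ev_pCons linear_map_add[OF f ev_carr ev_carr] scale_left_distrib)
  have ev_smult: "ev (smult c p) = scal V c (ev p)" for c p
    by (induction p)
      (simp_all add: ev_0 ev_pCons linear_map_scale[OF f ev_carr] scale_right_distrib)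
  have ev_monom: "ev (monom c i) = scal V c ((f ^^ i) x0)" for c i
  proof (induction i)
    case (Suc i)
    have "(f ^^ i) x0 \<in> carr V" for i by (induction i) (use x0 linear_map_carr[OF f] in auto)
    with Suc show ?case by (simp add: monom_Suc ev_pCons linear_map_scale[OF f])
  qed (simp add: monom_0 ev_pCons ev_0 f0)
  have ev_sum: "ev (\<Sum>i\<in>I. g i) = (\<Sum>i\<in>I. ev (g i))" for g :: "nat \<Rightarrow> 'k poly" and I
    by (induction I rule: infinite_finite_induct) (simp_all add: ev_0 ev_add)
  have "(f ^^ i) x0 \<in> carr V" for i by (induction i) (use x0 linear_map_carr[OF f] in auto)
  from exists_annihilating_poly[of "\<lambda>i. (f ^^ i) x0", OF this]
  obtain u n where u: "\<exists>i\<le>n. u i \<noteq> 0" "(\<Sum>i\<le>n. scal V (u i) ((f ^^ i) x0)) = 0" by blast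
  define p0 where "p0 = (\<Sum>i\<le>n. monom (u i) i)"
  have "ev p0 = 0" using u(2) by (simp add: p0_def ev_sum ev_monom)
  moreover have "p0 \<noteq> 0"
  proof -
    obtain i where i: "i \<le> n" "u i \<noteq> 0" using u(1) by blast
    have "coeff p0 i = u i"
      using i by (simp add: p0_def coeff_sum if_distrib cong: if_cong)
    with i show ?thesis by auto
  qed
  ultimately have "\<exists>p. p \<noteq> 0 \<and> ev p = 0" by blast
  then obtain p' where "p' \<noteq> 0 \<and> ev p' = 0" by blast
  from ex_has_least_nat[of "\<lambda>p. p \<noteq> 0 \<and> ev p = 0", OF this, of degree]
  obtain p where p: "p \<noteq> 0" "ev p = 0"
    and min: "\<And>q. q \<noteq> 0 \<Longrightarrow> ev q = 0 \<Longrightarrow> degree p \<le> degree q" by blast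
  have "degree p > 0"
  proof (rule ccontr)
    assume "\<not> degree p > 0"
    then obtain a where "p = [:a:]" by (metis degree_eq_zeroE neq0_conv)
    with p x0 show False by (simp add: ev_pCons ev_0 f0)
  qed
  then obtain z where "poly p z = 0" using alg_closed_imp_poly_has_root by blast
  then obtain q where q: "p = [:-z, 1:] * q" by (metis dvdE poly_eq_0_iff_dvd)
  with p have q0: "q \<noteq> 0" by auto
  have "degree p = Suc (degree q)" unfolding q using q0 by (subst degree_mult_eq) auto
  with min q0 have evq: "ev q \<noteq> 0" by force
  have "p = smult (- z) q + pCons 0 q" unfolding q by simp
  then have "ev p = scal V (- z) (ev q) + ev (pCons 0 q)"
    by (simp only: ev_add ev_smult)
  then have "ev p = - scal V z (ev q) + f (ev q)"
    by (simp add: ev_pCons)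
  with p(2) have "f (ev q) = scal V z (ev q)" by (metis add.inverse_inverse add_eq_0_iff)
  with evq ev_carr[of q] show ?thesis by blast
qed

section \<open>Tensor products\<close>

text \<open>If \<open>x - y\<close> is non-zero, it extends to a basis, and the coordinate along it
  takes the value 1 there.\<close>

lemma (in vector_space) functionals_separate:
  assumes "\<And>\<phi>. Vector_Spaces.linear scale (*) \<phi> \<Longrightarrow> \<phi> x = \<phi> y"
  shows "x = y"
proof (rule ccontr)
  assume "x \<noteq> y"
  then have ind: "independent {x - y}" by simp
  let ?B = "extend_basis {x - y}"
  define \<phi> where "\<phi> v = representation ?B v (x - y)" for v
  have "x - y \<in> ?B" using extend_basis_superset[OF ind] by simp
  then have 1: "\<phi> (x - y) = 1"
    unfolding \<phi>_def by (simp add: representation_basis[OF independent_extend_basis[OF ind]])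
  have lin: "Vector_Spaces.linear scale (*) \<phi>"
    unfolding \<phi>_def by (rule linear_representation[OF independent_extend_basis[OF ind] span_extend_basis[OF ind]])
  then interpret Vector_Spaces.linear scale "(*)" \<phi> .
  have "\<phi> (x - y) = 0" using assms[OF lin] by (simp add: diff)
  with 1 show False by simp
qed

lemma ptscale_vector_space: "vector_space ptscale"
  by unfold_locales (auto simp: ptscale_def algebra_simps)

lemma is_vspace_ground: "is_vspace ground"
proof -
  interpret vector_space "(*) :: 'a \<Rightarrow> 'a \<Rightarrow> 'a"
    by unfold_locales (auto simp: algebra_simps)
  show ?thesis
    by (simp add: is_vspace_def ground_def vector_space_axioms)
qed

lemma is_vspace_tensor_space: "is_vspace (tensor_space U V)"
proof -
  interpret vector_space ptscale by (rule ptscale_vector_space)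
  show ?thesis
    by (simp add: is_vspace_def tensor_space_def vector_space_axioms subspace_span)
qed

lemma tens_carr: "u \<in> carr U \<Longrightarrow> v \<in> carr V \<Longrightarrow> tens U V u v \<in> carr (tensor_space U V)"
proof -
  interpret vector_space ptscale by (rule ptscale_vector_space)
  show "u \<in> carr U \<Longrightarrow> v \<in> carr V \<Longrightarrow> ?thesis"
    unfolding tensor_space_def by (auto intro: span_base)
qed

lemma scal_tensor_space [simp]: "scal (tensor_space U V) = ptscale"
  by (simp add: tensor_space_def)

lemma bilinear_mapD:
  assumes "bilinear_map U V W f"
  shows "v \<in> carr V \<Longrightarrow> linear_map U W (\<lambda>u. f u v)" "u \<in> carr U \<Longrightarrow> linear_map V W (f u)"
  using assms by (auto simp: bilinear_map_def)

lemma bilinear_tens: "bilinear_map U V (tensor_space U V) (tens U V)"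
proof -
  have *: "tens U V (u + u') v = tens U V u v + tens U V u' v"
    "tens U V (scal U c u) v = ptscale c (tens U V u v)"
    if "u \<in> carr U" "u' \<in> carr U" "v \<in> carr V" for u u' v c
    using that by (auto simp: tens_def ptscale_def fun_eq_iff bilinear_map_def linear_map_def ground_def)
  have **: "tens U V u (v + v') = tens U V u v + tens U V u v'"
    "tens U V u (scal V c v) = ptscale c (tens U V u v)"
    if "u \<in> carr U" "v \<in> carr V" "v' \<in> carr V" for u v v' c
    using that by (auto simp: tens_def ptscale_def fun_eq_iff bilinear_map_def linear_map_def ground_def)
  show ?thesis
    by (simp add: bilinear_map_def linear_map_def * ** tens_carr)
qed

lemma tens_list_apply:
  assumes "bilinear_map U V ground \<beta>"
  shows "(\<Sum>(u, v)\<leftarrow>ps. tens U V u v) \<beta> = (\<Sum>(u, v)\<leftarrow>ps. \<beta> u v)"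
  by (induction ps) (auto simp: assms tens_def)

lemma tens_list_carr:
  assumes "set ps \<subseteq> carr U \<times> carr V"
  shows "(\<Sum>(u, v)\<leftarrow>ps. tens U V u v) \<in> carr (tensor_space U V)"
proof -
  interpret vspace_carrier "tensor_space U V"
    by unfold_locales (rule is_vspace_tensor_space)
  show ?thesis using assms
    by (induction ps) (auto intro!: carr_add tens_carr)
qed

text \<open>Bilinear forms separate tensors by construction; for a general target one composes with
  linear functionals.\<close>

lemma tens_list_cong:
  assumes "vector_space (scal W)" "bilinear_map U V W f"
    and "set ps \<subseteq> carr U \<times> carr V" "set qs \<subseteq> carr U \<times> carr V"
    and eq: "(\<Sum>(u, v)\<leftarrow>ps. tens U V u v) = (\<Sum>(u, v)\<leftarrow>qs. tens U V u v)"
  shows "(\<Sum>(u, v)\<leftarrow>ps. f u v) = (\<Sum>(u, v)\<leftarrow>qs. f u v)"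
proof (rule vector_space.functionals_separate[OF assms(1)])
  fix \<phi> assume "Vector_Spaces.linear (scal W) (*) \<phi>"
  then interpret Vector_Spaces.linear "scal W" "(*)" \<phi> .
  have b: "bilinear_map U V ground (\<lambda>u v. \<phi> (f u v))"
    using assms(2) by (simp add: bilinear_map_def linear_map_def ground_def add scale)
  have *: "\<phi> (\<Sum>(u, v)\<leftarrow>rs. f u v) = (\<Sum>(u, v)\<leftarrow>rs. \<phi> (f u v))" for rs
    by (induction rs) (auto simp: add)
  show "\<phi> (\<Sum>(u, v)\<leftarrow>ps. f u v) = \<phi> (\<Sum>(u, v)\<leftarrow>qs. f u v)"
    using fun_cong[OF eq] unfolding * tens_list_apply[OF b, symmetric] .
qed

lemma tensor_lift_list:
  assumes "vector_space (scal W)" "bilinear_map U V W f" "set ps \<subseteq> carr U \<times> carr V"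
  shows "tensor_lift U V f (\<Sum>(u, v)\<leftarrow>ps. tens U V u v) = (\<Sum>(u, v)\<leftarrow>ps. f u v)"
proof -
  let ?P = "\<lambda>qs. set qs \<subseteq> carr U \<times> carr V \<and>
    (\<Sum>(u, v)\<leftarrow>qs. tens U V u v) = (\<Sum>(u, v)\<leftarrow>ps. tens U V u v)"
  have "?P (Eps ?P)" using assms(3) by (intro someI[of ?P ps]) simp
  then show ?thesis
    unfolding tensor_lift_def by (intro tens_list_cong[OF assms(1,2) _ assms(3)]) simp_all
qed

lemma tensor_lift_tens:
  assumes "vector_space (scal W)" "bilinear_map U V W f" "u \<in> carr U" "v \<in> carr V"
  shows "tensor_lift U V f (tens U V u v) = f u v"
  using tensor_lift_list[OF assms(1,2), of "[(u, v)]"] assms(3,4) by simp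

lemma tensor_decomp:
  assumes "is_vspace U" "t \<in> carr (tensor_space U V)"
  shows "\<exists>ps. set ps \<subseteq> carr U \<times> carr V \<and> (\<Sum>(u, v)\<leftarrow>ps. tens U V u v) = t"
proof -
  interpret vector_space ptscale by (rule ptscale_vector_space)
  interpret U: vspace_carrier U using assms by unfold_locales
  have "t \<in> span {tens U V u v | u v. u \<in> carr U \<and> v \<in> carr V}"
    using assms(2) by (simp add: tensor_space_def)
  then show ?thesis
  proof (induction rule: span_induct_alt)
    case base
    show ?case by (intro exI[of _ "[]"]) simp
  next
    case (step c x y)
    then obtain u v ps where *: "u \<in> carr U" "v \<in> carr V" "x = tens U V u v"
      "set ps \<subseteq> carr U \<times> carr V" "(\<Sum>(u, v)\<leftarrow>ps. tens U V u v) = y" by blast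
    have "ptscale c x = tens U V (scal U c u) v"
      using linear_map_scale[OF bilinear_mapD(1)[OF bilinear_tens *(2)] *(1)] *(3) by simp
    with * show ?case by (intro exI[of _ "(scal U c u, v) # ps"]) auto
  qed
qed

text \<open>\<open>tensor_lift\<close> evaluates on a chosen decomposition, and
  \<open>tensor_lift_list\<close> allows any other: concatenated lists decompose a sum, and scaled
  first factors decompose a multiple.\<close>

lemma linear_tensor_lift:
  assumes "is_vspace U" "is_vspace W" "bilinear_map U V W f"
  shows "linear_map (tensor_space U V) W (tensor_lift U V f)"
proof -
  interpret U: vspace_carrier U using assms by unfold_locales
  interpret W: vspace_carrier W using assms by unfold_locales
  note lift = tensor_lift_list[OF W.vector_space_axioms assms(3)]
  have carr: "tensor_lift U V f t \<in> carr W" if t: "t \<in> carr (tensor_space U V)" for t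
  proof -
    obtain ps where ps: "set ps \<subseteq> carr U \<times> carr V" "(\<Sum>(u, v)\<leftarrow>ps. tens U V u v) = t"
      using tensor_decomp[OF assms(1) t] by blast
    have "(\<Sum>(u, v)\<leftarrow>ps. f u v) \<in> carr W" using ps(1)
      by (induction ps)
        (auto intro!: W.carr_add linear_map_carr[OF bilinear_mapD(2)[OF assms(3)]])
    then show ?thesis using lift[OF ps(1)] ps(2) by simp
  qed
  have add: "tensor_lift U V f (s + t) = tensor_lift U V f s + tensor_lift U V f t"
    if s: "s \<in> carr (tensor_space U V)" and t: "t \<in> carr (tensor_space U V)" for s t
  proof -
    obtain ps where ps: "set ps \<subseteq> carr U \<times> carr V" "(\<Sum>(u, v)\<leftarrow>ps. tens U V u v) = s"
      using tensor_decomp[OF assms(1) s] by blast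
    obtain qs where qs: "set qs \<subseteq> carr U \<times> carr V" "(\<Sum>(u, v)\<leftarrow>qs. tens U V u v) = t"
      using tensor_decomp[OF assms(1) t] by blast
    show ?thesis
      using lift[OF ps(1)] lift[OF qs(1)] lift[of "ps @ qs"] ps qs by simp
  qed
  have scale: "tensor_lift U V f (ptscale c t) = scal W c (tensor_lift U V f t)"
    if t: "t \<in> carr (tensor_space U V)" for c t
  proof -
    obtain ps where ps: "set ps \<subseteq> carr U \<times> carr V" "(\<Sum>(u, v)\<leftarrow>ps. tens U V u v) = t"
      using tensor_decomp[OF assms(1) t] by blast
    let ?qs = "map (\<lambda>(u, v). (scal U c u, v)) ps"
    have 1: "set ?qs \<subseteq> carr U \<times> carr V" using ps(1) by auto
    have "(\<Sum>(u, v)\<leftarrow>?qs. tens U V u v) = ptscale c t" using ps(1) unfolding ps(2)[symmetric]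
    proof (induction ps)
      case Nil then show ?case by (simp add: ptscale_def fun_eq_iff)
    next
      case (Cons p ps)
      obtain u v where p: "p = (u, v)" by (cases p)
      have "tens U V (scal U c u) v = ptscale c (tens U V u v)"
        using Cons.prems p linear_map_scale[OF bilinear_mapD(1)[OF bilinear_tens]] by fastforce
      moreover have "(\<Sum>(u, v)\<leftarrow>map (\<lambda>(u, v). (scal U c u, v)) ps. tens U V u v)
          = ptscale c (\<Sum>(u, v)\<leftarrow>ps. tens U V u v)" using Cons by simp
      ultimately show ?case
        by (simp add: p ptscale_def fun_eq_iff algebra_simps)
    qed
    moreover have "(\<Sum>(u, v)\<leftarrow>?qs. f u v) = scal W c (\<Sum>(u, v)\<leftarrow>ps. f u v)" using ps(1)
    proof (induction ps)
      case (Cons p ps)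
      obtain u v where p: "p = (u, v)" by (cases p)
      have "f (scal U c u) v = scal W c (f u v)"
        using Cons.prems p linear_map_scale[OF bilinear_mapD(1)[OF assms(3)]] by auto
      with Cons p show ?case by (simp add: W.scale_right_distrib)
    qed simp
    ultimately show ?thesis
      using lift[OF ps(1)] lift[OF 1] ps(2) by simp
  qed
  show ?thesis by (simp add: linear_map_def carr add scale)
qed

section \<open>Sweedler calculus\<close>

text \<open>Linearity on whole types, in terms of the two scalings alone. Without carrier
  conditions, the many linearity side goals can be closed by \<open>intro lin_intros\<close> from
  the shape of the term.\<close>

definition lin :: "('k \<Rightarrow> 'u \<Rightarrow> 'u) \<Rightarrow> ('k \<Rightarrow> 'w \<Rightarrow> 'w) \<Rightarrow> ('u::ab_group_add \<Rightarrow> 'w::ab_group_add) \<Rightarrow> bool"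
  where "lin s t f \<longleftrightarrow> (\<forall>x y. f (x + y) = f x + f y) \<and> (\<forall>c x. f (s c x) = t c (f x))"

named_theorems lin_intros

lemma lin_add: "lin s t f \<Longrightarrow> f (x + y) = f x + f y"
  and lin_scale: "lin s t f \<Longrightarrow> f (s c x) = t c (f x)"
  by (auto simp: lin_def)

lemma lin_zero: "lin s t f \<Longrightarrow> f 0 = 0"
  using lin_add[of s t f 0 0] by simp

lemma lin_diff: "lin s t f \<Longrightarrow> f (x - y) = f x - f y"
  using lin_add[of s t f "x - y" y] by (simp add: algebra_simps)

lemma lin_sum: "lin s t f \<Longrightarrow> f (\<Sum>i\<in>I. g i) = (\<Sum>i\<in>I. f (g i))"
  by (induction I rule: infinite_finite_induct) (simp_all add: lin_zero lin_add)

lemma lin_comp: "lin t u f \<Longrightarrow> lin s t g \<Longrightarrow> lin s u (\<lambda>x. f (g x))"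
  by (simp add: lin_def)

lemma lin_id [lin_intros]: "lin s s (\<lambda>x. x)"
  by (simp add: lin_def)

lemma lin_plus: "vector_space t \<Longrightarrow> lin s t f \<Longrightarrow> lin s t g \<Longrightarrow> lin s t (\<lambda>x. f x + g x)"
  by (simp add: lin_def vector_space_def algebra_simps)

lemma lin_sums:
  assumes "vector_space t" "\<And>i. i \<in> I \<Longrightarrow> lin s t (f i)"
  shows "lin s t (\<lambda>x. \<Sum>i\<in>I. f i x)"
proof -
  interpret vector_space t by fact
  show ?thesis using assms(2)
    by (induction I rule: infinite_finite_induct) (simp_all add: lin_def scale_right_distrib)
qed

lemma lin_mult_field [lin_intros]:
  fixes f :: "'u::ab_group_add \<Rightarrow> 'k::field"
  shows "lin s (*) f \<Longrightarrow> lin s (*) (\<lambda>x. f x * c)"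
    and "lin s (*) f \<Longrightarrow> lin s (*) (\<lambda>x. c * f x)"
  by (simp_all add: lin_def algebra_simps)

lemma vector_space_mult: "vector_space ((*) :: 'k::field \<Rightarrow> 'k \<Rightarrow> 'k)"
  using is_vspace_ground is_vspace_vector_space by (fastforce simp: ground_def)

locale hopf =
  fixes H :: "('k::field, 'h::ring_1) hopf"
  assumes hopf: "hopf_algebra H"
begin

abbreviation hscale (infixr "\<odot>" 75) where "c \<odot> x \<equiv> scal H c x"
abbreviation "sw \<equiv> sweedler H"
abbreviation "\<epsilon> \<equiv> counit H"
abbreviation "S \<equiv> antipode H"
abbreviation "hlin \<equiv> lin (scal H)"

lemma is_vspace_H: "is_vspace H" and carr_H [simp]: "carr H = UNIV"
  using hopf by (simp_all add: hopf_algebra_def)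

sublocale H: vspace_carrier H
  using is_vspace_H by unfold_locales

lemma scale_mult_left: "(c \<odot> x) * y = c \<odot> (x * y)"
  and scale_mult_right: "x * (c \<odot> y) = c \<odot> (x * y)"
  using hopf unfolding hopf_algebra_def by metis+

lemma linear_map_iff_lin: "carr W = UNIV \<Longrightarrow> linear_map H W f \<longleftrightarrow> hlin (scal W) f"
  by (simp add: linear_map_def lin_def)

lemma hlin_mult [lin_intros]:
  "lin s (scal H) f \<Longrightarrow> lin s (scal H) (\<lambda>x. f x * y)"
  "lin s (scal H) f \<Longrightarrow> lin s (scal H) (\<lambda>x. y * f x)"
  by (simp_all add: lin_def algebra_simps scale_mult_left scale_mult_right)

lemma lin_counit: "hlin (*) \<epsilon>"
  using hopf by (simp add: hopf_algebra_def algebra_map_def linear_map_def ground_def lin_def)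

lemma lin_antipode: "hlin (scal H) S"
  using hopf by (simp add: hopf_algebra_def linear_map_def lin_def)

lemmas lin_counit_comp [lin_intros] = lin_comp[OF lin_counit]
lemmas lin_antipode_comp [lin_intros] = lin_comp[OF lin_antipode]

lemma lin_hscale [lin_intros]:
  "lin s (scal H) f \<Longrightarrow> lin s (scal H) (\<lambda>x. c \<odot> f x)"
  "lin s (*) g \<Longrightarrow> lin s (scal H) (\<lambda>x. g x \<odot> y)"
  by (simp_all add: lin_def H.scale_right_distrib H.scale_left_distrib mult.commute)

lemma counit_mult: "\<epsilon> (x * y) = \<epsilon> x * \<epsilon> y" and counit_1: "\<epsilon> 1 = 1"
  using hopf by (simp_all add: hopf_algebra_def algebra_map_def)

lemma comult_carr: "comult H h \<in> carr (tensor_space H H)"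
  using hopf by (auto simp: hopf_algebra_def linear_map_def)

lemma is_vspace_UNIV: "vector_space t \<Longrightarrow> is_vspace \<lparr>carr = UNIV, scal = t\<rparr>"
proof -
  assume "vector_space t"
  then interpret vector_space t .
  show ?thesis by (simp add: is_vspace_def vector_space_axioms)
qed

lemma bilinearI:
  assumes "\<And>y. hlin t (\<lambda>x. f x y)" "\<And>x. hlin t (f x)"
  shows "bilinear_map H H \<lparr>carr = UNIV, scal = t\<rparr> f"
  using assms by (simp add: bilinear_map_def linear_map_def lin_def)

text \<open>The same choice term as inside \<open>tensor_lift\<close>, so every Sweedler sum at
  \<open>h\<close> is a sum over one fixed list. Additivity, exchange of sums and pushing linear
  maps inside then hold for arbitrary \<open>f\<close>; multilinearity is required only where the
  comultiplication axioms come in.\<close>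

definition cop :: "'h \<Rightarrow> ('h \<times> 'h) list" where
  "cop h = (SOME ps. set ps \<subseteq> carr H \<times> carr H \<and> (\<Sum>(u, v)\<leftarrow>ps. tens H H u v) = comult H h)"

lemma sw_cop: "sw f h = (\<Sum>(a, b)\<leftarrow>cop h. f a b)"
  unfolding sweedler_def tensor_lift_def cop_def ..

lemma sw_linear_map:
  assumes "is_vspace U" "linear_map U W \<phi>" "\<And>a b. f a b \<in> carr U"
  shows "\<phi> (sw f h) = sw (\<lambda>a b. \<phi> (f a b)) h"
proof -
  interpret U: vspace_carrier U using assms by unfold_locales
  have "(\<Sum>(a, b)\<leftarrow>ps. f a b) \<in> carr U \<and>
    \<phi> (\<Sum>(a, b)\<leftarrow>ps. f a b) = (\<Sum>(a, b)\<leftarrow>ps. \<phi> (f a b))" for ps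
    by (induction ps)
      (auto simp: linear_map_zero[OF assms(1,2)] linear_map_add[OF assms(2)] assms(3) U.carr_add)
  then show ?thesis unfolding sw_cop by simp
qed

lemma sw_carr:
  assumes "is_vspace U" "\<And>a b. f a b \<in> carr U"
  shows "sw f h \<in> carr U"
proof -
  interpret U: vspace_carrier U using assms by unfold_locales
  have "(\<Sum>(a, b)\<leftarrow>ps. f a b) \<in> carr U" for ps
    by (induction ps) (auto simp: assms(2) U.carr_add)
  then show ?thesis unfolding sw_cop .
qed

lemma sw_lin: "lin s t \<phi> \<Longrightarrow> \<phi> (sw f h) = sw (\<lambda>a b. \<phi> (f a b)) h"
  for \<phi> :: "'u::ab_group_add \<Rightarrow> 'w::ab_group_add"
proof -
  assume \<phi>: "lin s t \<phi>"
  have "\<phi> (\<Sum>(a, b)\<leftarrow>ps. f a b) = (\<Sum>(a, b)\<leftarrow>ps. \<phi> (f a b))" for ps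
    by (induction ps) (auto simp: lin_zero[OF \<phi>] lin_add[OF \<phi>])
  then show ?thesis unfolding sw_cop by simp
qed

lemma sw_add: "sw (\<lambda>a b. f a b + g a b) h = sw f h + sw g h"
  unfolding sw_cop by (simp add: sum_list_addf case_prod_unfold)

lemma sw_sum: "sw (\<lambda>a b. \<Sum>i\<in>I. f i a b) h = (\<Sum>i\<in>I. sw (f i) h)"
proof -
  have "(\<Sum>(a, b)\<leftarrow>ps. \<Sum>i\<in>I. f i a b) = (\<Sum>i\<in>I. \<Sum>(a, b)\<leftarrow>ps. f i a b)" for ps
    by (induction ps) (auto simp: sum.distrib)
  then show ?thesis unfolding sw_cop by simp
qed

lemma sw_swap: "sw (\<lambda>a b. sw (\<lambda>c d. f a b c d) k) h = sw (\<lambda>c d. sw (\<lambda>a b. f a b c d) h) k"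
proof -
  have "(\<Sum>(a, b)\<leftarrow>ps. \<Sum>(c, d)\<leftarrow>qs. f a b c d) = (\<Sum>(c, d)\<leftarrow>qs. \<Sum>(a, b)\<leftarrow>ps. f a b c d)" for ps qs
    by (induction ps) (auto simp: sum_list_addf case_prod_unfold)
  then show ?thesis unfolding sw_cop by simp
qed

lemma sw_mult_left: "x * sw f h = sw (\<lambda>a b. x * f a b) h"
  and sw_mult_right: "sw f h * x = sw (\<lambda>a b. f a b * x) h"
  for x :: "'r::ring"
proof -
  have "x * (\<Sum>(a, b)\<leftarrow>ps. f a b) = (\<Sum>(a, b)\<leftarrow>ps. x * f a b)"
    "(\<Sum>(a, b)\<leftarrow>ps. f a b) * x = (\<Sum>(a, b)\<leftarrow>ps. f a b * x)" for ps
    by (induction ps) (auto simp: algebra_simps)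
  then show "x * sw f h = sw (\<lambda>a b. x * f a b) h" "sw f h * x = sw (\<lambda>a b. f a b * x) h"
    unfolding sw_cop by simp_all
qed

lemma sw_scale:
  assumes "vector_space t"
  shows "t c (sw f h) = sw (\<lambda>a b. t c (f a b)) h"
proof -
  interpret vector_space t by fact
  have "t c (\<Sum>(a, b)\<leftarrow>ps. f a b) = (\<Sum>(a, b)\<leftarrow>ps. t c (f a b))" for ps
    by (induction ps) (auto simp: scale_right_distrib)
  then show ?thesis unfolding sw_cop by simp
qed

lemma lin_sw_arg:
  assumes t: "vector_space t" and "\<And>y. hlin t (\<lambda>x. f x y)" "\<And>x. hlin t (f x)"
  shows "hlin t (sw f)"
proof -
  let ?W = "\<lparr>carr = UNIV, scal = t\<rparr>"
  have W: "is_vspace ?W" by (rule is_vspace_UNIV[OF t])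
  have L: "linear_map (tensor_space H H) ?W (tensor_lift H H f)"
    by (rule linear_tensor_lift[OF is_vspace_H W bilinearI[OF assms(2,3)]])
  have C: "linear_map H (tensor_space H H) (comult H)"
    using hopf by (simp add: hopf_algebra_def)
  show ?thesis
    unfolding lin_def sweedler_def
    using linear_map_add[OF L] linear_map_scale[OF L] linear_map_add[OF C] linear_map_scale[OF C]
    by (simp add: comult_carr)
qed

lemma lin_sw_arg_comp [lin_intros]:
  assumes "vector_space t" "\<And>y. hlin t (\<lambda>x. f x y)" "\<And>x. hlin t (\<lambda>y. f x y)" "lin s (scal H) g"
  shows "lin s t (\<lambda>x. sw (\<lambda>a b. f a b) (g x))"
  by (rule lin_comp[OF lin_sw_arg[OF assms(1-3)] assms(4)])

lemma lin_sw [lin_intros]: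
  assumes "vector_space t" "\<And>a b. lin s t (\<lambda>x. f x a b)"
  shows "lin s t (\<lambda>x. sw (\<lambda>a b. f x a b) h)"
proof -
  interpret vector_space t by fact
  have "lin s t (\<lambda>x. \<Sum>(a, b)\<leftarrow>ps. f x a b)" for ps
    by (induction ps) (auto simp: lin_def[of _ _ "\<lambda>x. 0"] intro!: lin_plus[OF assms(1)] assms(2))
  then show ?thesis unfolding sw_cop .
qed

text \<open>Lifting the trilinear \<open>f\<close> in two stages gives a linear map on
  \<open>H \<otimes> (H \<otimes> H)\<close> with value \<open>f a c d\<close> on pure tensors; it
  is applied to the coassociativity axiom.\<close>

lemma sw_coassoc:
  assumes t: "vector_space t" and "\<And>b c. hlin t (\<lambda>a. f a b c)" "\<And>a c. hlin t (\<lambda>b. f a b c)"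
    "\<And>a b. hlin t (\<lambda>c. f a b c)"
  shows "sw (\<lambda>a b. sw (\<lambda>c d. f a c d) b) h = sw (\<lambda>a b. sw (\<lambda>c d. f c d b) a) h"
proof -
  let ?T = "tensor_space H H" and ?W = "\<lparr>carr = UNIV, scal = t\<rparr>"
  have W: "is_vspace ?W" by (rule is_vspace_UNIV[OF t])
  then have t': "vector_space (scal ?W)" using t by simp
  have T: "is_vspace ?T" by (rule is_vspace_tensor_space)
  have b: "bilinear_map H H ?W (f a)" for a by (rule bilinearI) (rule assms)+
  let ?G = "\<lambda>a. tensor_lift H H (f a)"
  have G: "?G a (tens H H c d) = f a c d" for a c d
    by (rule tensor_lift_tens[OF t' b]) simp_all
  have G_lin: "linear_map ?T ?W (?G a)" for a
    by (rule linear_tensor_lift[OF is_vspace_H W b])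
  \<comment> \<open>The inner lift must be linear in \<open>a\<close> at every tensor
    \<open>z\<close>; one decomposition of \<open>z\<close> serves all \<open>a\<close> at
    once.\<close>
  have G_lin': "linear_map H ?W (\<lambda>a. ?G a z)" if z: "z \<in> carr ?T" for z
  proof -
    obtain ps where ps: "set ps \<subseteq> carr H \<times> carr H" "(\<Sum>(u, v)\<leftarrow>ps. tens H H u v) = z"
      using tensor_decomp[OF is_vspace_H z] by blast
    have *: "?G a z = (\<Sum>(u, v)\<leftarrow>ps. f a u v)" for a
      using tensor_lift_list[OF t' b ps(1)] ps(2) by simp
    have "hlin t (\<lambda>a. \<Sum>(u, v)\<leftarrow>ps. f a u v)"
    proof (induction ps)
      case Nil
      interpret vector_space t by fact
      show ?case by (simp add: lin_def)
    next
      case (Cons p ps)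
      then show ?case by (cases p) (simp add: lin_plus[OF t] assms(2))
    qed
    then show ?thesis unfolding * by (simp add: linear_map_iff_lin)
  qed
  have Gb: "bilinear_map H ?T ?W ?G" by (simp add: bilinear_map_def G_lin G_lin')
  let ?\<phi> = "tensor_lift H ?T ?G"
  have \<phi>: "linear_map (tensor_space H ?T) ?W ?\<phi>"
    by (rule linear_tensor_lift[OF is_vspace_H W Gb])
  have \<phi>_tens: "?\<phi> (tens H ?T a (tens H H c d)) = f a c d" for a c d
    using tensor_lift_tens[OF t' Gb, of a "tens H H c d"] by (simp add: tens_carr G)
  have carr: "tens H ?T a (tens H H c d) \<in> carr (tensor_space H ?T)" for a c d
    by (simp add: tens_carr)
  note carr_sw = sw_carr[OF is_vspace_tensor_space]
  note push = sw_linear_map[OF is_vspace_tensor_space \<phi>]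
  have "sw (\<lambda>a b. sw (\<lambda>b1 b2. tens H ?T a (tens H H b1 b2)) b) h =
        sw (\<lambda>a b. sw (\<lambda>a1 a2. tens H ?T a1 (tens H H a2 b)) a) h"
    using hopf by (simp add: hopf_algebra_def)
  from arg_cong[OF this, of ?\<phi>] show ?thesis
    by (simp add: push carr carr_sw \<phi>_tens)
qed

lemma sw_counit_left: "hlin t \<phi> \<Longrightarrow> sw (\<lambda>a b. t (\<epsilon> a) (\<phi> b)) h = \<phi> h"
  and sw_counit_right: "hlin t \<phi> \<Longrightarrow> sw (\<lambda>a b. t (\<epsilon> b) (\<phi> a)) h = \<phi> h"
proof -
  assume \<phi>: "hlin t \<phi>"
  have "sw (\<lambda>a b. \<epsilon> a \<odot> b) h = h" "sw (\<lambda>a b. \<epsilon> b \<odot> a) h = h"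
    using hopf by (simp_all add: hopf_algebra_def)
  from this[THEN arg_cong[of _ _ \<phi>]]
  show "sw (\<lambda>a b. t (\<epsilon> a) (\<phi> b)) h = \<phi> h" "sw (\<lambda>a b. t (\<epsilon> b) (\<phi> a)) h = \<phi> h"
    by (simp_all add: sw_lin[OF \<phi>] lin_scale[OF \<phi>])
qed

lemma sw_antipode_left: "hlin t \<phi> \<Longrightarrow> sw (\<lambda>a b. \<phi> (S a * b)) h = t (\<epsilon> h) (\<phi> 1)"
  and sw_antipode_right: "hlin t \<phi> \<Longrightarrow> sw (\<lambda>a b. \<phi> (a * S b)) h = t (\<epsilon> h) (\<phi> 1)"
proof -
  assume \<phi>: "hlin t \<phi>"
  have "sw (\<lambda>a b. S a * b) h = \<epsilon> h \<odot> 1" "sw (\<lambda>a b. a * S b) h = \<epsilon> h \<odot> 1"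
    using hopf by (simp_all add: hopf_algebra_def)
  from this[THEN arg_cong[of _ _ \<phi>]]
  show "sw (\<lambda>a b. \<phi> (S a * b)) h = t (\<epsilon> h) (\<phi> 1)" "sw (\<lambda>a b. \<phi> (a * S b)) h = t (\<epsilon> h) (\<phi> 1)"
    by (simp_all add: sw_lin[OF \<phi>] lin_scale[OF \<phi>])
qed

lemma sw_mult:
  assumes t: "vector_space t" and "\<And>y. hlin t (\<lambda>x. f x y)" "\<And>x. hlin t (\<lambda>y. f x y)"
  shows "sw f (x * y) = sw (\<lambda>a b. sw (\<lambda>c d. f (a * c) (b * d)) y) x"
proof -
  let ?T = "tensor_space H H" and ?W = "\<lparr>carr = UNIV, scal = t\<rparr>"
  have W: "is_vspace ?W" by (rule is_vspace_UNIV[OF t])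
  then have t': "vector_space (scal ?W)" using t by simp
  have b: "bilinear_map H H ?W f" by (rule bilinearI) (rule assms)+
  let ?\<phi> = "tensor_lift H H f"
  have \<phi>: "linear_map ?T ?W ?\<phi>" by (rule linear_tensor_lift[OF is_vspace_H W b])
  have \<phi>_tens: "?\<phi> (tens H H c d) = f c d" for c d
    by (rule tensor_lift_tens[OF t' b]) simp_all
  note carr_sw = sw_carr[OF is_vspace_tensor_space]
  note push = sw_linear_map[OF is_vspace_tensor_space \<phi>]
  have "comult H (x * y) = sw (\<lambda>a b. sw (\<lambda>c d. tens H H (a * c) (b * d)) y) x"
    using hopf by (simp add: hopf_algebra_def)
  from arg_cong[OF this, of ?\<phi>] show ?thesis
    unfolding sweedler_def[of H f] by (simp add: push tens_carr carr_sw \<phi>_tens)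
qed

lemma sw_1:
  assumes t: "vector_space t" and "\<And>y. hlin t (\<lambda>x. f x y)" "\<And>x. hlin t (\<lambda>y. f x y)"
  shows "sw f 1 = f 1 1"
proof -
  let ?W = "\<lparr>carr = UNIV, scal = t\<rparr>"
  have t': "vector_space (scal ?W)" using t by simp
  have b: "bilinear_map H H ?W f" by (rule bilinearI) (rule assms)+
  have "comult H 1 = tens H H 1 1" using hopf by (simp add: hopf_algebra_def)
  then show ?thesis
    unfolding sweedler_def using tensor_lift_tens[OF t' b] by simp
qed

section \<open>The antipode\<close>

lemmas vector_space_H = H.vector_space_axioms
lemmas [lin_intros] = vector_space_mult vector_space_H

lemma antipode_mult: "S (x * y) = S y * S x"
proof -
  \<comment> \<open>With legs \<open>a, b, c\<close> of \<open>x\<close> and \<open>d, e, f\<close>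
    of \<open>y\<close> this is \<open>S(x\<^sub>1 y\<^sub>1) x\<^sub>2 y\<^sub>2 S(y\<^sub>3)
    S(x\<^sub>3)\<close>. Cancelling from the right end leaves \<open>S(x y)\<close>; cancelling the
    product of the first factors leaves \<open>S(y) S(x)\<close>.\<close>
  define G where "G a b c d e f = S (a * d) * (b * e) * (S f * S c)" for a b c d e f
  have 1: "sw (\<lambda>e f. G a b c d e f) y' = \<epsilon> y' \<odot> (S (a * d) * b * S c)" for a b c d y'
  proof -
    have "sw (\<lambda>e f. (\<lambda>z. S (a * d) * b * z * S c) (e * S f)) y' = \<epsilon> y' \<odot> (S (a * d) * b * 1 * S c)"
      by (rule sw_antipode_right) (intro lin_intros)
    then show ?thesis by (simp add: G_def mult.assoc)
  qed
  have 2: "sw (\<lambda>d y'. \<epsilon> y' \<odot> (S (a * d) * b * S c)) y = S (a * y) * b * S c" for a b c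
    by (rule sw_counit_right) (intro lin_intros)
  have 3: "sw (\<lambda>b c. S (a * y) * b * S c) x' = \<epsilon> x' \<odot> S (a * y)" for a x'
  proof -
    have "sw (\<lambda>b c. (\<lambda>z. S (a * y) * z) (b * S c)) x' = \<epsilon> x' \<odot> (S (a * y) * 1)"
      by (rule sw_antipode_right) (intro lin_intros)
    then show ?thesis by (simp add: mult.assoc)
  qed
  have 4: "sw (\<lambda>a x'. \<epsilon> x' \<odot> S (a * y)) x = S (x * y)"
    by (rule sw_counit_right) (intro lin_intros)
  have L: "sw (\<lambda>a x'. sw (\<lambda>b c. sw (\<lambda>d y'. sw (\<lambda>e f. G a b c d e f) y') y) x') x = S (x * y)"
    by (simp only: 1 2 3 4)
  have 5: "sw (\<lambda>d y'. sw (\<lambda>e f. G a b c d e f) y') y = sw (\<lambda>y' f. sw (\<lambda>d e. G a b c d e f) y') y" for a b c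
    by (rule sw_coassoc[OF vector_space_H]; unfold G_def; intro lin_intros)
  have 6: "sw (\<lambda>a x'. sw (\<lambda>b c. sw (\<lambda>y' f. sw (\<lambda>d e. G a b c d e f) y') y) x') x =
    sw (\<lambda>x' c. sw (\<lambda>a b. sw (\<lambda>y' f. sw (\<lambda>d e. G a b c d e f) y') y) x') x"
    by (rule sw_coassoc[OF vector_space_H]; unfold G_def; intro lin_intros)
  have 7: "sw (\<lambda>a b. sw (\<lambda>y' f. sw (\<lambda>d e. G a b c d e f) y') y) x' = 
    sw (\<lambda>y' f. \<epsilon> (x' * y') \<odot> (S f * S c)) y" for c x'
  proof -
    have "sw (\<lambda>a b. sw (\<lambda>d e. G a b c d e f) y') x' = sw (\<lambda>p q. S p * q * (S f * S c)) (x' * y')" for y' f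
      unfolding G_def by (rule sw_mult[OF vector_space_H, symmetric]; intro lin_intros)
    also have "\<dots> y' f = \<epsilon> (x' * y') \<odot> (1 * (S f * S c))" for y' f
      by (rule sw_antipode_left[of "scal H" "\<lambda>z. z * (S f * S c)"]) (intro lin_intros)
    finally show ?thesis by (subst sw_swap) simp
  qed
  have 8: "sw (\<lambda>y' f. \<epsilon> (x' * y') \<odot> (S f * S c)) y = \<epsilon> x' \<odot> (S y * S c)" for c x'
  proof -
    have "sw (\<lambda>y' f. \<epsilon> y' \<odot> (\<epsilon> x' \<odot> (S f * S c))) y = \<epsilon> x' \<odot> (S y * S c)"
      by (rule sw_counit_left) (intro lin_intros)
    then show ?thesis by (simp add: counit_mult mult.commute)
  qed
  have 9: "sw (\<lambda>x' c. \<epsilon> x' \<odot> (S y * S c)) x = S y * S x"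
    by (rule sw_counit_left) (intro lin_intros)
  show ?thesis using L unfolding 5 6 7 8 9 by simp
qed

lemma antipode_1: "S 1 = 1"
proof -
  have "sw (\<lambda>a b. S a * b) 1 = \<epsilon> 1 \<odot> 1"
    using sw_antipode_left[OF lin_id] by simp
  moreover have "sw (\<lambda>a b. S a * b) 1 = S 1 * 1"
    by (rule sw_1[OF vector_space_H]; intro lin_intros)
  ultimately show ?thesis by (simp add: counit_1)
qed

lemma counit_antipode: "\<epsilon> (S h) = \<epsilon> h"
proof -
  have "sw (\<lambda>a b. \<epsilon> (S a * b)) h = \<epsilon> h * \<epsilon> 1"
    by (rule sw_antipode_left[OF lin_counit])
  moreover have "sw (\<lambda>a b. \<epsilon> b * \<epsilon> (S a)) h = \<epsilon> (S h)"
    by (rule sw_counit_right) (intro lin_intros)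
  ultimately show ?thesis by (simp add: counit_mult counit_1 mult.commute)
qed

lemma sw_antipode:
  assumes t: "vector_space t" and f1: "\<And>y. hlin t (\<lambda>x. f x y)" and f2: "\<And>x. hlin t (\<lambda>y. f x y)"
  shows "sw f (S h) = sw (\<lambda>a b. f (S b) (S a)) h"
proof -
  note li = lin_intros t lin_comp[OF f1] lin_comp[OF f2]
  \<comment> \<open>This is \<open>f\<close> at \<open>\<Delta>(S(h\<^sub>1)) (h\<^sub>2 \<otimes>
    h\<^sub>3) (S(h\<^sub>5) \<otimes> S(h\<^sub>4))\<close>. Cancelling
    \<open>h\<^sub>3 S(h\<^sub>4)\<close> and then \<open>h\<^sub>2 S(h\<^sub>5)\<close> leaves
    \<open>\<Delta>(S(h))\<close>; collapsing \<open>\<Delta>(S(h\<^sub>1) h\<^sub>2)\<close> leaves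
    \<open>S(h\<^sub>2) \<otimes> S(h\<^sub>1)\<close>.\<close>
  define G where "G a b c d e = sw (\<lambda>p q. f (p * b * S e) (q * c * S d)) (S a)" for a b c d e
  have 1: "sw (\<lambda>c d. G a b c d e) x = t (\<epsilon> x) (sw (\<lambda>p q. f (p * b * S e) q) (S a))" for a b e x
  proof -
    have "sw (\<lambda>c d. f (p * b * S e) (q * c * S d)) x = t (\<epsilon> x) (f (p * b * S e) q)" for p q
      using sw_antipode_right[of t "\<lambda>w. f (p * b * S e) (q * w)" x, OF lin_comp[OF f2]]
      by (simp add: mult.assoc lin_intros)
    then show ?thesis unfolding G_def by (subst sw_swap) (simp add: sw_scale[OF t])
  qed
  have 2: "sw (\<lambda>x e. t (\<epsilon> x) (sw (\<lambda>p q. f (p * b * S e) q) (S a))) w =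
    sw (\<lambda>p q. f (p * b * S w) q) (S a)" for a b w
    by (rule sw_counit_left) (intro li)
  have 3: "sw (\<lambda>b w. sw (\<lambda>p q. f (p * b * S w) q) (S a)) z = t (\<epsilon> z) (sw f (S a))" for a z
  proof -
    have "sw (\<lambda>b w. f (p * b * S w) q) z = t (\<epsilon> z) (f p q)" for p q
      using sw_antipode_right[of t "\<lambda>w. f (p * w) q" z, OF lin_comp[OF f1]]
      by (simp add: mult.assoc lin_intros)
    then show ?thesis by (subst sw_swap) (simp add: sw_scale[OF t])
  qed
  have 4: "sw (\<lambda>a z. t (\<epsilon> z) (sw f (S a))) h = sw f (S h)"
    by (rule sw_counit_right) (intro li)
  have L: "sw (\<lambda>a z. sw (\<lambda>b w. sw (\<lambda>x e. sw (\<lambda>c d. G a b c d e) x) w) z) h = sw f (S h)"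
    by (simp only: 1 2 3 4)
  have 5: "sw (\<lambda>b w. sw (\<lambda>x e. sw (\<lambda>c d. G a b c d e) x) w) z =
      sw (\<lambda>u e. sw (\<lambda>b x. sw (\<lambda>c d. G a b c d e) x) u) z" for a z
    by (rule sw_coassoc[OF t]; unfold G_def; intro li)
  have 6: "sw (\<lambda>b x. sw (\<lambda>c d. G a b c d e) x) u = sw (\<lambda>z d. sw (\<lambda>b c. G a b c d e) z) u" for a e u
    by (rule sw_coassoc[OF t]; unfold G_def; intro li)
  have 7: "sw (\<lambda>a z. sw (\<lambda>u e. sw (\<lambda>z d. sw (\<lambda>b c. G a b c d e) z) u) z) h =
      sw (\<lambda>y e. sw (\<lambda>a u. sw (\<lambda>z d. sw (\<lambda>b c. G a b c d e) z) u) y) h"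
    by (rule sw_coassoc[OF t]; unfold G_def; intro li)
  have 8: "sw (\<lambda>a u. sw (\<lambda>z d. sw (\<lambda>b c. G a b c d e) z) u) y =
      sw (\<lambda>x d. sw (\<lambda>a z. sw (\<lambda>b c. G a b c d e) z) x) y" for e y
    by (rule sw_coassoc[OF t]; unfold G_def; intro li)
  have 9: "sw (\<lambda>a z. sw (\<lambda>b c. G a b c d e) z) x = t (\<epsilon> x) (f (S e) (S d))" for d e x
  proof -
    define F where "F w = sw (\<lambda>p q. f (p * S e) (q * S d)) w" for w
    have F: "hlin t F" unfolding F_def by (intro li)
    have "F (S a * z) = sw (\<lambda>p q. sw (\<lambda>b c. f (p * b * S e) (q * c * S d)) z) (S a)" for a z
      unfolding F_def by (rule sw_mult[OF t]; intro li)
    also have "\<dots> a z = sw (\<lambda>b c. G a b c d e) z" for a z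
      unfolding G_def by (rule sw_swap)
    finally have "sw (\<lambda>a z. sw (\<lambda>b c. G a b c d e) z) x = sw (\<lambda>a z. F (S a * z)) x" by simp
    also have "\<dots> = t (\<epsilon> x) (F 1)" by (rule sw_antipode_left[OF F])
    also have "F 1 = f (1 * S e) (1 * S d)"
      unfolding F_def by (rule sw_1[OF t]; intro li)
    finally show ?thesis by simp
  qed
  have 10: "sw (\<lambda>x d. t (\<epsilon> x) (f (S e) (S d))) y = f (S e) (S y)" for e y
    by (rule sw_counit_left) (intro li)
  show ?thesis using L unfolding 5 6 7 8 9 10 by simp
qed

end

section \<open>The Haar integral and the regular character\<close>

locale semisimple_hopf =
  fixes H :: "('k::{alg_closed_field,field_char_0}, 'h::ring_1) hopf"
  assumes hopf_algebra_H: "hopf_algebra H" and fin_dim_H: "fin_dim H" and semisimple_H: "semisimple H"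
begin

sublocale hopf H
  using hopf_algebra_H by unfold_locales

sublocale H: fd_space H
  using is_vspace_H fin_dim_H by unfold_locales

abbreviation "htr \<equiv> linear_trace H"

lemma linear_map_H: "linear_map H H f \<longleftrightarrow> hlin (scal H) f"
  by (rule linear_map_iff_lin) simp

lemma linear_map_ground: "linear_map H ground f \<longleftrightarrow> hlin (*) f"
  by (simp add: linear_map_iff_lin ground_def)

lemma lin_vcoord: "hlin (*) (vcoord H b)"
  using H.linear_vcoord by (simp add: linear_map_ground)

lemmas lin_vcoord_comp [lin_intros] = lin_comp[OF lin_vcoord]

lemma expand: "x = (\<Sum>b\<in>vbasis H. vcoord H b x \<odot> b)"
  by (simp add: H.vcoord_expand)

lemma lin_inj_surj:
  assumes "hlin (scal H) f" "\<And>x. f x = 0 \<Longrightarrow> x = 0"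
  shows "\<exists>x. f x = y"
  using H.linear_inj_surj[of f y] assms by (auto simp: linear_map_H)

lemma htr_comm:
  assumes "hlin (scal H) f" "hlin (scal H) g"
  shows "htr (\<lambda>x. f (g x)) = htr (\<lambda>x. g (f x))"
  using assms linear_trace_comm[OF H.fd_space_axioms H.fd_space_axioms] by (simp add: linear_map_H)

lemma lin_htr [lin_intros]:
  assumes "\<And>a. lin s (scal H) (\<lambda>h. F h a)"
  shows "lin s (*) (\<lambda>h. htr (\<lambda>a. F h a))"
  unfolding linear_trace_eq
  by (intro lin_sums vector_space_mult lin_comp[OF lin_vcoord] assms)

lemma htr_sw: "htr (\<lambda>x. sw (\<lambda>a b. F a b x) h) = sw (\<lambda>a b. htr (\<lambda>x. F a b x)) h"
  unfolding linear_trace_eq by (simp add: sw_sum sw_lin[OF lin_vcoord])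

lemma htr_rank_one: "hlin (*) p \<Longrightarrow> htr (\<lambda>x. p x \<odot> v) = p v"
  using H.trace_rank_one by (simp add: linear_map_ground)

lemma htr_idempotent:
  assumes "hlin (scal H) P" "\<And>x. P (P x) = P x"
  obtains n where "htr P = of_nat n" "n = 0 \<Longrightarrow> \<forall>x. P x = 0"
  using H.trace_idempotent[of P] assms by (auto simp: linear_map_H)

text \<open>Split 1 as \<open>e + e'\<close> along \<open>W\<close> and a complement
  \<open>W'\<close>. For \<open>x\<close> in \<open>W\<close>, the element
  \<open>x e' = x - x e\<close> lies in both and vanishes.\<close>

lemma left_ideal_idempotent:
  assumes "H.subspace W" "\<And>h w. w \<in> W \<Longrightarrow> h * w \<in> W"
  shows "\<exists>e\<in>W. \<forall>x\<in>W. x * e = x"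
proof -
  have "submod (regular_hmod H) W"
    using assms by (simp add: submod_def regular_hmod_def)
  then obtain W' where W': "submod (regular_hmod H) W'" "W \<inter> W' = {0}"
    "{w + w' | w w'. w \<in> W \<and> w' \<in> W'} = UNIV"
    using semisimple_H by (auto simp: semisimple_def semisimple_hmod_def regular_hmod_def)
  then obtain e e' where e: "1 = e + e'" "e \<in> W" "e' \<in> W'" by blast
  have "x * e = x" if x: "x \<in> W" for x
  proof -
    have *: "x = x * e + x * e'" using e(1) by (metis distrib_left mult.right_neutral)
    have "x * e' \<in> W'" using W'(1) e(3) by (simp add: submod_def regular_hmod_def)
    moreover have "x - x * e \<in> W"
      using assms(1) x assms(2)[OF e(2)] by (rule H.subspace_diff)
    ultimately have "x - x * e = 0" using * W'(2) by (metis IntI add_diff_cancel_left' singletonD)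
    then show ?thesis by simp
  qed
  with e(2) show ?thesis by blast
qed

section \<open>The regular character, its trace form, and the Haar integral\<close>

definition \<chi> :: "'h \<Rightarrow> 'k" where "\<chi> h = htr (\<lambda>x. h * x)"

lemma lin_chi: "hlin (*) \<chi>"
  unfolding \<chi>_def by (intro lin_intros)

lemmas lin_chi_comp [lin_intros] = lin_comp[OF lin_chi]

lemma chi_comm: "\<chi> (a * b) = \<chi> (b * a)"
proof -
  have "htr (\<lambda>x. a * (b * x)) = htr (\<lambda>x. b * (a * x))"
    by (rule htr_comm; intro lin_intros)
  moreover have "\<chi> (x * y) = htr (\<lambda>z. x * (y * z))" for x y
    unfolding \<chi>_def by (rule H.trace_cong) (rule mult.assoc)
  ultimately show ?thesis by simp
qed

text \<open>The radical of the trace form is a left ideal, so it has an idempotent generator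
  \<open>e\<close>. Then \<open>\<chi> e = 0\<close> is the rank of multiplication by
  \<open>e\<close>, which forces \<open>e = 0\<close> in characteristic zero.\<close>

lemma chi_nondegenerate:
  assumes "\<And>b. \<chi> (a * b) = 0"
  shows "a = 0"
proof -
  let ?N = "{a. \<forall>b. \<chi> (a * b) = 0}"
  have "H.subspace ?N"
    by (auto simp: H.subspace_def distrib_right scale_mult_left lin_zero[OF lin_chi]
        lin_add[OF lin_chi] lin_scale[OF lin_chi])
  moreover have "h * w \<in> ?N" if "w \<in> ?N" for h w
  proof -
    have "\<chi> (h * w * b) = \<chi> (w * (b * h))" for b
      using chi_comm[of h "w * b"] by (simp only: mult.assoc)
    with that show ?thesis by simp
  qed
  ultimately obtain e where e: "e \<in> ?N" "\<And>x. x \<in> ?N \<Longrightarrow> x * e = x"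
    using left_ideal_idempotent by meson
  have "e * e = e" using e by blast
  then have "e * (e * x) = e * x" for x by (metis mult.assoc)
  then obtain n where n: "htr (\<lambda>x. e * x) = of_nat n" "n = 0 \<Longrightarrow> \<forall>x. e * x = 0"
    using htr_idempotent[of "\<lambda>x. e * x"] by (auto simp: lin_intros)
  have "\<chi> (e * 1) = 0" using e(1) by blast
  then have "\<chi> e = 0" by (simp only: mult_1_right)
  with n(1) have "n = 0" by (simp only: \<chi>_def of_nat_eq_0_iff)
  with n(2) have "e * 1 = 0" by blast
  moreover have "a * e = a" using e(2) assms by blast
  ultimately show ?thesis by (metis mult.right_neutral mult_zero_right)
qed

text \<open>Von Neumann regularity: \<open>w * t\<close> is an idempotent generator of
  \<open>H t\<close>, and \<open>t\<close> itself lies in \<open>H t\<close>.\<close>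

lemma principal_left_ideal_idempotent:
  fixes t :: 'h
  shows "\<exists>w. w * t * (w * t) = w * t \<and> t * (w * t) = t \<and> (\<forall>x. x * t * (w * t) = x * t)"
proof -
  have sub: "H.subspace (range (\<lambda>h. h * t))"
  proof (rule H.subspaceI)
    show "0 \<in> range (\<lambda>h. h * t)" by (metis mult_zero_left rangeI)
    show "x + y \<in> range (\<lambda>h. h * t)" if "x \<in> range (\<lambda>h. h * t)" "y \<in> range (\<lambda>h. h * t)" for x y
      using that by (auto simp: distrib_right[symmetric])
    show "c \<odot> x \<in> range (\<lambda>h. h * t)" if "x \<in> range (\<lambda>h. h * t)" for c x
      using that by (auto simp: scale_mult_left[symmetric])
  qed
  have ideal: "h * w \<in> range (\<lambda>h. h * t)" if w: "w \<in> range (\<lambda>h. h * t)" for h w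
  proof -
    from w obtain y where "w = y * t" by blast
    then have "h * w = (h * y) * t" by (simp only: mult.assoc)
    then show ?thesis by (rule range_eqI)
  qed
  obtain f where f: "f \<in> range (\<lambda>h. h * t)" "\<forall>x\<in>range (\<lambda>h. h * t). x * f = x"
    using left_ideal_idempotent[OF sub ideal] by meson
  from f(1) obtain w where w: "f = w * t" by blast
  have *: "x * t * (w * t) = x * t" for x using f(2) w by blast
  from *[of w] *[of 1] * show ?thesis by (metis mult_1)
qed

text \<open>Semiprimeness, since regularity provides \<open>w\<close> with
  \<open>a = a * w * a\<close>.\<close>

lemma square_zero_left_ideal:
  fixes a :: 'h
  assumes "\<And>h. a * h * a = 0"
  shows "a = 0"
proof -
  obtain w where "a * (w * a) = a" using principal_left_ideal_idempotent[of a] by blast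
  then show ?thesis using assms[of w] by (simp add: mult.assoc)
qed

text \<open>For a left integral, \<open>k * h * k\<close> is a multiple of
  \<open>\<epsilon> k \<odot> k\<close>, so \<open>H k\<close> has square zero.\<close>

lemma left_integral_eq_zero:
  assumes k: "\<And>h. h * k = \<epsilon> h \<odot> k" and "\<epsilon> k = 0"
  shows "k = 0"
  by (rule square_zero_left_ideal) (simp add: k counit_mult assms(2))

text \<open>The kernel of \<open>\<epsilon>\<close> is \<open>H e\<close> for an idempotent
  \<open>e\<close>. Right multiplication by \<open>1 - e\<close> kills this kernel, in particular
  every \<open>h - \<epsilon> h \<odot> 1\<close>, so \<open>1 - e\<close> is a left
  integral.\<close>

lemma haar_exists:
  "\<exists>\<Lambda>. (\<forall>h. h * \<Lambda> = \<epsilon> h \<odot> \<Lambda> \<and> \<Lambda> * h = \<epsilon> h \<odot> \<Lambda>) \<and> \<epsilon> \<Lambda> = 1"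
proof -
  let ?K = "{x. \<epsilon> x = 0}"
  have "H.subspace ?K"
    by (simp add: H.subspace_def lin_zero[OF lin_counit] lin_add[OF lin_counit] lin_scale[OF lin_counit])
  moreover have "h * w \<in> ?K" if "w \<in> ?K" for h w using that by (simp add: counit_mult)
  ultimately obtain e where e: "e \<in> ?K" "\<And>x. x \<in> ?K \<Longrightarrow> x * e = x"
    using left_ideal_idempotent by meson
  define L where "L = 1 - e"
  have eps: "\<epsilon> L = 1" using e(1) by (simp add: L_def lin_diff[OF lin_counit] counit_1)
  have left: "h * L = \<epsilon> h \<odot> L" for h
  proof -
    have "h - \<epsilon> h \<odot> 1 \<in> ?K"
      by (simp add: lin_diff[OF lin_counit] lin_scale[OF lin_counit] counit_1)
    from e(2)[OF this] have "(h - \<epsilon> h \<odot> 1) * L = 0" by (simp add: L_def right_diff_distrib)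
    then show ?thesis by (simp add: left_diff_distrib scale_mult_left)
  qed
  \<comment> \<open>The defect \<open>L * h - \<epsilon> h \<odot> L\<close> is again a left
    integral, now with counit zero.\<close>
  have right: "L * h = \<epsilon> h \<odot> L" for h
  proof -
    have "L * h - \<epsilon> h \<odot> L = 0"
    proof (rule left_integral_eq_zero)
      show "\<epsilon> (L * h - \<epsilon> h \<odot> L) = 0"
        by (simp add: lin_diff[OF lin_counit] lin_scale[OF lin_counit] counit_mult eps)
      show "x * (L * h - \<epsilon> h \<odot> L) = \<epsilon> x \<odot> (L * h - \<epsilon> h \<odot> L)" for x
        by (simp add: right_diff_distrib scale_mult_right left scale_mult_left H.scale_right_diff_distrib
            mult.commute flip: mult.assoc)
    qed
    then show ?thesis by simp
  qed
  show ?thesis using eps left right by blast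
qed

abbreviation "\<Lambda> \<equiv> haar_integral H"

lemma haar_left: "h * \<Lambda> = \<epsilon> h \<odot> \<Lambda>"
  and haar_right: "\<Lambda> * h = \<epsilon> h \<odot> \<Lambda>"
  and counit_haar: "\<epsilon> \<Lambda> = 1"
proof -
  let ?P = "\<lambda>L. (\<forall>h. h * L = \<epsilon> h \<odot> L \<and> L * h = \<epsilon> h \<odot> L) \<and> \<epsilon> L = 1"
  have "L = L'" if "?P L" "?P L'" for L L'
  proof -
    have "L * L' = \<epsilon> L \<odot> L'" "L * L' = \<epsilon> L' \<odot> L" using that by blast+
    with that show ?thesis by (metis H.scale_one)
  qed
  with haar_exists have "\<exists>!L. ?P L" by (rule ex_ex1I)
  from theI'[OF this]
  show "h * \<Lambda> = \<epsilon> h \<odot> \<Lambda>" "\<Lambda> * h = \<epsilon> h \<odot> \<Lambda>" "\<epsilon> \<Lambda> = 1"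
    unfolding haar_integral_def by blast+
qed

lemma left_integral_unique:
  assumes "\<And>h. h * k = \<epsilon> h \<odot> k"
  shows "k = \<epsilon> k \<odot> \<Lambda>"
proof -
  have "\<epsilon> \<Lambda> \<odot> k = \<epsilon> k \<odot> \<Lambda>" using assms[of \<Lambda>] haar_right[of k] by (rule trans[OF sym])
  then show ?thesis by (simp only: counit_haar H.scale_one)
qed

section \<open>Traces of convolution operators built from the squared antipode\<close>

lemma lin_expand: "hlin t \<phi> \<Longrightarrow> (\<Sum>b\<in>vbasis H. t (vcoord H b x) (\<phi> b)) = \<phi> x"
  by (subst (2) expand) (simp add: lin_sum lin_scale)

lemma vcoord_eqI: "(\<And>b. vcoord H b x = vcoord H b y) \<Longrightarrow> x = y"
  using expand[of x] expand[of y] by simp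

text \<open>Behind it is \<open>S(k\<^sub>3) S\<^sup>2(k\<^sub>2) = S(S(k\<^sub>2)
  k\<^sub>3)\<close>, which collapses. The translation by \<open>k\<close> inside \<open>f\<close>
  is thereby moved outside, where a trace can cycle it.\<close>

lemma antipode_convolution:
  assumes f: "hlin (*) f"
  shows "sw (\<lambda>a b. f (k * a) \<odot> S (S b)) h =
    sw (\<lambda>k1 k2. S k2 * sw (\<lambda>a b. f a \<odot> S (S b)) (k1 * h)) k"
proof -
  note li = lin_intros lin_comp[OF f]
  define G where "G p q c a b = (f (p * a) \<odot> (S c * S (S (q * b))))" for p q c a b
  have 1: "S c * sw (\<lambda>a b. f a \<odot> S (S b)) (z * h) = sw (\<lambda>p q. sw (\<lambda>a b. G p q c a b) h) z" for c z
  proof -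
    have "sw (\<lambda>a b. f a \<odot> S (S b)) (z * h) = sw (\<lambda>p q. sw (\<lambda>a b. f (p * a) \<odot> S (S (q * b))) h) z"
      by (rule sw_mult[OF vector_space_H]; intro li)
    then show ?thesis unfolding G_def by (simp add: sw_mult_left scale_mult_right)
  qed
  have 2: "sw (\<lambda>z c. sw (\<lambda>p q. sw (\<lambda>a b. G p q c a b) h) z) k =
    sw (\<lambda>p z. sw (\<lambda>q c. sw (\<lambda>a b. G p q c a b) h) z) k"
    unfolding G_def by (rule sw_coassoc[OF vector_space_H, symmetric]; intro li)
  have 3: "sw (\<lambda>q c. sw (\<lambda>a b. G p q c a b) h) z = \<epsilon> z \<odot> sw (\<lambda>a b. f (p * a) \<odot> S (S b)) h" for p z
  proof -
    have "sw (\<lambda>q c. G p q c a b) z = \<epsilon> z \<odot> (f (p * a) \<odot> S (S b))" for a b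
    proof -
      have "sw (\<lambda>q c. f (p * a) \<odot> (S (S q * c) * S (S b))) z = \<epsilon> z \<odot> (f (p * a) \<odot> (S 1 * S (S b)))"
        by (rule sw_antipode_left[of "scal H" "\<lambda>w. f (p * a) \<odot> (S w * S (S b))"]) (intro li)
      then show ?thesis by (simp add: G_def antipode_mult antipode_1 mult.assoc)
    qed
    then show ?thesis by (subst sw_swap) (simp add: sw_scale[OF vector_space_H])
  qed
  have 4: "sw (\<lambda>p z. \<epsilon> z \<odot> sw (\<lambda>a b. f (p * a) \<odot> S (S b)) h) k = sw (\<lambda>a b. f (k * a) \<odot> S (S b)) h"
    by (rule sw_counit_right) (intro li)
  show ?thesis unfolding 1 2 3 4 ..
qed

text \<open>Translating by \<open>k\<close> multiplies the trace by \<open>\<epsilon> k\<close>,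
  because cyclicity brings \<open>k\<^sub>1\<close> and \<open>S(k\<^sub>2)\<close> together. At
  \<open>k = \<Lambda>\<close> the translated operator is \<open>f \<Lambda>\<close> times
  \<open>S\<^sup>2\<close>.\<close>

lemma trace_convolution_antipode_sq:
  assumes f: "hlin (*) f"
  shows "htr (\<lambda>h. sw (\<lambda>a b. f a \<odot> S (S b)) h) = f \<Lambda> * htr (\<lambda>h. S (S h))"
proof -
  note li = lin_intros lin_comp[OF f]
  define T where "T h = sw (\<lambda>a b. f a \<odot> S (S b)) h" for h
  have T: "hlin (scal H) T" unfolding T_def by (intro li)
  define \<phi> where "\<phi> z = htr (\<lambda>x. T (z * x))" for z
  have \<phi>: "hlin (*) \<phi>" unfolding \<phi>_def by (intro lin_intros lin_comp[OF T])
  have "htr (\<lambda>h. sw (\<lambda>a b. f (k * a) \<odot> S (S b)) h) = sw (\<lambda>k1 k2. \<phi> (k1 * S k2)) k" for k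
  proof -
    have "htr (\<lambda>h. sw (\<lambda>a b. f (k * a) \<odot> S (S b)) h) = sw (\<lambda>k1 k2. htr (\<lambda>h. S k2 * T (k1 * h))) k"
      unfolding antipode_convolution[OF f] T_def[symmetric] by (rule htr_sw)
    moreover have "htr (\<lambda>h. S k2 * T (k1 * h)) = htr (\<lambda>x. T (k1 * (S k2 * x)))" for k1 k2
      by (rule htr_comm; intro lin_intros lin_comp[OF T])
    ultimately show ?thesis by (simp add: \<phi>_def mult.assoc)
  qed
  also have "sw (\<lambda>k1 k2. \<phi> (k1 * S k2)) k = \<epsilon> k * htr T" for k
    using sw_antipode_right[OF \<phi>] by (simp add: \<phi>_def)
  finally have "htr (\<lambda>h. sw (\<lambda>a b. f (\<Lambda> * a) \<odot> S (S b)) h) = htr T"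
    by (simp add: counit_haar)
  moreover have "sw (\<lambda>a b. f (\<Lambda> * a) \<odot> S (S b)) h = f \<Lambda> \<odot> S (S h)" for h
  proof -
    have "sw (\<lambda>a b. \<epsilon> a \<odot> (f \<Lambda> \<odot> S (S b))) h = f \<Lambda> \<odot> S (S h)"
      by (rule sw_counit_left) (intro lin_intros)
    then show ?thesis by (simp add: haar_right lin_scale[OF f])
  qed
  moreover have "htr (\<lambda>h. f \<Lambda> \<odot> S (S h)) = f \<Lambda> * htr (\<lambda>h. S (S h))"
    by (rule H.trace_scale) simp
  ultimately show ?thesis unfolding T_def by simp
qed

section \<open>Integrals and Radford's formula\<close>

text \<open>Being a twisted trace, \<open>lam\<close> has \<open>S\<^sup>2\<close> as its Nakayama automorphism, see \<open>lam_comm\<close>.\<close>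

definition lam :: "'h \<Rightarrow> 'k" where "lam h = htr (\<lambda>x. h * S (S x))"

lemma lin_lam: "hlin (*) lam"
  unfolding lam_def by (intro lin_intros)

lemmas lin_lam_comp [lin_intros] = lin_comp[OF lin_lam]

lemma lam_1: "lam 1 = htr (\<lambda>x. S (S x))"
  by (simp add: lam_def)

lemma lam_comm: "lam (a * b) = lam (b * S (S a))"
proof -
  have "htr (\<lambda>x. a * (b * S (S x))) = htr (\<lambda>x. b * S (S (a * x)))"
    by (rule htr_comm; intro lin_intros)
  then show ?thesis unfolding lam_def by (simp only: antipode_mult mult.assoc)
qed

lemma lam_haar: "lam \<Lambda> = 1"
proof -
  have "lam \<Lambda> = htr (\<lambda>x. \<epsilon> x \<odot> \<Lambda>)"
    unfolding lam_def by (simp only: haar_right counit_antipode)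
  then show ?thesis by (simp add: htr_rank_one[OF lin_counit] counit_haar)
qed

lemma sw_antipode_sq:
  assumes t: "vector_space t" and f1: "\<And>y. hlin t (\<lambda>x. f x y)" and f2: "\<And>x. hlin t (\<lambda>y. f x y)"
  shows "sw f (S (S h)) = sw (\<lambda>a b. f (S (S a)) (S (S b))) h"
proof -
  have "sw f (S (S h)) = sw (\<lambda>a b. f (S b) (S a)) (S h)"
    by (rule sw_antipode) (rule assms)+
  also have "\<dots> = sw (\<lambda>a b. f (S (S a)) (S (S b))) h"
    by (rule sw_antipode[OF t]; intro lin_intros lin_comp[OF f1] lin_comp[OF f2])
  finally show ?thesis .
qed

text \<open>The left side is the trace of
  \<open>a \<mapsto> f(h\<^sub>1) h\<^sub>2 S\<^sup>2(a)\<close>. Rewriting this operator as a sum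
  of \<open>T b (h * S (S (U b a)))\<close> and cycling \<open>T b\<close> to the inside leaves
  \<open>f 1\<close> times the operator of \<open>lam h\<close>.\<close>

lemma lam_left_integral:
  assumes f: "hlin (*) f"
  shows "sw (\<lambda>a b. f a * lam b) h = f 1 * lam h"
proof -
  note li = lin_intros lin_comp[OF f]
  \<comment> \<open>\<open>T b\<close> reads the \<open>b\<close>-coordinate off the first leg, and
    \<open>U b\<close> pairs \<open>b\<close> with the antipode of that leg. Summed over the basis,
    \<open>U b\<close> after \<open>T b\<close> produces
    \<open>f(a\<^sub>1 S(a\<^sub>2)) a\<^sub>3\<close>.\<close>
  define T where "T b z = sw (\<lambda>p q. vcoord H b p \<odot> q) z" for b z
  define U where "U b z = sw (\<lambda>p q. f (b * S p) \<odot> q) z" for b z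
  have T: "hlin (scal H) (T b)" and U: "hlin (scal H) (U b)" for b
    unfolding T_def U_def by (intro li)+
  have key: "sw (\<lambda>p q. f p \<odot> (q * S (S a))) h = (\<Sum>b\<in>vbasis H. T b (h * S (S (U b a))))" for a
  proof -
    have T_U: "(\<Sum>b\<in>vbasis H. T b (h * S (S (U b a)))) =
        sw (\<lambda>r a'. sw (\<lambda>p q. f (p * S r) \<odot> q) (h * S (S a'))) a"
    proof -
      have lin: "hlin (scal H) (\<lambda>z. T b (h * S (S z)))" for b
        by (intro lin_intros lin_comp[OF T])
      have 1: "T b (h * S (S (U b a))) = sw (\<lambda>r a'. f (b * S r) \<odot> T b (h * S (S a'))) a" for b
        unfolding U_def by (subst sw_lin[OF lin]) (simp only: lin_scale[OF lin])
      have 2: "(\<Sum>b\<in>vbasis H. f (b * S r) \<odot> T b z) = sw (\<lambda>p q. f (p * S r) \<odot> q) z" for r z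
      proof -
        have "(\<Sum>b\<in>vbasis H. f (b * S r) \<odot> T b z) =
          sw (\<lambda>p q. \<Sum>b\<in>vbasis H. (vcoord H b p * f (b * S r)) \<odot> q) z"
          unfolding T_def by (simp add: sw_sum sw_scale[OF vector_space_H] mult.commute)
        moreover have "(\<Sum>b\<in>vbasis H. (vcoord H b p * f (b * S r)) \<odot> q) = f (p * S r) \<odot> q" for p q
        proof -
          have "(\<Sum>b\<in>vbasis H. vcoord H b p * f (b * S r)) = f (p * S r)"
            by (rule lin_expand[of "(*)" "\<lambda>b. f (b * S r)"]) (intro li)
          then show ?thesis by (simp flip: H.scale_sum_left)
        qed
        ultimately show ?thesis by simp
      qed
      show ?thesis by (simp only: 1 sw_sum[symmetric] 2)
    qed
    define G where "G p q r c d = f (p * (S (S c) * S r)) \<odot> (q * S (S d))" for p q r c d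
    have 3: "sw (\<lambda>p q. f (p * S r) \<odot> q) (h * S (S a')) = sw (\<lambda>p q. sw (\<lambda>c d. G p q r c d) a') h" for r a'
    proof -
      have "sw (\<lambda>p q. f (p * S r) \<odot> q) (h * S (S a')) =
        sw (\<lambda>p q. sw (\<lambda>c d. f (p * c * S r) \<odot> (q * d)) (S (S a'))) h"
        by (rule sw_mult[OF vector_space_H]; intro li)
      moreover have "sw (\<lambda>c d. f (p * c * S r) \<odot> (q * d)) (S (S a')) = sw (\<lambda>c d. G p q r c d) a'" for p q
        unfolding G_def mult.assoc[symmetric]
        by (rule sw_antipode_sq[OF vector_space_H]; intro li)
      ultimately show ?thesis by simp
    qed
    have 4: "sw (\<lambda>r a'. sw (\<lambda>p q. sw (\<lambda>c d. G p q r c d) a') h) a =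
      sw (\<lambda>p q. sw (\<lambda>r a'. sw (\<lambda>c d. G p q r c d) a') a) h"
      by (rule sw_swap)
    have 5: "sw (\<lambda>r a'. sw (\<lambda>c d. G p q r c d) a') a = sw (\<lambda>z d. sw (\<lambda>r c. G p q r c d) z) a" for p q
      unfolding G_def by (rule sw_coassoc[OF vector_space_H]; intro li)
    \<comment> \<open>The legs cancel through \<open>S\<^sup>2(c) S(r) = S(r S(c))\<close>; this is
      what fixes the square of the antipode in \<open>lam\<close>.\<close>
    have 6: "sw (\<lambda>r c. G p q r c d) z = \<epsilon> z \<odot> (f p \<odot> (q * S (S d)))" for p q d z
    proof -
      have "sw (\<lambda>r c. f (p * S (r * S c)) \<odot> (q * S (S d))) z = \<epsilon> z \<odot> (f (p * S 1) \<odot> (q * S (S d)))"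
        by (rule sw_antipode_right[of "scal H" "\<lambda>w. f (p * S w) \<odot> (q * S (S d))"]) (intro li)
      then show ?thesis by (simp add: G_def antipode_mult antipode_1)
    qed
    have 7: "sw (\<lambda>z d. \<epsilon> z \<odot> (f p \<odot> (q * S (S d)))) a = f p \<odot> (q * S (S a))" for p q
      by (rule sw_counit_left) (intro li)
    show ?thesis unfolding T_U 3 4 5 6 7 ..
  qed
  have UT: "(\<Sum>b\<in>vbasis H. U b (T b a)) = f 1 \<odot> a" for a
  proof -
    have 1: "U b (T b a) = sw (\<lambda>p q. vcoord H b p \<odot> U b q) a" for b
      unfolding T_def by (subst sw_lin[OF U]) (simp only: lin_scale[OF U])
    have 2: "(\<Sum>b\<in>vbasis H. vcoord H b p \<odot> U b q) = U p q" for p q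
      by (rule lin_expand) (unfold U_def, intro li)
    have 3: "sw (\<lambda>p q. U p q) a = sw (\<lambda>z s. sw (\<lambda>p r. f (p * S r) \<odot> s) z) a"
      unfolding U_def by (rule sw_coassoc[OF vector_space_H]; intro li)
    have 4: "sw (\<lambda>p r. f (p * S r) \<odot> s) z = \<epsilon> z \<odot> (f 1 \<odot> s)" for s z
      by (rule sw_antipode_right[of "scal H" "\<lambda>w. f w \<odot> s"]) (intro li f)
    have 5: "sw (\<lambda>z s. \<epsilon> z \<odot> (f 1 \<odot> s)) a = f 1 \<odot> a"
      by (rule sw_counit_left) (intro li)
    show ?thesis by (simp only: 1 2 3 4 5 sw_sum[symmetric])
  qed
  have "sw (\<lambda>a b. f a * lam b) h = sw (\<lambda>a b. htr (\<lambda>x. f a \<odot> (b * S (S x)))) h"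
    unfolding lam_def by (simp add: H.trace_scale)
  also have "\<dots> = htr (\<lambda>x. sw (\<lambda>p q. f p \<odot> (q * S (S x))) h)"
    by (simp add: htr_sw)
  also have "\<dots> = (\<Sum>b\<in>vbasis H. htr (\<lambda>x. T b (h * S (S (U b x)))))"
    unfolding key by (rule H.trace_sum) simp
  also have "\<dots> = (\<Sum>b\<in>vbasis H. htr (\<lambda>x. h * S (S (U b (T b x)))))"
  proof (rule sum.cong[OF refl])
    fix b
    show "htr (\<lambda>x. T b (h * S (S (U b x)))) = htr (\<lambda>x. h * S (S (U b (T b x))))"
      by (rule htr_comm[of "T b" "\<lambda>x. h * S (S (U b x))"]; intro lin_intros T lin_comp[OF U])
  qed
  also have "\<dots> = htr (\<lambda>x. \<Sum>b\<in>vbasis H. h * S (S (U b (T b x))))"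
    by (rule H.trace_sum[symmetric]) simp
  also have "\<dots> = htr (\<lambda>x. h * S (S (f 1 \<odot> x)))"
    by (simp add: UT[symmetric] lin_sum[OF lin_antipode] sum_distrib_left)
  also have "\<dots> = f 1 * lam h"
    unfolding lam_def by (simp add: lin_scale[OF lin_antipode] scale_mult_right H.trace_scale)
  finally show ?thesis .
qed

section \<open>Casimir identities: moving an element between the two legs of the Haar
  integral\<close>

lemma haar_casimir_left:
  assumes t: "vector_space t" and f1: "\<And>y. hlin t (\<lambda>x. f x y)" and f2: "\<And>x. hlin t (\<lambda>y. f x y)"
  shows "sw (\<lambda>a b. f a (k * b)) \<Lambda> = sw (\<lambda>a b. f (S k * a) b) \<Lambda>"
proof -
  note li = lin_intros t lin_comp[OF f1] lin_comp[OF f2]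
  \<comment> \<open>This is \<open>f\<close> at \<open>S(k\<^sub>1) k\<^sub>2 \<Lambda>\<^sub>1
    \<otimes> k\<^sub>3 \<Lambda>\<^sub>2\<close>. With \<open>k\<^sub>2 \<otimes> k\<^sub>3\<close>
    read as a coproduct, \<open>\<Lambda>\<close> absorbs it; with
    \<open>S(k\<^sub>1) k\<^sub>2\<close> collapsed first, only \<open>k\<close> on the second leg
    remains.\<close>
  define G where "G a b c p q = f (S a * (b * p)) (c * q)" for a b c p q
  have 1: "sw (\<lambda>b c. sw (\<lambda>p q. G a b c p q) \<Lambda>) z = t (\<epsilon> z) (sw (\<lambda>p q. f (S a * p) q) \<Lambda>)" for a z
  proof -
    have "sw (\<lambda>b c. sw (\<lambda>p q. G a b c p q) \<Lambda>) z = sw (\<lambda>p q. f (S a * p) q) (z * \<Lambda>)"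
      unfolding G_def by (rule sw_mult[OF t, symmetric]; intro li)
    also have "\<dots> = sw (\<lambda>p q. f (S a * p) q) (\<epsilon> z \<odot> \<Lambda>)" by (simp only: haar_left)
    also have "\<dots> = t (\<epsilon> z) (sw (\<lambda>p q. f (S a * p) q) \<Lambda>)"
      by (rule lin_scale[where s = "scal H"]) (intro li)
    finally show ?thesis .
  qed
  have 2: "sw (\<lambda>a z. t (\<epsilon> z) (sw (\<lambda>p q. f (S a * p) q) \<Lambda>)) k = sw (\<lambda>p q. f (S k * p) q) \<Lambda>"
    by (rule sw_counit_right) (intro li)
  have 3: "sw (\<lambda>a z. sw (\<lambda>b c. sw (\<lambda>p q. G a b c p q) \<Lambda>) z) k =
    sw (\<lambda>z c. sw (\<lambda>a b. sw (\<lambda>p q. G a b c p q) \<Lambda>) z) k"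
    unfolding G_def by (rule sw_coassoc[OF t]; intro li)
  have 4: "sw (\<lambda>a b. sw (\<lambda>p q. G a b c p q) \<Lambda>) z = t (\<epsilon> z) (sw (\<lambda>p q. f p (c * q)) \<Lambda>)" for c z
  proof -
    have "sw (\<lambda>a b. G a b c p q) z = t (\<epsilon> z) (f p (c * q))" for p q
      using sw_antipode_left[of t "\<lambda>w. f (w * p) (c * q)" z, OF lin_comp[OF f1]]
      by (simp add: G_def mult.assoc lin_intros)
    then show ?thesis by (subst sw_swap) (simp add: sw_scale[OF t])
  qed
  have 5: "sw (\<lambda>z c. t (\<epsilon> z) (sw (\<lambda>p q. f p (c * q)) \<Lambda>)) k = sw (\<lambda>p q. f p (k * q)) \<Lambda>"
    by (rule sw_counit_left) (intro li)
  show ?thesis using 3 by (simp only: 1 2 4 5)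
qed

lemma haar_casimir_right:
  assumes t: "vector_space t" and f1: "\<And>y. hlin t (\<lambda>x. f x y)" and f2: "\<And>x. hlin t (\<lambda>y. f x y)"
  shows "sw (\<lambda>a b. f (a * k) b) \<Lambda> = sw (\<lambda>a b. f a (b * S k)) \<Lambda>"
proof -
  note li = lin_intros t lin_comp[OF f1] lin_comp[OF f2]
  \<comment> \<open>The mirror image: \<open>f\<close> at \<open>\<Lambda>\<^sub>1 k\<^sub>1
    \<otimes> \<Lambda>\<^sub>2 k\<^sub>2 S(k\<^sub>3)\<close>.\<close>
  define G where "G a b c p q = f (p * a) (q * b * S c)" for a b c p q
  have 1: "sw (\<lambda>a b. sw (\<lambda>p q. G a b c p q) \<Lambda>) z = t (\<epsilon> z) (sw (\<lambda>p q. f p (q * S c)) \<Lambda>)" for c z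
  proof -
    have "sw (\<lambda>a b. sw (\<lambda>p q. G a b c p q) \<Lambda>) z = sw (\<lambda>p q. sw (\<lambda>a b. f (p * a) (q * b * S c)) z) \<Lambda>"
      unfolding G_def by (rule sw_swap)
    also have "\<dots> = sw (\<lambda>p q. f p (q * S c)) (\<Lambda> * z)"
      by (rule sw_mult[OF t, symmetric]; intro li)
    also have "\<dots> = sw (\<lambda>p q. f p (q * S c)) (\<epsilon> z \<odot> \<Lambda>)" by (simp only: haar_right)
    also have "\<dots> = t (\<epsilon> z) (sw (\<lambda>p q. f p (q * S c)) \<Lambda>)"
      by (rule lin_scale[where s = "scal H"]) (intro li)
    finally show ?thesis .
  qed
  have 2: "sw (\<lambda>z c. t (\<epsilon> z) (sw (\<lambda>p q. f p (q * S c)) \<Lambda>)) k = sw (\<lambda>p q. f p (q * S k)) \<Lambda>"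
    by (rule sw_counit_left) (intro li)
  have 3: "sw (\<lambda>a z. sw (\<lambda>b c. sw (\<lambda>p q. G a b c p q) \<Lambda>) z) k =
    sw (\<lambda>z c. sw (\<lambda>a b. sw (\<lambda>p q. G a b c p q) \<Lambda>) z) k"
    unfolding G_def by (rule sw_coassoc[OF t]; intro li)
  have 4: "sw (\<lambda>b c. sw (\<lambda>p q. G a b c p q) \<Lambda>) z = t (\<epsilon> z) (sw (\<lambda>p q. f (p * a) q) \<Lambda>)" for a z
  proof -
    have "sw (\<lambda>b c. G a b c p q) z = t (\<epsilon> z) (f (p * a) q)" for p q
      using sw_antipode_right[of t "\<lambda>w. f (p * a) (q * w)" z, OF lin_comp[OF f2]]
      by (simp add: G_def mult.assoc lin_intros)
    then show ?thesis by (subst sw_swap) (simp add: sw_scale[OF t])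
  qed
  have 5: "sw (\<lambda>a z. t (\<epsilon> z) (sw (\<lambda>p q. f (p * a) q) \<Lambda>)) k = sw (\<lambda>p q. f (p * k) q) \<Lambda>"
    by (rule sw_counit_right) (intro li)
  show ?thesis using 3 by (simp only: 1 2 4 5)
qed

section \<open>One-sided integrals of the dual Hopf algebra, viewed as functionals on
  \<open>H\<close>\<close>

definition left_int :: "('h \<Rightarrow> 'k) \<Rightarrow> bool" where
  "left_int \<rho> \<longleftrightarrow> hlin (*) \<rho> \<and> (\<forall>h. sw (\<lambda>a b. \<rho> b \<odot> a) h = \<rho> h \<odot> 1)"

definition right_int :: "('h \<Rightarrow> 'k) \<Rightarrow> bool" where
  "right_int \<rho> \<longleftrightarrow> hlin (*) \<rho> \<and> (\<forall>h. sw (\<lambda>a b. \<rho> a \<odot> b) h = \<rho> h \<odot> 1)"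

lemma left_int_lam: "left_int lam"
proof -
  have "sw (\<lambda>a b. lam b \<odot> a) h = lam h \<odot> 1" for h
  proof (rule vcoord_eqI)
    fix c
    show "vcoord H c (sw (\<lambda>a b. lam b \<odot> a) h) = vcoord H c (lam h \<odot> 1)"
      using lam_left_integral[OF lin_vcoord, of c h]
      by (simp add: sw_lin[OF lin_vcoord] lin_scale[OF lin_vcoord] mult.commute)
  qed
  then show ?thesis by (simp add: left_int_def lin_lam)
qed

lemma left_int_apply:
  assumes "left_int \<rho>" "hlin t \<phi>"
  shows "sw (\<lambda>a b. t (\<rho> b) (\<phi> a)) h = t (\<rho> h) (\<phi> 1)"
proof -
  have "\<phi> (sw (\<lambda>a b. \<rho> b \<odot> a) h) = \<phi> (\<rho> h \<odot> 1)" using assms(1) by (simp add: left_int_def)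
  then show ?thesis by (simp add: sw_lin[OF assms(2)] lin_scale[OF assms(2)])
qed

lemma right_int_apply:
  assumes "right_int \<rho>" "hlin t \<phi>"
  shows "sw (\<lambda>a b. t (\<rho> a) (\<phi> b)) h = t (\<rho> h) (\<phi> 1)"
proof -
  have "\<phi> (sw (\<lambda>a b. \<rho> a \<odot> b) h) = \<phi> (\<rho> h \<odot> 1)" using assms(1) by (simp add: right_int_def)
  then show ?thesis by (simp add: sw_lin[OF assms(2)] lin_scale[OF assms(2)])
qed

text \<open>The Casimir identity turns \<open>k\<close> on the second leg into \<open>S k\<close> on
  the first, outside the reach of \<open>\<rho>\<close>. The antipode is thus recovered from a left
  integral, which yields non-degeneracy of \<open>lam\<close>.\<close>

lemma antipode_via_left_int:
  assumes "left_int \<rho>"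
  shows "sw (\<lambda>a b. \<rho> (k * b) \<odot> a) \<Lambda> = \<rho> \<Lambda> \<odot> S k"
proof -
  have \<rho>: "hlin (*) \<rho>" using assms by (simp add: left_int_def)
  have "sw (\<lambda>a b. \<rho> (k * b) \<odot> a) \<Lambda> = sw (\<lambda>a b. \<rho> b \<odot> (S k * a)) \<Lambda>"
    by (rule haar_casimir_left[OF vector_space_H, of "\<lambda>a b. \<rho> b \<odot> a"]; intro lin_intros \<rho>)
  also have "\<dots> = \<rho> \<Lambda> \<odot> (S k * 1)"
    by (rule left_int_apply[OF assms]) (intro lin_intros)
  finally show ?thesis by simp
qed

text \<open>The element \<open>h\<close> is recovered from \<open>S h\<close> as
  \<open>lam(\<Lambda>\<^sub>2 S(h)) \<Lambda>\<^sub>1\<close>.\<close>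

lemma antipode_inject: "S x = S y \<longleftrightarrow> x = y"
proof -
  have "sw (\<lambda>a b. lam (b * S h) \<odot> a) \<Lambda> = h" for h
  proof -
    have "sw (\<lambda>a b. lam (b * S h) \<odot> a) \<Lambda> = sw (\<lambda>a b. lam b \<odot> (a * h)) \<Lambda>"
      by (rule haar_casimir_right[OF vector_space_H, of "\<lambda>a b. lam b \<odot> a", symmetric]; intro lin_intros)
    also have "\<dots> = lam \<Lambda> \<odot> (1 * h)"
      by (rule left_int_apply[OF left_int_lam]) (intro lin_intros)
    finally show ?thesis by (simp add: lam_haar)
  qed
  then show ?thesis by metis
qed

lemma antipode_surj: "\<exists>x. S x = y"
  by (rule lin_inj_surj[OF lin_antipode]) (metis antipode_inject lin_antipode lin_zero)

text \<open>Surjectivity of \<open>S\<close> makes \<open>S \<Lambda>\<close> a left integral, and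
  its counit is 1.\<close>

lemma antipode_haar: "S \<Lambda> = \<Lambda>"
proof -
  have "h * S \<Lambda> = \<epsilon> h \<odot> S \<Lambda>" for h
  proof -
    obtain x where "h = S x" using antipode_surj by metis
    then show ?thesis
      by (simp add: haar_right lin_scale[OF lin_antipode] counit_antipode flip: antipode_mult)
  qed
  then have "S \<Lambda> = \<epsilon> (S \<Lambda>) \<odot> \<Lambda>" by (rule left_integral_unique)
  then show ?thesis by (simp add: counit_antipode counit_haar)
qed

lemma lam_nondegenerate:
  assumes "\<And>b. lam (k * b) = 0"
  shows "k = 0"
proof -
  have "sw (\<lambda>a b. lam (k * b) \<odot> a) \<Lambda> = S k"
    by (simp add: antipode_via_left_int[OF left_int_lam] lam_haar)
  moreover have "sw (\<lambda>a b. 0) \<Lambda> = (0 :: 'h)" by (simp add: sw_cop case_prod_unfold)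
  ultimately have "S k = S 0" using assms by (simp add: lin_zero[OF lin_antipode])
  then show ?thesis by (simp add: antipode_inject)
qed

lemma right_int_lam_antipode: "right_int (\<lambda>h. lam (S h))"
proof -
  have "S (sw (\<lambda>a b. lam (S a) \<odot> b) h) = S (lam (S h) \<odot> 1)" for h
  proof -
    have "S (sw (\<lambda>a b. lam (S a) \<odot> b) h) = sw (\<lambda>a b. lam (S a) \<odot> S b) h"
      by (simp add: sw_lin[OF lin_antipode] lin_scale[OF lin_antipode])
    also have "\<dots> = sw (\<lambda>x y. lam y \<odot> x) (S h)"
      by (rule sw_antipode[OF vector_space_H, symmetric]; intro lin_intros)
    also have "\<dots> = S (lam (S h) \<odot> 1)"
      using left_int_lam by (simp add: left_int_def lin_scale[OF lin_antipode] antipode_1)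
    finally show ?thesis .
  qed
  then show ?thesis by (simp add: right_int_def antipode_inject) (intro lin_intros)
qed

lemma left_int_right_int_antipode:
  assumes "right_int \<mu>"
  shows "left_int (\<lambda>h. \<mu> (S h))"
proof -
  have \<mu>: "hlin (*) \<mu>" using assms by (simp add: right_int_def)
  have "S (sw (\<lambda>a b. \<mu> (S b) \<odot> a) h) = S (\<mu> (S h) \<odot> 1)" for h
  proof -
    have "S (sw (\<lambda>a b. \<mu> (S b) \<odot> a) h) = sw (\<lambda>a b. \<mu> (S b) \<odot> S a) h"
      by (simp add: sw_lin[OF lin_antipode] lin_scale[OF lin_antipode])
    also have "\<dots> = sw (\<lambda>x y. \<mu> x \<odot> y) (S h)"
      by (rule sw_antipode[OF vector_space_H, symmetric]; intro lin_intros \<mu>)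
    also have "\<dots> = S (\<mu> (S h) \<odot> 1)"
      using assms by (simp add: right_int_def lin_scale[OF lin_antipode] antipode_1)
    finally show ?thesis .
  qed
  then show ?thesis
    by (simp add: left_int_def antipode_inject) (intro lin_intros lin_comp[OF \<mu>])
qed

text \<open>Pair a left integral \<open>\<sigma>\<close> with the right integral
  \<open>lam \<circ> S\<close> along \<open>\<Lambda>\<close>, with \<open>h\<close> inserted. The
  right integral property evaluates this to \<open>\<sigma> h\<close>, the left one to
  \<open>\<sigma> \<Lambda> * lam (S (S h))\<close>; the case \<open>\<sigma> = lam\<close> removes
  the two antipodes.\<close>

lemma left_int_unique:
  assumes "left_int \<rho>"
  shows "\<rho> h = \<rho> \<Lambda> * lam h"
proof -
  have \<rho>: "hlin (*) \<rho>" using assms by (simp add: left_int_def)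
  have *: "sw (\<lambda>a b. (lam (S a) * \<sigma> (h * b))) \<Lambda> = \<sigma> h" if "hlin (*) \<sigma>" for \<sigma>
    using right_int_apply[OF right_int_lam_antipode, of "(*)" "\<lambda>b. \<sigma> (h * b)" \<Lambda>]
    by (simp add: lin_comp[OF that] lin_intros antipode_haar lam_haar)
  have **: "sw (\<lambda>a b. (lam (S a) * \<sigma> (h * b))) \<Lambda> = \<sigma> \<Lambda> * lam (S (S h))" if "left_int \<sigma>" for \<sigma>
    using arg_cong[OF antipode_via_left_int[OF that, of h], of "\<lambda>x. lam (S x)"]
    by (simp add: sw_lin[OF lin_comp[OF lin_lam lin_antipode]] lin_scale[OF lin_lam] 
        lin_scale[OF lin_antipode] mult.commute)
  have "\<rho> h = \<rho> \<Lambda> * lam (S (S h))" using *[OF \<rho>] **[OF assms] by simp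
  moreover have "lam h = lam (S (S h))" using *[OF lin_lam] **[OF left_int_lam] by (simp add: lam_haar)
  ultimately show ?thesis by simp
qed

text \<open>The distinguished grouplike element of \<open>H\<close>.\<close>

definition dg :: 'h where "dg = sw (\<lambda>a b. lam a \<odot> b) \<Lambda>"

text \<open>Every coordinate of the left side is again a left integral in \<open>h\<close>, hence a
  multiple of \<open>lam\<close>; its value at \<open>\<Lambda>\<close> is the coordinate of
  \<open>dg\<close>.\<close>

lemma lam_right: "sw (\<lambda>a b. lam a \<odot> b) h = lam h \<odot> dg"
proof (rule vcoord_eqI)
  fix c
  define \<rho> where "\<rho> h = sw (\<lambda>a b. lam a * vcoord H c b) h" for h
  have \<rho>: "vcoord H c (sw (\<lambda>a b. lam a \<odot> b) h) = \<rho> h" for h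
    by (simp add: sw_lin[OF lin_vcoord] lin_scale[OF lin_vcoord] \<rho>_def)
  have "left_int \<rho>"
    unfolding left_int_def
  proof (intro conjI allI)
    show "hlin (*) \<rho>" unfolding \<rho>_def by (intro lin_intros)
    fix h
    have 1: "\<rho> b \<odot> a = sw (\<lambda>c' d. (lam c' * vcoord H c d) \<odot> a) b" for a b
      unfolding \<rho>_def by (rule sw_lin[of "(*)" "scal H" "\<lambda>x. x \<odot> a"]) (intro lin_intros)
    have 2: "sw (\<lambda>a b. sw (\<lambda>c' d. (lam c' * vcoord H c d) \<odot> a) b) h =
      sw (\<lambda>z d. sw (\<lambda>a c'. (lam c' * vcoord H c d) \<odot> a) z) h"
      by (rule sw_coassoc[OF vector_space_H]; intro lin_intros)
    have 3: "sw (\<lambda>a c'. (lam c' * vcoord H c d) \<odot> a) z = (lam z * vcoord H c d) \<odot> 1" for d z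
      using left_int_apply[OF left_int_lam, of "scal H" "\<lambda>a. vcoord H c d \<odot> a" z]
      by (simp add: lin_intros)
    show "sw (\<lambda>a b. \<rho> b \<odot> a) h = \<rho> h \<odot> 1"
      unfolding 1 2 3 ..
  qed
  then have "\<rho> h = \<rho> \<Lambda> * lam h" by (rule left_int_unique)
  then show "vcoord H c (sw (\<lambda>a b. lam a \<odot> b) h) = vcoord H c (lam h \<odot> dg)"
    unfolding \<rho> unfolding dg_def lin_scale[OF lin_vcoord] \<rho> by simp
qed

text \<open>Coassociativity and two uses of \<open>lam_right\<close> give
  \<open>\<Delta>(dg) = dg \<otimes> dg\<close>.\<close>

lemma sw_dg:
  assumes t: "vector_space t" and f1: "\<And>y. hlin t (\<lambda>x. f x y)" and f2: "\<And>x. hlin t (\<lambda>y. f x y)"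
  shows "sw f dg = f dg dg"
proof -
  note li = lin_intros t lin_comp[OF f1] lin_comp[OF f2]
  have L: "hlin t (sw f)" by (rule lin_sw_arg[OF t f1 f2])
  interpret T: vector_space t by fact
  have 1: "sw f dg = sw (\<lambda>a b. t (lam a) (sw f b)) \<Lambda>"
    unfolding dg_def by (simp add: sw_lin[OF L] lin_scale[OF L])
  have lt: "hlin t (\<lambda>a. t (lam a) x)" for x
    by (simp add: lin_def lin_add[OF lin_lam] lin_scale[OF lin_lam] T.scale_left_distrib)
  have lt': "lin s t (\<lambda>a. t c (g a))" if "lin s t g" for s g c
    using that by (simp add: lin_def T.scale_right_distrib mult.commute)
  have 2: "sw (\<lambda>a b. sw (\<lambda>c d. t (lam a) (f c d)) b) \<Lambda> = sw (\<lambda>z d. sw (\<lambda>a c. t (lam a) (f c d)) z) \<Lambda>"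
    by (rule sw_coassoc[OF t]; intro lt lt' f1 f2)
  have 3: "sw (\<lambda>a c. t (lam a) (f c d)) z = t (lam z) (f dg d)" for d z
    using arg_cong[OF lam_right[of z], of "\<lambda>x. f x d"]
    by (simp add: sw_lin[OF f1] lin_scale[OF f1])
  have 4: "sw (\<lambda>z d. t (lam z) (f dg d)) \<Lambda> = f dg dg"
    using arg_cong[OF lam_right[of \<Lambda>], of "\<lambda>x. f dg x"]
    by (simp add: sw_lin[OF f2] lin_scale[OF f2] lam_haar)
  show ?thesis unfolding 1 sw_scale[OF t] 2 3 4 ..
qed

lemma counit_dg: "\<epsilon> dg = 1"
proof -
  have "\<epsilon> dg = sw (\<lambda>a b. \<epsilon> b * lam a) \<Lambda>"
    unfolding dg_def by (simp add: sw_lin[OF lin_counit] lin_scale[OF lin_counit] mult.commute)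
  also have "\<dots> = lam \<Lambda>" by (rule sw_counit_right[OF lin_lam])
  finally show ?thesis by (simp add: lam_haar)
qed

lemma antipode_dg: "S dg * dg = 1" "dg * S dg = 1"
proof -
  have "S dg * dg = sw (\<lambda>a b. S a * b) dg"
    by (rule sw_dg[OF vector_space_H, of "\<lambda>a b. S a * b", symmetric]; intro lin_intros)
  also have "\<dots> = \<epsilon> dg \<odot> 1" by (rule sw_antipode_left[OF lin_id])
  finally show "S dg * dg = 1" by (simp add: counit_dg)
  have "dg * S dg = sw (\<lambda>a b. a * S b) dg"
    by (rule sw_dg[OF vector_space_H, of "\<lambda>a b. a * S b", symmetric]; intro lin_intros)
  also have "\<dots> = \<epsilon> dg \<odot> 1" by (rule sw_antipode_right[OF lin_id])
  finally show "dg * S dg = 1" by (simp add: counit_dg)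
qed

text \<open>Translation by the grouplike \<open>dg\<close> turns \<open>lam\<close> into a right
  integral. Composed with \<open>S\<close> it is a left integral again, and its value at
  \<open>\<Lambda>\<close> is 1.\<close>

lemma lam_antipode: "lam (S h * dg) = lam h"
proof -
  have "right_int (\<lambda>h. lam (h * dg))"
    unfolding right_int_def
  proof (intro conjI allI)
    show "hlin (*) (\<lambda>h. lam (h * dg))" by (intro lin_intros)
    fix h
    have "lam (h * dg) \<odot> dg = sw (\<lambda>a b. lam a \<odot> b) (h * dg)"
      by (rule lam_right[symmetric])
    also have "\<dots> = sw (\<lambda>a b. sw (\<lambda>c d. lam (a * c) \<odot> (b * d)) dg) h"
      by (rule sw_mult[OF vector_space_H]; intro lin_intros)
    also have "\<dots> = sw (\<lambda>a b. lam (a * dg) \<odot> (b * dg)) h"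
    proof -
      have "sw (\<lambda>c d. lam (a * c) \<odot> (b * d)) dg = lam (a * dg) \<odot> (b * dg)" for a b
        by (rule sw_dg[OF vector_space_H]; intro lin_intros)
      then show ?thesis by simp
    qed
    also have "\<dots> = sw (\<lambda>a b. lam (a * dg) \<odot> b) h * dg"
      by (simp add: sw_mult_right scale_mult_left)
    finally have "lam (h * dg) \<odot> dg * S dg = sw (\<lambda>a b. lam (a * dg) \<odot> b) h * dg * S dg" by simp
    then show "sw (\<lambda>a b. lam (a * dg) \<odot> b) h = lam (h * dg) \<odot> 1"
      by (simp add: mult.assoc antipode_dg scale_mult_left)
  qed
  then have "lam (S h * dg) = lam (S \<Lambda> * dg) * lam h"
    by (rule left_int_unique[OF left_int_right_int_antipode])
  then show ?thesis
    by (simp add: antipode_haar haar_right counit_dg lam_haar)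
qed

text \<open>Passing through \<open>lam_antipode\<close> and \<open>lam_comm\<close> gives
  \<open>lam (a * b) = lam (w * a)\<close> with \<open>w = dg * S (S b) * S dg\<close>. Comparison
  with \<open>lam_comm\<close> itself and non-degeneracy give \<open>b = S (S w)\<close>.\<close>

lemma radford: "S (S (S (S b))) = S dg * b * dg"
proof -
  have SS: "S (S dg) = dg"
  proof -
    have "S dg * S (S dg) = 1"
      using arg_cong[OF antipode_dg(1), of S] by (simp add: antipode_mult antipode_1)
    then have "dg * (S dg * S (S dg)) = dg" by simp
    then show ?thesis by (simp add: antipode_dg flip: mult.assoc)
  qed
  define w where "w = dg * S (S b) * S dg"
  have "lam ((b - S (S w)) * z) = 0" for z
  proof -
    obtain a where a: "z = S (S a)" by (metis antipode_surj)
    have "lam (a * b) = lam (S (a * b) * dg)" by (rule lam_antipode[symmetric])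
    also have "\<dots> = lam (S a * dg * S (S (S b)))"
      unfolding antipode_mult mult.assoc by (subst lam_comm) (simp only: mult.assoc)
    also have "S (S (S b)) = S dg * (dg * S (S (S b)) * S dg) * dg"
      by (simp add: mult.assoc antipode_dg) (simp add: antipode_dg flip: mult.assoc)
    also have "lam (S a * dg * \<dots>) = lam (S (w * a) * dg)"
      by (simp add: w_def antipode_mult SS mult.assoc)
        (simp add: antipode_dg flip: mult.assoc)
    also have "\<dots> = lam (w * a)" by (rule lam_antipode)
    finally have "lam (a * b) = lam (w * a)" .
    then have "lam (b * z) = lam (S (S w) * z)"
      using lam_comm[of a b] lam_comm[of w a] lam_comm[of a "S (S w)"] by (simp add: a)
    then show ?thesis by (simp add: left_diff_distrib lin_diff[OF lin_lam])
  qed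
  then have "b = S (S w)" using lam_nondegenerate by force
  then have "b = dg * S (S (S (S b))) * S dg" by (simp add: w_def antipode_mult SS)
  then have "S dg * b * dg = S dg * (dg * S (S (S (S b))) * S dg) * dg" by simp
  then show ?thesis by (simp add: mult.assoc antipode_dg) (simp add: antipode_dg flip: mult.assoc)
qed

end

section \<open>The trace of the squared antipode\<close>

text \<open>The coordinate along 1 in a basis of \<open>k\<close> over the rationals.\<close>

lemma exists_rational_functional:
  "\<exists>\<phi> :: 'k::field_char_0 \<Rightarrow> rat. (\<forall>x y. \<phi> (x + y) = \<phi> x + \<phi> y) \<and> \<phi> 1 = 1"
proof -
  interpret Q: vector_space "\<lambda>q (x::'k). of_rat q * x"
    by unfold_locales (simp_all add: algebra_simps of_rat_add of_rat_mult)
  have ind: "Q.independent {1 :: 'k}" by simp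
  let ?B = "Q.extend_basis {1 :: 'k}"
  have B: "Q.independent ?B" "Q.span ?B = UNIV" "1 \<in> ?B"
    using Q.independent_extend_basis[OF ind] Q.span_extend_basis[OF ind]
      Q.extend_basis_superset[OF ind] by auto
  show ?thesis
    by (rule exI[of _ "\<lambda>x. Q.representation ?B x 1"])
      (simp add: Q.representation_add[OF B(1)] B Q.representation_basis[OF B(1) B(3)])
qed

lemma finite_roots_of_unity:
  assumes "N > 0"
  shows "finite {\<xi> :: 'k::field. \<xi> ^ N = 1}"
proof -
  have "monom 1 N - 1 \<noteq> (0 :: 'k poly)"
  proof
    assume "monom 1 N - 1 = (0 :: 'k poly)"
    then have "degree (monom (1::'k) N) = degree (1 :: 'k poly)" by simp
    with assms show False by (simp add: degree_monom_eq)
  qed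
  from poly_roots_finite[OF this] show ?thesis by (simp add: poly_monom)
qed

text \<open>The double sum is \<open>\<Sum>\<^sub>c \<bar>\<Sum>\<^sub>e\<^sub>\<in>\<^sub>c \<eta>\<^sub>e\<bar>\<^sup>2\<close> for roots of unity \<open>\<eta>\<^sub>e\<close>, with \<open>c\<close> running over the classes.
  Instead of embedding a cyclotomic field into the complex numbers, one composes with a
  \<open>\<rat>\<close>-linear functional \<open>\<phi>\<close> on \<open>k\<close> and sums over all rotations by roots of unity \<open>\<xi>\<close>, which turns
  it into a sum of rational squares.\<close>

lemma sum_ratios_nonzero:
  fixes \<zeta> :: "'e \<Rightarrow> 'k::field_char_0"
  assumes fin: "finite E" and N: "N > 0" and \<zeta>: "\<And>e. e \<in> E \<Longrightarrow> \<zeta> e \<noteq> 0"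
    and refl: "\<And>e. e \<in> E \<Longrightarrow> R e e"
    and sym: "\<And>e f. e \<in> E \<Longrightarrow> f \<in> E \<Longrightarrow> R e f \<Longrightarrow> R f e"
    and trans: "\<And>e f g. e \<in> E \<Longrightarrow> f \<in> E \<Longrightarrow> g \<in> E \<Longrightarrow> R e f \<Longrightarrow> R f g \<Longrightarrow> R e g"
    and pow: "\<And>e f. e \<in> E \<Longrightarrow> f \<in> E \<Longrightarrow> R e f \<Longrightarrow> \<zeta> e ^ N = \<zeta> f ^ N"
    and e0: "e0 \<in> E" "\<And>f. f \<in> E \<Longrightarrow> R e0 f \<Longrightarrow> f = e0"
  shows "(\<Sum>e\<in>E. \<Sum>f\<in>E. if R e f then \<zeta> e / \<zeta> f else 0) \<noteq> 0"
proof
  assume D0: "(\<Sum>e\<in>E. \<Sum>f\<in>E. if R e f then \<zeta> e / \<zeta> f else 0) = 0"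
  obtain \<phi> :: "'k \<Rightarrow> rat" where \<phi>: "\<And>x y. \<phi> (x + y) = \<phi> x + \<phi> y" "\<phi> 1 = 1"
    using exists_rational_functional by blast
  have \<phi>0: "\<phi> 0 = 0" using \<phi>(1)[of 0 0] by simp
  have \<phi>_sum: "\<phi> (sum g A) = (\<Sum>a\<in>A. \<phi> (g a))" for g :: "'e \<Rightarrow> 'k" and A
    by (induction A rule: infinite_finite_induct) (simp_all add: \<phi> \<phi>0)
  define U where "U = {\<xi> :: 'k. \<xi> ^ N = 1}"
  have finU: "finite U" unfolding U_def by (rule finite_roots_of_unity[OF N])
  \<comment> \<open>Dividing by a class representative normalises the ratios:
    \<open>\<eta> e\<close> is an \<open>N\<close>-th root of unity, although
    \<open>\<zeta> e\<close> itself need not be one.\<close>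
  define r where "r e = (SOME i. i \<in> E \<and> R e i)" for e
  have r: "r e \<in> E \<and> R e (r e)" if "e \<in> E" for e
    unfolding r_def by (rule someI[of _ e]) (simp add: that refl)
  have r_iff: "R e f \<longleftrightarrow> r e = r f" if ef: "e \<in> E" "f \<in> E" for e f
  proof
    assume "R e f"
    then have "(\<lambda>i. i \<in> E \<and> R e i) = (\<lambda>i. i \<in> E \<and> R f i)"
      using ef sym trans by blast
    then show "r e = r f" by (simp add: r_def)
  next
    assume "r e = r f"
    then show "R e f" using ef r sym trans by metis
  qed
  define \<eta> where "\<eta> e = \<zeta> e / \<zeta> (r e)" for e
  have \<eta>U: "\<eta> e \<in> U" if "e \<in> E" for e
    using that r[OF that] pow[of e "r e"] \<zeta>[of "r e"] by (simp add: U_def \<eta>_def power_divide)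
  have \<eta>0: "\<eta> e \<noteq> 0" if "e \<in> E" for e using that r \<zeta> by (simp add: \<eta>_def)
  have ratio: "\<zeta> e / \<zeta> f = \<eta> e / \<eta> f" if "e \<in> E" "f \<in> E" "R e f" for e f
    using that r_iff[of e f] \<zeta> r[of e] by (simp add: \<eta>_def)
  \<comment> \<open>The substitution of \<open>\<xi> * \<eta> f\<close> for \<open>\<xi>\<close>
    permutes the roots of unity and makes the expression symmetric in \<open>e\<close> and
    \<open>f\<close>, as a square requires.\<close>
  have shift: "(\<Sum>\<xi>\<in>U. \<phi> \<xi> * \<phi> (\<xi> * (\<zeta> e / \<zeta> f))) = (\<Sum>\<xi>\<in>U. \<phi> (\<xi> * \<eta> e) * \<phi> (\<xi> * \<eta> f))"
    if ef: "e \<in> E" "f \<in> E" "R e f" for e f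
  proof -
    have "(\<Sum>\<xi>\<in>U. \<phi> \<xi> * \<phi> (\<xi> * (\<zeta> e / \<zeta> f))) =
      (\<Sum>\<xi>\<in>U. \<phi> (\<xi> * \<eta> f) * \<phi> (\<xi> * \<eta> f * (\<zeta> e / \<zeta> f)))"
      using \<eta>U[OF ef(2)] \<eta>0[OF ef(2)]
      by (intro sum.reindex_bij_witness[of _ "\<lambda>\<xi>. \<xi> * \<eta> f" "\<lambda>\<xi>. \<xi> / \<eta> f"])
        (auto simp: U_def power_mult_distrib power_divide)
    then show ?thesis
      using \<eta>0[OF ef(2)] by (simp add: ratio[OF ef] mult.commute)
  qed
  define x where "x \<xi> e = \<phi> (\<xi> * \<eta> e)" for \<xi> e
  have "0 = (\<Sum>\<xi>\<in>U. \<phi> \<xi> * \<phi> (\<xi> * (\<Sum>e\<in>E. \<Sum>f\<in>E. if R e f then \<zeta> e / \<zeta> f else 0)))"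
    by (simp add: D0 \<phi>0)
  also have "\<dots> = (\<Sum>\<xi>\<in>U. \<Sum>e\<in>E. \<Sum>f\<in>E. if R e f then \<phi> \<xi> * \<phi> (\<xi> * (\<zeta> e / \<zeta> f)) else 0)"
    by (simp add: sum_distrib_left \<phi>_sum if_distrib \<phi>0 cong: if_cong)
  also have "\<dots> = (\<Sum>e\<in>E. \<Sum>f\<in>E. \<Sum>\<xi>\<in>U. if R e f then \<phi> \<xi> * \<phi> (\<xi> * (\<zeta> e / \<zeta> f)) else 0)"
    by (subst sum.swap, rule sum.cong[OF HOL.refl], rule sum.swap)
  also have "\<dots> = (\<Sum>e\<in>E. \<Sum>f\<in>E. \<Sum>\<xi>\<in>U. if R e f then x \<xi> e * x \<xi> f else 0)"
  proof (rule sum.cong[OF HOL.refl], rule sum.cong[OF HOL.refl])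
    fix e f assume "e \<in> E" "f \<in> E"
    then show "(\<Sum>\<xi>\<in>U. if R e f then \<phi> \<xi> * \<phi> (\<xi> * (\<zeta> e / \<zeta> f)) else 0) =
      (\<Sum>\<xi>\<in>U. if R e f then x \<xi> e * x \<xi> f else 0)"
      using shift[of e f] by (cases "R e f") (simp_all add: x_def)
  qed
  also have "\<dots> = (\<Sum>\<xi>\<in>U. \<Sum>e\<in>E. \<Sum>f\<in>E. if R e f then x \<xi> e * x \<xi> f else 0)"
    by (subst (2) sum.swap, rule sum.cong[OF HOL.refl], rule sum.swap)
  also have "\<dots> = (\<Sum>\<xi>\<in>U. \<Sum>i\<in>r ` E. (\<Sum>e\<in>E. if r e = i then x \<xi> e else 0)\<^sup>2)"
  proof (rule sum.cong[OF HOL.refl])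
    fix \<xi>
    have "(\<Sum>i\<in>r ` E. (\<Sum>e\<in>E. if r e = i then x \<xi> e else 0)\<^sup>2) =
      (\<Sum>i\<in>r ` E. \<Sum>e\<in>E. \<Sum>f\<in>E. if r e = i \<and> r f = i then x \<xi> e * x \<xi> f else 0)"
      unfolding power2_eq_square sum_product by (intro sum.cong[OF HOL.refl]) simp
    also have "\<dots> = (\<Sum>e\<in>E. \<Sum>f\<in>E. \<Sum>i\<in>r ` E. if r e = i \<and> r f = i then x \<xi> e * x \<xi> f else 0)"
      by (subst sum.swap, rule sum.cong[OF HOL.refl], rule sum.swap)
    also have "\<dots> = (\<Sum>e\<in>E. \<Sum>f\<in>E. if R e f then x \<xi> e * x \<xi> f else 0)"
    proof (intro sum.cong[OF HOL.refl])
      fix e f assume ef: "e \<in> E" "f \<in> E"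
      show "(\<Sum>i\<in>r ` E. if r e = i \<and> r f = i then x \<xi> e * x \<xi> f else 0) =
        (if R e f then x \<xi> e * x \<xi> f else 0)"
      proof (cases "r e = r f")
        case True
        then have "(\<Sum>i\<in>r ` E. if r e = i \<and> r f = i then x \<xi> e * x \<xi> f else 0) =
          (\<Sum>i\<in>r ` E. if r e = i then x \<xi> e * x \<xi> f else 0)"
          by (intro sum.cong[OF HOL.refl]) simp
        with True ef fin show ?thesis by (simp add: r_iff)
      next
        case False
        then have "(\<Sum>i\<in>r ` E. if r e = i \<and> r f = i then x \<xi> e * x \<xi> f else 0) = 0"
          by (intro sum.neutral) auto
        with False ef show ?thesis by (simp add: r_iff)
      qed
    qed
    finally show "(\<Sum>e\<in>E. \<Sum>f\<in>E. if R e f then x \<xi> e * x \<xi> f else 0) =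
      (\<Sum>i\<in>r ` E. (\<Sum>e\<in>E. if r e = i then x \<xi> e else 0)\<^sup>2)" by simp
  qed
  finally have zero: "(\<Sum>\<xi>\<in>U. \<Sum>i\<in>r ` E. (\<Sum>e\<in>E. if r e = i then x \<xi> e else 0)\<^sup>2) = 0" by simp
  \<comment> \<open>All squares vanish; but the rotation \<open>\<xi> = 1\<close> and the
    one-element class of \<open>e0\<close> contribute the square of
    \<open>\<phi> 1 = 1\<close>.\<close>
  have "(1::'k) \<in> U" by (simp add: U_def)
  with zero have "(\<Sum>i\<in>r ` E. (\<Sum>e\<in>E. if r e = i then x 1 e else 0)\<^sup>2) = 0"
    by (subst (asm) sum_nonneg_eq_0_iff) (auto simp: finU sum_nonneg)
  then have "(\<Sum>e\<in>E. if r e = r e0 then x 1 e else 0)\<^sup>2 = 0"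
    using e0(1) fin by (subst (asm) sum_nonneg_eq_0_iff) auto
  moreover have "(\<Sum>e\<in>E. if r e = r e0 then x 1 e else 0) = (\<Sum>e\<in>E. if e = e0 then x 1 e else 0)"
    using e0 sym r_iff by (intro sum.cong[OF HOL.refl]) metis
  moreover have "r e0 = e0" using e0 r by blast
  ultimately show False using fin e0(1) \<zeta>[OF e0(1)] \<phi>(2) by (simp add: x_def \<eta>_def)
qed

context semisimple_hopf begin

section \<open>The distinguished grouplike element and the antipode have finite order\<close>

lemma dg_power_inverse: "S dg ^ n * dg ^ n = 1"
proof (induction n)
  case (Suc n)
  have "S dg ^ Suc n * dg ^ Suc n = S dg ^ n * (S dg * dg) * dg ^ n"
    unfolding power_Suc2[of "S dg" n] power_Suc[of dg n] by (simp only: mult.assoc)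
  with Suc show ?case by (simp add: antipode_dg)
qed simp

lemma sw_dg_power:
  assumes f1: "\<And>y. hlin (*) (\<lambda>x. f x y)" and f2: "\<And>x. hlin (*) (\<lambda>y. f x y)"
  shows "sw f (dg ^ n) = f (dg ^ n) (dg ^ n)"
  using assms
proof (induction n arbitrary: f)
  case 0
  then show ?case by (simp add: sw_1[OF vector_space_mult])
next
  case (Suc n)
  note li = lin_intros lin_comp[OF Suc.prems(1)] lin_comp[OF Suc.prems(2)]
  have "sw f (dg * dg ^ n) = sw (\<lambda>a b. sw (\<lambda>c d. f (a * c) (b * d)) (dg ^ n)) dg"
    by (rule sw_mult[OF vector_space_mult Suc.prems])
  also have "\<dots> = sw (\<lambda>a b. f (a * dg ^ n) (b * dg ^ n)) dg"
  proof -
    have "sw (\<lambda>c d. f (a * c) (b * d)) (dg ^ n) = f (a * dg ^ n) (b * dg ^ n)" for a b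
      by (rule Suc.IH) (intro li)+
    then show ?thesis by simp
  qed
  also have "\<dots> = f (dg * dg ^ n) (dg * dg ^ n)"
    by (rule sw_dg[OF vector_space_mult]; intro li)
  finally show ?case by simp
qed

text \<open>Independence of grouplike elements: expand a power \<open>x\<close> of \<open>dg\<close>
  in a basis \<open>B\<close> chosen among the powers. The grouplike property of \<open>x\<close>
  forces its coefficients to be orthogonal idempotents of the field, so exactly one is 1 and
  \<open>x\<close> is in \<open>B\<close>. Hence there are finitely many powers.\<close>

lemma dg_finite_order: "\<exists>m>0. dg ^ m = 1"
proof -
  let ?G = "range (\<lambda>n. dg ^ n)"
  obtain B where B: "B \<subseteq> ?G" "H.independent B" "?G \<subseteq> H.span B"
    using H.maximal_independent_subset by blast
  have finB: "finite B"
    using H.independent_span_bound[OF H.finite_vbasis B(2)] H.carr_span by auto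
  let ?B = "H.extend_basis B"
  have B': "H.independent ?B" "H.span ?B = UNIV" "B \<subseteq> ?B"
    using H.independent_extend_basis[OF B(2)] H.span_extend_basis[OF B(2)]
      H.extend_basis_superset[OF B(2)] by auto
  define r where "r b x = H.representation ?B x b" for b x
  have r: "hlin (*) (r b)" for b
    by (simp add: lin_def r_def H.representation_add[OF B'(1)] H.representation_scale[OF B'(1)] B'(2))
  have r_basis: "r b c = (if b = c then 1 else 0)" if "c \<in> B" for b c
    using that B'(3) by (auto simp: r_def H.representation_basis[OF B'(1)])
  have "?G \<subseteq> B"
  proof
    fix x assume x: "x \<in> ?G"
    then obtain n where n: "x = dg ^ n" by blast
    have ex: "(\<Sum>d\<in>B. r d x \<odot> d) = x"
      unfolding r_def using x B B' finB
      by (subst H.representation_extend[OF B'(1) _ B'(3)])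
        (auto intro!: H.sum_representation_eq)
    have rr: "r b x * r c x = (if b = c then r b x else 0)" if bc: "b \<in> B" "c \<in> B" for b c
    proof -
      let ?f = "\<lambda>p q. r b p * r c q"
      have f: "hlin (*) (\<lambda>x. ?f x y)" "hlin (*) (\<lambda>y. ?f x y)" for x y
        by (intro lin_intros r)+
      have "sw ?f (dg ^ n) = r b (dg ^ n) * r c (dg ^ n)" by (rule sw_dg_power[OF f])
      then have "r b x * r c x = sw ?f x" by (simp only: n)
      also have "\<dots> = sw ?f (\<Sum>d\<in>B. r d x \<odot> d)" by (simp only: ex)
      also have "\<dots> = (\<Sum>d\<in>B. r d x * sw ?f d)"
        using lin_sw_arg[OF vector_space_mult f] by (simp add: lin_sum lin_scale)
      also have "\<dots> = (\<Sum>d\<in>B. r d x * (r b d * r c d))"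
      proof (rule sum.cong[OF refl])
        fix d assume "d \<in> B"
        then obtain m where "d = dg ^ m" using B(1) by blast
        then show "r d x * sw ?f d = r d x * (r b d * r c d)"
          using sw_dg_power[OF f] by simp
      qed
      also have "\<dots> = (\<Sum>d\<in>B. if d = b then (if b = c then r b x else 0) else 0)"
        by (intro sum.cong[OF refl]) (auto simp: r_basis)
      finally show ?thesis using bc finB by simp
    qed
    have "\<epsilon> x = 1"
      unfolding n by (induction n) (simp_all add: counit_1 counit_mult counit_dg)
    then have "x \<noteq> 0" using lin_zero[OF lin_counit] by (metis zero_neq_one)
    have "\<exists>b\<in>B. r b x \<noteq> 0"
    proof (rule ccontr)
      assume "\<not> ?thesis"
      then have "(\<Sum>d\<in>B. r d x \<odot> d) = 0" by (intro sum.neutral) simp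
      with ex \<open>x \<noteq> 0\<close> show False by simp
    qed
    then obtain b where b: "b \<in> B" "r b x \<noteq> 0" by blast
    then have "r b x = 1" using rr[of b b] by simp
    moreover have "r c x = 0" if "c \<in> B" "c \<noteq> b" for c using rr[of b c] that b by simp
    ultimately have "(\<Sum>d\<in>B. r d x \<odot> d) = (\<Sum>d\<in>B. if d = b then b else 0)"
      by (intro sum.cong[OF refl]) auto
    then show "x \<in> B" using ex finB b by simp
  qed
  then have "finite ?G" using finB finite_subset by blast
  then have "\<not> inj (\<lambda>n::nat. dg ^ n)" using finite_imageD by blast
  then obtain i j :: nat where ij: "i < j" "dg ^ i = dg ^ j"
    unfolding inj_def by (metis linorder_neqE_nat)
  have "dg ^ j = dg ^ i * dg ^ (j - i)" using ij(1) by (simp flip: power_add)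
  then have "S dg ^ i * dg ^ i = S dg ^ i * dg ^ i * dg ^ (j - i)"
    using ij(2) by (simp add: mult.assoc)
  then have "dg ^ (j - i) = 1" by (simp add: dg_power_inverse)
  with ij(1) show ?thesis by (intro exI[of _ "j - i"]) simp
qed

text \<open>By \<open>radford\<close>, the \<open>2n\<close>-th iterate of \<open>S\<^sup>2\<close>
  is conjugation by the \<open>n\<close>-th power of \<open>dg\<close>.\<close>

lemma antipode_finite_order: "\<exists>N>0. \<forall>x. ((\<lambda>x. S (S x)) ^^ N) x = x"
proof -
  obtain m where m: "m > 0" "dg ^ m = 1" using dg_finite_order by blast
  have 1: "((\<lambda>x. S (S x)) ^^ (2 * n)) x = S dg ^ n * x * dg ^ n" for n x
  proof (induction n)
    case (Suc n)
    have "((\<lambda>x. S (S x)) ^^ (2 * Suc n)) x = S (S (S (S (((\<lambda>x. S (S x)) ^^ (2 * n)) x))))"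
      by simp
    also have "\<dots> = S dg * (S dg ^ n * x * dg ^ n) * dg" unfolding Suc radford ..
    finally show ?case by (simp only: mult.assoc power_Suc[of "S dg" n] power_Suc2[of dg n])
  qed simp
  have "S dg ^ m = 1" using dg_power_inverse[of m] m(2) by simp
  with m show ?thesis by (intro exI[of _ "2 * m"]) (simp add: 1)
qed

text \<open>The regular character is symmetric and non-degenerate, so \<open>lam = \<chi>(u _)\<close> for some \<open>u\<close>; the
  Nakayama automorphism of \<open>lam\<close> is then conjugation by \<open>u\<close>.\<close>

lemma antipode_sq_inner:
  "\<exists>u v. u * v = 1 \<and> v * u = 1 \<and> (\<forall>a. u * a = S (S a) * u)"
proof -
  let ?B = "vbasis H"
  \<comment> \<open>The functional \<open>\<chi> (x * _)\<close> is stored as a vector of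
    \<open>H\<close> through its values on the basis. Non-degeneracy of \<open>\<chi>\<close> is
    then injectivity of an endomorphism and gives surjectivity.\<close>
  define \<Psi> where "\<Psi> x = (\<Sum>b\<in>?B. \<chi> (x * b) \<odot> b)" for x
  have \<Psi>: "hlin (scal H) \<Psi>" unfolding \<Psi>_def by (intro lin_sums lin_intros)
  note coord = H.vcoord_lincomb
  have lin_ext: "\<phi> y = \<psi> y"
    if "hlin (*) \<phi>" "hlin (*) \<psi>" "\<And>b. b \<in> ?B \<Longrightarrow> \<phi> b = \<psi> b" for \<phi> \<psi> y
    using H.linear_eq_on_basis[of ground \<phi> \<psi> y] that by (simp add: linear_map_ground)
  have "x = 0" if "\<Psi> x = 0" for x
  proof (rule chi_nondegenerate)
    fix y
    have "\<chi> (x * b) = 0" if "b \<in> ?B" for b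
    proof -
      have "\<chi> (x * b) = vcoord H b (\<Psi> x)" unfolding \<Psi>_def by (rule coord[OF that, symmetric])
      then show ?thesis by (simp only: \<open>\<Psi> x = 0\<close> lin_zero[OF lin_vcoord])
    qed
    then show "\<chi> (x * y) = 0"
      by (rule lin_ext[of "\<lambda>y. \<chi> (x * y)" "\<lambda>y. 0", rotated 2]) (intro lin_intros | simp add: lin_def)+
  qed
  from lin_inj_surj[OF \<Psi> this] obtain u where u: "\<Psi> u = (\<Sum>b\<in>?B. lam b \<odot> b)" by blast
  have u_lam: "\<chi> (u * y) = lam y" for y
  proof (rule lin_ext)
    fix b assume "b \<in> ?B"
    then show "\<chi> (u * b) = lam b"
      using arg_cong[OF u, of "vcoord H b"] by (simp only: \<Psi>_def coord)
  qed (intro lin_intros)+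
  have "x = 0" if "u * x = 0" for x
  proof (rule lam_nondegenerate)
    fix b
    have "lam (x * b) = \<chi> (u * x * b)" by (simp only: u_lam mult.assoc)
    then show "lam (x * b) = 0" using that lin_zero[OF lin_chi] by simp
  qed
  then have inj: "u * x = u * y \<Longrightarrow> x = y" for x y
    by (metis right_diff_distrib right_minus_eq)
  obtain v where v: "u * v = 1"
    using lin_inj_surj[of "\<lambda>x. u * x" 1] \<open>\<And>x. u * x = 0 \<Longrightarrow> x = 0\<close> lin_intros by blast
  have "u * (v * u) = u * 1" by (simp add: v flip: mult.assoc)
  then have "v * u = 1" by (rule inj)
  moreover have "u * a = S (S a) * u" for a
  proof -
    have "\<chi> ((u * a - S (S a) * u) * b) = 0" for b
    proof -
      have "\<chi> (u * a * b) = lam (b * S (S a))" by (simp only: mult.assoc u_lam lam_comm[of a])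
      also have "\<dots> = \<chi> (u * b * S (S a))" by (simp only: mult.assoc u_lam)
      also have "\<dots> = \<chi> (S (S a) * (u * b))" by (rule chi_comm)
      also have "\<dots> = \<chi> (S (S a) * u * b)" by (simp only: mult.assoc)
      finally show ?thesis by (simp add: left_diff_distrib lin_diff[OF lin_chi])
    qed
    then have "u * a - S (S a) * u = 0" by (rule chi_nondegenerate)
    then show ?thesis by simp
  qed
  ultimately show ?thesis using v by blast
qed

subsection \<open>Idempotents commuting with an element\<close>

text \<open>Members have to be non-zero so that sizes are bounded and a largest family
  exists.\<close>

definition idem_family :: "'h \<Rightarrow> 'h set \<Rightarrow> bool" where
  "idem_family u E \<longleftrightarrow> finite E \<and> (\<forall>e\<in>E. e \<noteq> 0 \<and> e * e = e \<and> u * e = e * u) \<and>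
     (\<forall>e\<in>E. \<forall>f\<in>E. e \<noteq> f \<longrightarrow> e * f = 0) \<and> \<Sum>E = 1"

lemma one_neq_zero_H: "(1 :: 'h) \<noteq> 0"
  using counit_1 lin_zero[OF lin_counit] by (metis zero_neq_one)

lemma chi_idempotent:
  assumes "e * e = e"
  obtains n where "\<chi> e = of_nat n" "n = 0 \<Longrightarrow> e = 0"
proof -
  have "e * (e * x) = e * x" for x using assms by (metis mult.assoc)
  then obtain n where n: "htr (\<lambda>x. e * x) = of_nat n" "n = 0 \<Longrightarrow> \<forall>x. e * x = 0"
    using htr_idempotent[of "\<lambda>x. e * x"] lin_intros by blast
  from n(1) have "\<chi> e = of_nat n" by (simp only: \<chi>_def)
  moreover have "n = 0 \<Longrightarrow> e = 0" using n(2) by (metis mult.right_neutral)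
  ultimately show ?thesis by (rule that)
qed

text \<open>The regular character of a non-zero idempotent is a positive integer, and these integers
  add up to the dimension of \<open>H\<close>.\<close>

lemma idem_family_card: "idem_family u E \<Longrightarrow> card E \<le> card (vbasis H)"
proof -
  assume E: "idem_family u E"
  have "\<exists>n. \<chi> e = of_nat n \<and> 1 \<le> n" if "e \<in> E" for e
  proof -
    have "e * e = e" "e \<noteq> 0" using E that by (auto simp: idem_family_def)
    then show ?thesis by (metis chi_idempotent less_one linorder_not_less)
  qed
  then obtain d where d: "\<And>e. e \<in> E \<Longrightarrow> \<chi> e = of_nat (d e) \<and> 1 \<le> d e" by metis
  have "of_nat (card (vbasis H)) = \<chi> (\<Sum>E)"
    using E by (simp add: idem_family_def \<chi>_def H.trace_id)
  also have "\<dots> = of_nat (\<Sum>e\<in>E. d e)"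
    using d by (simp add: lin_sum[OF lin_chi, of "\<lambda>e. e"])
  finally have "card (vbasis H) = (\<Sum>e\<in>E. d e)" by (simp only: of_nat_eq_iff)
  moreover have "(\<Sum>e\<in>E. 1) \<le> (\<Sum>e\<in>E. d e)" using d by (intro sum_mono) auto
  ultimately show ?thesis by simp
qed

lemma idem_family_max:
  "\<exists>E. idem_family u E \<and> (\<forall>F. idem_family u F \<longrightarrow> card F \<le> card E)"
proof -
  have "idem_family u {1}" by (simp add: idem_family_def one_neq_zero_H)
  then show ?thesis
    by (rule ex_has_greatest_nat[where b = "Suc (card (vbasis H))"])
      (simp add: idem_family_card less_Suc_eq_le)
qed

text \<open>Otherwise replacing \<open>e\<close> by \<open>f\<close> and \<open>e - f\<close> would
  enlarge the family. This covers only idempotents that commute with \<open>u\<close>.\<close>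

lemma max_idem_family_primitive:
  assumes E: "idem_family u E" and max: "\<And>F. idem_family u F \<Longrightarrow> card F \<le> card E"
    and e: "e \<in> E" and f: "f * f = f" "u * f = f * u" "f * e = f" "e * f = f"
  shows "f = 0 \<or> f = e"
proof (rule ccontr)
  assume "\<not> ?thesis"
  then have f0: "f \<noteq> 0" "e - f \<noteq> 0" by auto
  let ?E = "E - {e}"
  have fin: "finite E" and id: "\<And>e. e \<in> E \<Longrightarrow> e \<noteq> 0 \<and> e * e = e \<and> u * e = e * u"
    and orth: "\<And>e f. e \<in> E \<Longrightarrow> f \<in> E \<Longrightarrow> e \<noteq> f \<Longrightarrow> e * f = 0" and sum: "\<Sum>E = 1"
    using E by (auto simp: idem_family_def)
  have orth': "d * f = 0 \<and> f * d = 0 \<and> d * (e - f) = 0 \<and> (e - f) * d = 0" if "d \<in> ?E" for d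
  proof -
    have de: "d * e = 0" "e * d = 0" using that e orth by auto
    have "d * f = d * e * f" "f * d = f * (e * d)" by (metis f(3,4) mult.assoc)+
    with de show ?thesis by (simp add: algebra_simps)
  qed
  have ff: "f * (e - f) = 0" "(e - f) * f = 0" "(e - f) * (e - f) = e - f" "u * (e - f) = (e - f) * u"
    using f id[OF e] by (simp_all add: algebra_simps)
  have notin: "f \<notin> ?E" "e - f \<notin> ?E" "f \<noteq> e - f"
    using orth'[of f] orth'[of "e - f"] f0 f(1) ff by auto
  have "idem_family u (insert f (insert (e - f) ?E))"
    unfolding idem_family_def
  proof (intro conjI)
    show "\<Sum>(insert f (insert (e - f) ?E)) = 1"
      using notin fin sum by (simp add: sum.remove[OF fin e])
    show "\<forall>g\<in>insert f (insert (e - f) ?E). g \<noteq> 0 \<and> g * g = g \<and> u * g = g * u"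
      unfolding ball_simps(7) using f0 f(1,2) ff(3,4) id by (intro conjI ballI) auto
    show "\<forall>g\<in>insert f (insert (e - f) ?E). \<forall>h\<in>insert f (insert (e - f) ?E). g \<noteq> h \<longrightarrow> g * h = 0"
      unfolding ball_simps(7) using orth orth' ff(1,2) by (intro conjI ballI impI) auto
  qed (simp add: fin)
  then have "card (insert f (insert (e - f) ?E)) \<le> card E" by (rule max)
  moreover have "card (insert f (insert (e - f) ?E)) = Suc (card E)"
    using notin fin card_Suc_Diff1[OF fin e] by (simp del: card_Diff_insert card_Diff_singleton)
  ultimately show False by simp
qed

text \<open>Left multiplication by an element commuting with \<open>e\<close> preserves the corner
  \<open>e H e\<close>.\<close>

lemma corner_eigenvector:
  assumes e: "e * e = e" "e \<noteq> 0" and y: "y * e = e * y"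
  obtains c x where "x \<noteq> 0" "e * x = x" "x * e = x" "y * x = c \<odot> x"
proof -
  let ?W = "{x. e * x = x \<and> x * e = x}"
  have sub: "H.subspace ?W"
    by (auto simp: H.subspace_def distrib_left distrib_right scale_mult_left scale_mult_right)
  interpret W: fd_space "\<lparr>carr = ?W, scal = scal H\<rparr>"
    by (rule H.fd_subspace[OF sub]) simp
  have "e * (y * x) = y * x \<and> y * x * e = y * x" if "e * x = x" "x * e = x" for x
    using that y by (metis mult.assoc)
  then have "linear_map \<lparr>carr = ?W, scal = scal H\<rparr> \<lparr>carr = ?W, scal = scal H\<rparr> (\<lambda>x. y * x)"
    by (auto simp: linear_map_def distrib_left scale_mult_right)
  moreover have "carr \<lparr>carr = ?W, scal = scal H\<rparr> \<noteq> {0}" using e by auto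
  ultimately have "\<exists>c x. x \<in> ?W \<and> x \<noteq> 0 \<and> y * x = c \<odot> x"
    using exists_eigenvector[OF W.fd_space_axioms, of "\<lambda>x. y * x"] by (simp only: vspace.simps) blast
  then show ?thesis using that by blast
qed

text \<open>Let \<open>f\<close> be the idempotent generator of \<open>H z\<close>. Centrality of
  \<open>z\<close> gives \<open>f h = f h f\<close>, and then \<open>h f - f h f\<close> generates a
  left ideal of square zero; so \<open>f\<close> is central.\<close>

lemma central_ideal_idempotent:
  fixes z :: 'h
  assumes z: "\<And>h. z * h = h * z"
  shows "\<exists>w. w * z * (w * z) = w * z \<and> z * (w * z) = z \<and> (\<forall>h. w * z * h = h * (w * z))"
proof -
  obtain w where w: "w * z * (w * z) = w * z" "z * (w * z) = z" "\<And>x. x * z * (w * z) = x * z"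
    using principal_left_ideal_idempotent[of z] by blast
  define f where "f = w * z"
  have fh: "f * h * f = f * h" for h
  proof -
    have "f * h = w * h * z" by (simp add: f_def mult.assoc z)
    then show ?thesis using w(3)[of "w * h"] by (simp add: f_def)
  qed
  have "h * f - f * h * f = 0" for h
  proof (rule square_zero_left_ideal)
    fix b
    define d where "d = h * f - f * h * f"
    have "d * f = d" using w(1) by (simp add: d_def left_diff_distrib mult.assoc flip: f_def)
    moreover have "f * b * d = 0"
    proof -
      have "f * b * d = f * b * h * f - f * b * f * h * f"
        unfolding d_def right_diff_distrib by (simp only: mult.assoc)
      then show ?thesis by (simp only: fh diff_self)
    qed
    ultimately show "d * b * d = 0" by (metis mult.assoc mult_zero_right)
  qed
  then have fh': "f * h = h * f" for h using fh[of h] by (metis eq_iff_diff_eq_0)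
  have "w * z * h = h * (w * z)" for h using fh'[of h] by (simp only: f_def)
  with w(1,2) show ?thesis by blast
qed

end

section \<open>Primitive idempotents commuting with \<open>u\<close>, and the eigenvalues of
  \<open>u\<close> on them\<close>

locale antipode_decomposition = semisimple_hopf H
  for H :: "('k::{alg_closed_field,field_char_0}, 'h::ring_1) hopf" +
  fixes u v :: 'h and N :: nat and E :: "'h set"
  assumes uv: "u * v = 1" and vu: "v * u = 1" and u_antipode: "\<And>a. u * a = S (S a) * u"
    and N: "N > 0" and central: "\<And>h. u ^ N * h = h * u ^ N"
    and E: "idem_family u E" and E_max: "\<And>F. idem_family u F \<Longrightarrow> card F \<le> card E"
begin

lemma fin_E: "finite E" and E_sum: "\<Sum>E = 1"
  and E_nz: "e \<in> E \<Longrightarrow> e \<noteq> 0" and E_idem: "e \<in> E \<Longrightarrow> e * e = e"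
  and E_comm: "e \<in> E \<Longrightarrow> u * e = e * u"
  using E by (auto simp: idem_family_def)

lemma E_primitive:
  "e \<in> E \<Longrightarrow> f * f = f \<Longrightarrow> u * f = f * u \<Longrightarrow> f * e = f \<Longrightarrow> e * f = f \<Longrightarrow> f = 0 \<or> f = e"
  by (rule max_idem_family_primitive[OF E E_max])

text \<open>For an eigenvalue \<open>c\<close>, the central element
  \<open>z = u ^ N - c \<odot> 1\<close> generates an ideal with a central idempotent
  \<open>f\<close>. Primitivity leaves \<open>f e = 0\<close> or \<open>f e = e\<close>; the second
  is excluded by the eigenvector, which \<open>z\<close> kills.\<close>

lemma central_scalar:
  assumes e: "e \<in> E"
  shows "\<exists>c. u ^ N * e = c \<odot> e"
proof -
  obtain c x where x: "x \<noteq> 0" "e * x = x" "u ^ N * x = c \<odot> x"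
    using corner_eigenvector[OF E_idem[OF e] E_nz[OF e] central[of e]] by metis
  define z where "z = u ^ N - c \<odot> 1"
  have zx: "z * x = 0" unfolding z_def left_diff_distrib x(3) scale_mult_left by simp
  have zc: "z * h = h * z" for h
    unfolding z_def left_diff_distrib right_diff_distrib central[of h] scale_mult_left scale_mult_right
    by simp
  obtain w where w: "w * z * (w * z) = w * z \<and> z * (w * z) = z \<and> (\<forall>h. w * z * h = h * (w * z))"
    by (rule exE[OF central_ideal_idempotent[OF zc]])
  define f where "f = w * z"
  have f: "f * f = f" "z * f = z" and fc: "\<And>h. f * h = h * f"
    unfolding f_def using w by blast+
  have "f * e = 0 \<or> f * e = e"
  proof (rule E_primitive[OF e])
    show "f * e * (f * e) = f * e" by (metis f(1) fc E_idem[OF e] mult.assoc)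
    show "u * (f * e) = f * e * u" by (metis fc E_comm[OF e] mult.assoc)
    show "f * e * e = f * e" by (simp add: mult.assoc E_idem[OF e])
    show "e * (f * e) = f * e" by (metis fc E_idem[OF e] mult.assoc)
  qed
  moreover have "f * e \<noteq> e"
  proof
    assume "f * e = e"
    then have "x = f * x" by (metis x(2) mult.assoc)
    then have "x = w * (z * x)" by (simp only: f_def mult.assoc)
    with zx x(1) show False by simp
  qed
  ultimately have "f * e = 0" by blast
  then have "z * e = 0" by (metis f(2) mult.assoc mult_zero_right)
  then show ?thesis by (auto simp: z_def left_diff_distrib scale_mult_left)
qed

lemma power_eigen: "u * x = c \<odot> x \<Longrightarrow> u ^ n * x = c ^ n \<odot> x"
  by (induction n) (simp_all add: mult.assoc scale_mult_right mult.commute)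

text \<open>On \<open>e\<close> the power \<open>u ^ N\<close> is the scalar \<open>c ^ N\<close>,
  so averaging \<open>inverse c ^ k\<close> times \<open>u ^ k\<close> over a period projects to the
  \<open>c\<close>-eigenspace. The result \<open>p\<close> is a non-zero idempotent below
  \<open>e\<close> that commutes with \<open>u\<close>, hence equals \<open>e\<close>.\<close>

lemma E_eigen:
  assumes e: "e \<in> E"
  shows "\<exists>c. c \<noteq> 0 \<and> u * e = c \<odot> e"
proof -
  obtain c x where x: "x \<noteq> 0" "e * x = x" "u * x = c \<odot> x"
    using corner_eigenvector[OF E_idem[OF e] E_nz[OF e] E_comm[OF e]] by metis
  have c0: "c \<noteq> 0"
  proof
    assume "c = 0"
    then have "v * (u * x) = 0" using x by simp
    then have "v * u * x = 0" by (simp only: mult.assoc)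
    then show False using x vu by simp
  qed
  obtain d where d: "u ^ N * e = d \<odot> e" using central_scalar[OF e] by blast
  have "d \<odot> x = u ^ N * e * x" by (simp only: d scale_mult_left x(2))
  also have "\<dots> = u ^ N * x" by (simp only: mult.assoc x(2))
  also have "\<dots> = c ^ N \<odot> x" by (rule power_eigen[OF x(3)])
  finally have dc: "d = c ^ N" using x(1) by simp
  define g where "g k = (inverse c ^ k / of_nat N) \<odot> (u ^ k * e)" for k
  define p where "p = (\<Sum>k<N. g k)"
  have up: "u * p = c \<odot> p"
  proof -
    have g_Suc: "u * g k = c \<odot> g (Suc k)" for k
      using c0 by (simp add: g_def scale_mult_right mult.assoc)
    \<comment> \<open>Periodicity, from \<open>d = c ^ N\<close>: multiplication by \<open>u\<close>
      only shifts the sum cyclically, up to the factor \<open>c\<close>.\<close>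
    have "g N = g 0" using c0 N by (simp add: g_def d dc power_inverse)
    then have "(\<Sum>k<N. g (Suc k)) = (\<Sum>k<N. g k)"
      using sum.lessThan_Suc_shift[of g N] sum.lessThan_Suc[of g N] by simp
    then show ?thesis
      by (simp add: p_def sum_distrib_left g_Suc flip: H.scale_sum_right)
  qed
  have fix_eigen: "p * y = y" if "e * y = y" "u * y = c \<odot> y" for y
  proof -
    have "g k * y = (1 / of_nat N) \<odot> y" for k
      using c0 by (simp add: g_def scale_mult_left mult.assoc that(1) power_eigen[OF that(2)] power_inverse)
    then have "p * y = (\<Sum>k<N. (1 / of_nat N) \<odot> y)" by (simp add: p_def sum_distrib_right)
    also have "\<dots> = (\<Sum>k<N. 1 / of_nat N) \<odot> y" by (rule H.scale_sum_left[symmetric])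
    also have "(\<Sum>k<N. 1 / of_nat N) = (1 :: 'k)" using N by simp
    also have "1 \<odot> y = y" by simp
    finally show ?thesis .
  qed
  have ue: "u ^ k * e = e * u ^ k" for k
    by (induction k) (simp_all add: mult.assoc, metis E_comm[OF e] mult.assoc)
  have eg: "e * g k = g k" "g k * e = g k" for k
  proof -
    show "g k * e = g k" by (simp add: g_def scale_mult_left mult.assoc E_idem[OF e])
    have "e * (u ^ k * e) = u ^ k * e" by (metis ue E_idem[OF e] mult.assoc)
    then show "e * g k = g k" by (simp add: g_def scale_mult_right)
  qed
  have ep: "e * p = p" "p * e = p" by (simp_all add: p_def sum_distrib_left sum_distrib_right eg)
  have ug: "u * g k = g k * u" for k
  proof -
    have "u * (u ^ k * e) = u ^ k * e * u"
      by (metis E_comm[OF e] mult.assoc power_commutes)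
    then show ?thesis by (simp add: g_def scale_mult_left scale_mult_right)
  qed
  have "p = 0 \<or> p = e"
  proof (rule E_primitive[OF e])
    show "p * p = p" by (rule fix_eigen) (rule ep up)+
    show "u * p = p * u" by (simp add: p_def sum_distrib_left sum_distrib_right ug)
  qed (rule ep)+
  moreover have "p * x = x" by (rule fix_eigen) (rule x)+
  ultimately have "p = e" using x(1) by auto
  with up c0 show ?thesis by blast
qed

definition \<zeta> :: "'h \<Rightarrow> 'k" where "\<zeta> e = (SOME c. c \<noteq> 0 \<and> u * e = c \<odot> e)"

lemma zeta: "e \<in> E \<Longrightarrow> \<zeta> e \<noteq> 0" "e \<in> E \<Longrightarrow> u * e = \<zeta> e \<odot> e"
  using someI_ex[OF E_eigen] unfolding \<zeta>_def by blast+

text \<open>Since \<open>u\<close> acts on \<open>e\<close> by one scalar from both sides, all of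
  \<open>e H e\<close> commutes with \<open>u\<close>, so \<open>E_primitive\<close> applies to any
  idempotent there. A non-zero singular element \<open>y - c \<odot> e\<close> would produce one
  other than 0 and \<open>e\<close>.\<close>

lemma corner_scalar:
  assumes e: "e \<in> E" and y: "e * y = y" "y * e = y"
  shows "\<exists>c. y = c \<odot> e"
proof -
  obtain c x where x: "x \<noteq> 0" "e * x = x" "y * x = c \<odot> x"
    using corner_eigenvector[OF E_idem[OF e] E_nz[OF e], of y] y by metis
  define t where "t = y - c \<odot> e"
  have tx: "t * x = 0" using x by (simp add: t_def left_diff_distrib scale_mult_left)
  have te: "t * e = t" using y E_idem[OF e] by (simp add: t_def left_diff_distrib scale_mult_left)
  obtain w where w: "w * t * (w * t) = w * t" "t * (w * t) = t"
    using principal_left_ideal_idempotent by blast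
  define f where "f = e * (w * t)"
  have ef: "e * f = f" by (simp only: f_def mult.assoc[symmetric] E_idem[OF e])
  have fe: "f * e = f" by (simp only: f_def mult.assoc te)
  have "f = 0 \<or> f = e"
  proof (rule E_primitive[OF e _ _ fe ef])
    have "f * f = e * (w * (t * e) * (w * t))" by (simp only: f_def mult.assoc)
    then show "f * f = f" by (simp only: te w(1) f_def)
    have "u * f = \<zeta> e \<odot> f"
      unfolding f_def mult.assoc[symmetric] zeta(2)[OF e] by (simp add: scale_mult_left)
    moreover have "f * u = \<zeta> e \<odot> f"
    proof -
      have "f * u = f * (e * u)" by (simp only: fe mult.assoc[symmetric])
      also have "\<dots> = f * (\<zeta> e \<odot> e)" by (simp only: E_comm[OF e, symmetric] zeta(2)[OF e])
      finally show ?thesis by (simp add: scale_mult_right fe)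
    qed
    ultimately show "u * f = f * u" by simp
  qed
  moreover have "f \<noteq> e"
  proof
    assume "f = e"
    then have "x = f * x" using x(2) by simp
    then have "x = e * (w * (t * x))" by (simp only: f_def mult.assoc)
    with tx x(1) show False by simp
  qed
  ultimately have "f = 0" by blast
  have "t = t * e * (w * t)" by (simp only: te w(2))
  also have "\<dots> = t * f" by (simp only: f_def mult.assoc)
  finally have "t = 0" using \<open>f = 0\<close> by simp
  then show ?thesis by (auto simp: t_def)
qed

text \<open>For primitive idempotents, \<open>e\<close> and \<open>f\<close> are linked iff \<open>H e\<close> and \<open>H f\<close> are isomorphic.\<close>

definition linked :: "'h \<Rightarrow> 'h \<Rightarrow> bool" where "linked e f \<longleftrightarrow> (\<exists>x. e * x * f \<noteq> 0)"

text \<open>Schur's lemma for \<open>H e\<close> and \<open>H f\<close>: \<open>a\<close> and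
  \<open>b\<close> provide mutually inverse maps. Non-degeneracy of \<open>\<chi>\<close> supplies
  \<open>y\<close> with \<open>a y e\<close> non-zero, hence an invertible multiple of
  \<open>e\<close>, and \<open>b\<close> is a rescaled \<open>f y e\<close>.\<close>

lemma linkedE:
  assumes ef: "e \<in> E" "f \<in> E" and "linked e f"
  obtains a b where "e * a = a" "a * f = a" "f * b = b" "b * e = b" "a * b = e" "b * a = f"
proof -
  obtain x where x: "e * x * f \<noteq> 0" using assms(3) by (auto simp: linked_def)
  define a where "a = e * x * f"
  have a: "e * a = a" "a * f = a"
    by (simp_all only: a_def mult.assoc E_idem[OF ef(2)]) (simp only: E_idem[OF ef(1)] mult.assoc[symmetric])
  obtain y where "\<chi> (a * y) \<noteq> 0" using chi_nondegenerate x a_def by blast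
  moreover have "\<chi> (a * y) = \<chi> (a * y * e)"
    using a(1) chi_comm[of e "a * y"] by (simp only: mult.assoc[symmetric])
  ultimately have nz: "a * y * e \<noteq> 0" using lin_zero[OF lin_chi] by auto
  have "e * (a * y * e) = a * y * e" "a * y * e * e = a * y * e"
    by (simp_all only: mult.assoc E_idem[OF ef(1)]) (simp only: a mult.assoc[symmetric])
  then obtain c where c: "a * y * e = c \<odot> e" using corner_scalar[OF ef(1)] by blast
  with nz have c0: "c \<noteq> 0" by auto
  define b where "b = inverse c \<odot> (f * y * e)"
  have b: "f * b = b" "b * e = b"
    by (simp_all add: b_def scale_mult_left scale_mult_right mult.assoc E_idem[OF ef(1)])
      (simp add: E_idem[OF ef(2)] flip: mult.assoc)
  have ab: "a * b = e"
  proof -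
    have "a * b = inverse c \<odot> (a * f * y * e)" by (simp add: b_def scale_mult_right mult.assoc)
    with c c0 a show ?thesis by simp
  qed
  have "f * (b * a) = b * a" "b * a * f = b * a" by (metis a b mult.assoc)+
  then obtain d where d: "b * a = d \<odot> f" using corner_scalar[OF ef(2)] by blast
  have "a = a * b * a" by (simp only: ab a)
  also have "\<dots> = d \<odot> a" by (simp add: mult.assoc d scale_mult_right a)
  finally have "1 \<odot> a = d \<odot> a" by simp
  moreover have "a \<noteq> 0" using x a_def by simp
  ultimately have "d = 1" by (metis H.scale_cancel_right)
  with d have "b * a = f" by simp
  with a b ab show ?thesis by (intro that)
qed

lemma linked_equiv:
  shows linked_refl: "e \<in> E \<Longrightarrow> linked e e"
    and linked_sym: "e \<in> E \<Longrightarrow> f \<in> E \<Longrightarrow> linked e f \<Longrightarrow> linked f e"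
    and linked_trans: "e \<in> E \<Longrightarrow> f \<in> E \<Longrightarrow> g \<in> E \<Longrightarrow> linked e f \<Longrightarrow> linked f g \<Longrightarrow> linked e g"
proof -
  show "linked e e" if "e \<in> E"
    unfolding linked_def by (rule exI[of _ e]) (simp add: that E_idem E_nz)
  show "linked f e" if ef: "e \<in> E" "f \<in> E" "linked e f"
  proof -
    obtain a b where ab: "f * b = b" "b * e = b" "a * b = e"
      using linkedE[OF ef] by metis
    have "b \<noteq> 0" using ab(3) E_nz[OF ef(1)] by auto
    then show ?thesis unfolding linked_def by (intro exI[of _ b]) (simp add: ab)
  qed
  show "linked e g" if efg: "e \<in> E" "f \<in> E" "g \<in> E" "linked e f" "linked f g"
  proof -
    obtain a b where ab: "e * a = a" "b * a = f" using linkedE[OF efg(1,2,4)] by metis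
    obtain c d where cd: "f * c = c" "c * g = c" "c * d = f" using linkedE[OF efg(2,3,5)] by metis
    have "b * (a * c) = c" by (simp add: ab cd flip: mult.assoc)
    moreover have "c \<noteq> 0" using cd(3) E_nz[OF efg(2)] by auto
    ultimately have "a * c \<noteq> 0" by auto
    moreover have "e * (a * c) * g = a * c" by (simp only: ab cd mult.assoc) (simp only: ab mult.assoc[symmetric])
    ultimately show ?thesis unfolding linked_def by metis
  qed
qed

lemma v_eigen: "e \<in> E \<Longrightarrow> e * v = inverse (\<zeta> e) \<odot> e"
proof -
  assume e: "e \<in> E"
  have "e = e * (u * v)" by (simp add: uv)
  also have "\<dots> = \<zeta> e \<odot> (e * v)"
    by (simp add: E_comm[OF e, symmetric] zeta[OF e] scale_mult_left flip: mult.assoc)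
  finally have "inverse (\<zeta> e) \<odot> e = inverse (\<zeta> e) \<odot> (\<zeta> e \<odot> (e * v))" by simp
  then show ?thesis using zeta[OF e] by simp
qed

lemma zeta_power: "e \<in> E \<Longrightarrow> f \<in> E \<Longrightarrow> linked e f \<Longrightarrow> \<zeta> e ^ N = \<zeta> f ^ N"
proof -
  assume ef: "e \<in> E" "f \<in> E" "linked e f"
  then obtain x where x: "e * x * f \<noteq> 0" by (auto simp: linked_def)
  have "\<zeta> e ^ N \<odot> (e * x * f) = u ^ N * (e * x * f)"
    using power_eigen[OF zeta(2)[OF ef(1)]] by (simp add: scale_mult_left flip: mult.assoc)
  also have "\<dots> = e * x * f * u ^ N" by (rule central)
  also have "\<dots> = e * x * (f * u ^ N)" by (rule mult.assoc)
  also have "\<dots> = e * x * (u ^ N * f)" by (simp only: central[of f])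
  also have "\<dots> = \<zeta> f ^ N \<odot> (e * x * f)"
    using power_eigen[OF zeta(2)[OF ef(2)]] by (simp add: scale_mult_right)
  finally show ?thesis using x by simp
qed

text \<open>The trace is the dimension of \<open>e H f\<close>. In the linked case this is the line
  through \<open>a\<close>, and \<open>p\<close> reads off the coefficient by multiplying with
  \<open>b\<close> and taking \<open>\<chi>\<close>.\<close>

lemma trace_corner:
  assumes ef: "e \<in> E" "f \<in> E"
  shows "htr (\<lambda>x. e * x * f) = (if linked e f then 1 else 0)"
proof (cases "linked e f")
  case True
  obtain a b where ab: "e * a = a" "a * f = a" "f * b = b" "b * e = b" "a * b = e" "b * a = f"
    using linkedE[OF ef True] by metis
  have chi_e: "\<chi> e \<noteq> 0"
    using chi_idempotent[OF E_idem[OF ef(1)]] E_nz[OF ef(1)] by (metis of_nat_eq_0_iff)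
  define p where "p x = \<chi> (e * x * b) / \<chi> e" for x
  have p: "hlin (*) p"
    unfolding p_def divide_inverse by (intro lin_intros)
  have "e * x * f = p x \<odot> a" for x
  proof -
    have "e * (e * x * b) = e * x * b" "e * x * b * e = e * x * b"
      by (simp_all only: mult.assoc ab) (simp only: E_idem[OF ef(1)] mult.assoc[symmetric])
    then obtain c where c: "e * x * b = c \<odot> e" using corner_scalar[OF ef(1)] by blast
    then have "p x = c" using chi_e by (simp add: p_def lin_scale[OF lin_chi])
    have "e * x * f = e * x * b * a" by (simp only: ab mult.assoc)
    also have "\<dots> = c \<odot> a" by (simp add: c scale_mult_left ab)
    finally show ?thesis using \<open>p x = c\<close> by simp
  qed
  then have "htr (\<lambda>x. e * x * f) = p a" by (simp add: htr_rank_one[OF p])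
  also have "p a = 1" using chi_e by (simp add: p_def ab)
  finally show ?thesis using True by simp
next
  case False
  then have "htr (\<lambda>x. e * x * f) = htr (\<lambda>x. 0 \<odot> x)" by (simp add: linked_def)
  also have "\<dots> = 0 * htr (\<lambda>x. x)" by (rule H.trace_scale) simp
  finally show ?thesis using False by simp
qed

text \<open>\<open>S\<^sup>2\<close> is conjugation by \<open>u\<close>, which scales each block
  \<open>e H f\<close> of \<open>H\<close> by \<open>\<zeta> e / \<zeta> f\<close>.\<close>

lemma trace_antipode_sq:
  "htr (\<lambda>x. S (S x)) = (\<Sum>e\<in>E. \<Sum>f\<in>E. if linked e f then \<zeta> e / \<zeta> f else 0)"
proof -
  have "S (S x) = (\<Sum>e\<in>E. \<Sum>f\<in>E. (\<zeta> e / \<zeta> f) \<odot> (e * x * f))" for x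
  proof -
    have "u * x * v = S (S x) * (u * v)" by (simp only: u_antipode[of x] mult.assoc[symmetric])
    then have "S (S x) = u * x * v" by (simp add: uv)
    also have "\<dots> = u * (\<Sum>E * x * \<Sum>E) * v" by (simp add: E_sum)
    also have "\<dots> = (\<Sum>f\<in>E. \<Sum>e\<in>E. u * e * x * (f * v))"
      by (simp only: sum_distrib_left sum_distrib_right mult.assoc)
    also have "\<dots> = (\<Sum>e\<in>E. \<Sum>f\<in>E. u * e * x * (f * v))"
      by (rule sum.swap)
    also have "\<dots> = (\<Sum>e\<in>E. \<Sum>f\<in>E. (\<zeta> e / \<zeta> f) \<odot> (e * x * f))"
      by (intro sum.cong refl)
        (simp add: zeta v_eigen scale_mult_left scale_mult_right divide_inverse mult.commute)
    finally show ?thesis .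
  qed
  then have "htr (\<lambda>x. S (S x)) = (\<Sum>e\<in>E. \<Sum>f\<in>E. htr (\<lambda>x. (\<zeta> e / \<zeta> f) \<odot> (e * x * f)))"
    by (simp add: H.trace_sum)
  also have "\<dots> = (\<Sum>e\<in>E. \<Sum>f\<in>E. if linked e f then \<zeta> e / \<zeta> f else 0)"
    by (intro sum.cong refl) (simp add: H.trace_scale trace_corner)
  finally show ?thesis .
qed

text \<open>If \<open>\<epsilon> e = 1\<close>, then \<open>\<Lambda>\<close> is a non-zero
  idempotent below \<open>e\<close>; it commutes with \<open>u\<close>, as both products are
  \<open>\<epsilon> u \<odot> \<Lambda>\<close>.\<close>

lemma haar_mem: "e \<in> E \<Longrightarrow> \<epsilon> e \<noteq> 0 \<Longrightarrow> e = \<Lambda>"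
proof -
  assume e: "e \<in> E" "\<epsilon> e \<noteq> 0"
  have "\<epsilon> e * \<epsilon> e = \<epsilon> e" using E_idem[OF e(1)] by (metis counit_mult)
  with e(2) have e1: "\<epsilon> e = 1" by simp
  have "\<Lambda> = 0 \<or> \<Lambda> = e"
    by (rule E_primitive[OF e(1)]) (simp_all add: haar_left haar_right counit_haar e1)
  moreover have "\<Lambda> \<noteq> 0" using counit_haar lin_zero[OF lin_counit] by (metis zero_neq_one)
  ultimately show ?thesis by blast
qed

text \<open>The counits of the members of \<open>E\<close> add up to 1, so \<open>\<Lambda>\<close>
  is a member, and it is linked to nothing but itself. It serves as the isolated class in
  \<open>sum_ratios_nonzero\<close>.\<close>

lemma trace_antipode_sq_nonzero: "htr (\<lambda>x. S (S x)) \<noteq> 0"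
  unfolding trace_antipode_sq
proof (rule sum_ratios_nonzero[where ?e0.0 = \<Lambda>])
  show "finite E" "N > 0" by (rule fin_E N)+
  show "\<zeta> e \<noteq> 0" "linked e e" if "e \<in> E" for e using that by (rule zeta linked_refl)+
  show "linked f e" "\<zeta> e ^ N = \<zeta> f ^ N" if "e \<in> E" "f \<in> E" "linked e f" for e f
    using that by (rule linked_sym zeta_power)+
  show "linked e g" if "e \<in> E" "f \<in> E" "g \<in> E" "linked e f" "linked f g" for e f g
    using that by (rule linked_trans)
  have "(\<Sum>e\<in>E. \<epsilon> e) = \<epsilon> (\<Sum>E)" by (rule lin_sum[OF lin_counit, symmetric])
  then have "(\<Sum>e\<in>E. \<epsilon> e) \<noteq> 0" by (simp only: E_sum counit_1) simp
  then obtain e where "e \<in> E" "\<epsilon> e \<noteq> 0" by (rule sum.not_neutral_contains_not_neutral)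
  then show "\<Lambda> \<in> E" using haar_mem by blast
  fix f assume f: "f \<in> E" "linked \<Lambda> f"
  then obtain x where "\<Lambda> * x * f \<noteq> 0" by (auto simp: linked_def)
  then have "\<epsilon> f \<noteq> 0" by (auto simp: haar_right scale_mult_left)
  with f(1) show "f = \<Lambda>" by (rule haar_mem)
qed

end

context semisimple_hopf begin

lemma trace_antipode_sq_nonzero: "htr (\<lambda>x. S (S x)) \<noteq> 0"
proof -
  obtain u v where uv: "u * v = 1" "v * u = 1" "\<And>a. u * a = S (S a) * u"
    using antipode_sq_inner by blast
  obtain N where N: "N > 0" "\<And>x. ((\<lambda>x. S (S x)) ^^ N) x = x"
    using antipode_finite_order by blast
  have "u ^ n * h = ((\<lambda>x. S (S x)) ^^ n) h * u ^ n" for n h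
  proof (induction n)
    case (Suc n)
    have "u ^ Suc n * h = u * (((\<lambda>x. S (S x)) ^^ n) h * u ^ n)" by (simp add: mult.assoc Suc)
    also have "\<dots> = S (S (((\<lambda>x. S (S x)) ^^ n) h)) * (u * u ^ n)"
      by (simp only: uv(3)[of "((\<lambda>x. S (S x)) ^^ n) h"] mult.assoc[symmetric])
    finally show ?case by simp
  qed simp
  then have central: "u ^ N * h = h * u ^ N" for h using N(2) by simp
  obtain E where E: "idem_family u E" "\<And>F. idem_family u F \<Longrightarrow> card F \<le> card E"
    using idem_family_max by blast
  interpret antipode_decomposition H u v N E
    by unfold_locales (fact uv N(1) central E)+
  show ?thesis by (rule trace_antipode_sq_nonzero)
qed

text \<open>At the argument 1, \<open>lam_right\<close> compares \<open>lam 1 \<odot> 1\<close> with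
  \<open>lam 1 \<odot> dg\<close>.\<close>

lemma antipode_fourth: "S (S (S (S x))) = x"
proof -
  have "lam 1 \<odot> 1 = sw (\<lambda>a b. lam a \<odot> b) 1"
    by (rule sw_1[OF vector_space_H, symmetric]; intro lin_intros)
  then have "lam 1 \<odot> 1 = lam 1 \<odot> dg" by (simp only: lam_right)
  moreover have "lam 1 \<noteq> 0" by (subst lam_1) (rule trace_antipode_sq_nonzero)
  ultimately have "dg = 1" by (metis H.scale_left_imp_eq)
  then show ?thesis by (simp add: radford antipode_1)
qed

section \<open>The square of the antipode\<close>

lemma chi_1: "\<chi> 1 = of_nat (card (vbasis H))"
  by (simp add: \<chi>_def H.trace_id)

lemma chi_haar: "\<chi> \<Lambda> = 1"
proof -
  have "\<chi> \<Lambda> = htr (\<lambda>x. \<epsilon> x \<odot> \<Lambda>)" 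
    unfolding \<chi>_def by (rule H.trace_cong) (rule haar_right)
  then show ?thesis by (simp add: htr_rank_one[OF lin_counit] counit_haar)
qed

text \<open>The regular module absorbs tensor factors:
  \<open>a \<otimes> i \<mapsto> a\<^sub>1 \<otimes> S(a\<^sub>2) i\<close> carries the diagonal
  action on \<open>H \<otimes> H\<close> to the action on the first factor alone.\<close>

lemma chi_convolution: "sw (\<lambda>a b. \<chi> a * \<chi> b) h = \<chi> 1 * \<chi> h"
proof -
  let ?B = "vbasis H" and ?c = "vcoord H"
  \<comment> \<open>In the basis of the second factor, \<open>U m i\<close> are the blocks of this
    isomorphism and \<open>T i m\<close> those of its inverse
    \<open>a \<otimes> m \<mapsto> a\<^sub>1 \<otimes> a\<^sub>2 m\<close>.\<close>
  define T where "T i m z = sw (\<lambda>p q. ?c i (q * m) \<odot> p) z" for i m z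
  define U where "U m i z = sw (\<lambda>r s. ?c m (S s * i) \<odot> r) z" for m i z
  have T: "hlin (scal H) (T i m)" and U: "hlin (scal H) (U m i)" for i m
    unfolding T_def U_def by (intro lin_intros)+
  have key: "sw (\<lambda>p q. ?c i (q * i) \<odot> (p * a)) h = (\<Sum>m\<in>?B. T i m (h * U m i a))" for i a
  proof -
    define G where "G p q c d s = ?c i (q * (d * S s) * i) \<odot> (p * c)" for p q c d s
    have 1: "T i m (h * U m i a) = sw (\<lambda>r s. ?c m (S s * i) \<odot> T i m (h * r)) a" for m
    proof -
      have lin: "hlin (scal H) (\<lambda>z. T i m (h * z))" by (intro lin_comp[OF T] lin_intros)
      show ?thesis unfolding U_def by (subst sw_lin[OF lin]) (simp only: lin_scale[OF lin])
    qed
    have 2: "(\<Sum>m\<in>?B. ?c m (S s * i) \<odot> T i m z) = sw (\<lambda>p q. ?c i (q * (S s * i)) \<odot> p) z" for s z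
    proof -
      have "(\<Sum>m\<in>?B. ?c m (S s * i) \<odot> T i m z) =
        sw (\<lambda>p q. \<Sum>m\<in>?B. (?c m (S s * i) * ?c i (q * m)) \<odot> p) z"
        unfolding T_def by (simp add: sw_sum sw_scale[OF vector_space_H])
      moreover have "(\<Sum>m\<in>?B. (?c m (S s * i) * ?c i (q * m)) \<odot> p) = ?c i (q * (S s * i)) \<odot> p" for p q
      proof -
        have "(\<Sum>m\<in>?B. ?c m (S s * i) * ?c i (q * m)) = ?c i (q * (S s * i))"
          by (rule lin_expand) (intro lin_intros)
        then show ?thesis by (simp flip: H.scale_sum_left)
      qed
      ultimately show ?thesis by simp
    qed
    have 3: "sw (\<lambda>p q. ?c i (q * (S s * i)) \<odot> p) (h * r) = sw (\<lambda>p q. sw (\<lambda>c d. G p q c d s) r) h" for s r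
    proof -
      have "sw (\<lambda>p q. ?c i (q * (S s * i)) \<odot> p) (h * r) =
        sw (\<lambda>p q. sw (\<lambda>c d. ?c i (q * d * (S s * i)) \<odot> (p * c)) r) h"
        by (rule sw_mult[OF vector_space_H]; intro lin_intros)
      then show ?thesis by (simp only: G_def mult.assoc)
    qed
    have 4: "sw (\<lambda>r s. sw (\<lambda>p q. sw (\<lambda>c d. G p q c d s) r) h) a =
      sw (\<lambda>p q. sw (\<lambda>r s. sw (\<lambda>c d. G p q c d s) r) a) h"
      by (rule sw_swap)
    have 5: "sw (\<lambda>r s. sw (\<lambda>c d. G p q c d s) r) a = sw (\<lambda>c z. sw (\<lambda>d s. G p q c d s) z) a" for p q
      unfolding G_def by (rule sw_coassoc[OF vector_space_H, symmetric]; intro lin_intros)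
    have 6: "sw (\<lambda>d s. G p q c d s) z = \<epsilon> z \<odot> (?c i (q * i) \<odot> (p * c))" for p q c z
    proof -
      have "sw (\<lambda>d s. ?c i (q * (d * S s) * i) \<odot> (p * c)) z = \<epsilon> z \<odot> (?c i (q * 1 * i) \<odot> (p * c))"
        by (rule sw_antipode_right[of "scal H" "\<lambda>w. ?c i (q * w * i) \<odot> (p * c)"]) (intro lin_intros)
      then show ?thesis by (simp add: G_def)
    qed
    have 7: "sw (\<lambda>c z. \<epsilon> z \<odot> (?c i (q * i) \<odot> (p * c))) a = ?c i (q * i) \<odot> (p * a)" for p q
      by (rule sw_counit_right) (intro lin_intros)
    show ?thesis by (simp only: 1 sw_sum[symmetric] 2 3 4 5 6 7)
  qed
  have UT: "(\<Sum>i\<in>?B. \<Sum>m\<in>?B. U m i (T i m a)) = \<chi> 1 \<odot> a" for a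
  proof -
    have 1: "U m i (T i m a) = sw (\<lambda>p q. sw (\<lambda>r s. (?c m (S s * i) * ?c i (q * m)) \<odot> r) p) a" for m i
    proof -
      have "U m i (T i m a) = sw (\<lambda>p q. ?c i (q * m) \<odot> U m i p) a"
        unfolding T_def by (subst sw_lin[OF U]) (simp only: lin_scale[OF U])
      then show ?thesis unfolding U_def by (simp add: sw_scale[OF vector_space_H] mult.commute)
    qed
    have 2: "(\<Sum>i\<in>?B. \<Sum>m\<in>?B. (?c m (S s * i) * ?c i (q * m)) \<odot> r) = \<chi> (S s * q) \<odot> r" for s q r
    proof -
      have "(\<Sum>m\<in>?B. ?c m (S s * i) * ?c i (q * m)) = ?c i (q * (S s * i))" for i
        by (rule lin_expand) (intro lin_intros)
      then have "(\<Sum>i\<in>?B. \<Sum>m\<in>?B. ?c m (S s * i) * ?c i (q * m)) = \<chi> (q * S s)"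
        by (simp add: \<chi>_def linear_trace_eq mult.assoc)
      then show ?thesis by (simp add: chi_comm[of "S s"] flip: H.scale_sum_left)
    qed
    have 3: "sw (\<lambda>p q. sw (\<lambda>r s. \<chi> (S s * q) \<odot> r) p) a = sw (\<lambda>r z. sw (\<lambda>s q. \<chi> (S s * q) \<odot> r) z) a"
      by (rule sw_coassoc[OF vector_space_H, symmetric]; intro lin_intros)
    have 4: "sw (\<lambda>s q. \<chi> (S s * q) \<odot> r) z = \<epsilon> z \<odot> (\<chi> 1 \<odot> r)" for r z
      by (rule sw_antipode_left[of "scal H" "\<lambda>w. \<chi> w \<odot> r"]) (intro lin_intros)
    have 5: "sw (\<lambda>r z. \<epsilon> z \<odot> (\<chi> 1 \<odot> r)) a = \<chi> 1 \<odot> a"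
      by (rule sw_counit_right) (intro lin_intros)
    show ?thesis by (simp only: 1 sw_sum[symmetric] 2 3 4 5)
  qed
  have "sw (\<lambda>a b. \<chi> a * \<chi> b) h = sw (\<lambda>p q. \<Sum>i\<in>?B. htr (\<lambda>a. ?c i (q * i) \<odot> (p * a))) h"
  proof -
    have "\<chi> p * \<chi> q = (\<Sum>i\<in>?B. htr (\<lambda>a. ?c i (q * i) \<odot> (p * a)))" for p q
    proof -
      have "\<chi> q = (\<Sum>i\<in>?B. ?c i (q * i))" by (simp add: \<chi>_def linear_trace_eq)
      then show ?thesis
        by (simp add: H.trace_scale \<chi>_def[of p] sum_distrib_left mult.commute)
    qed
    then show ?thesis by simp
  qed
  also have "\<dots> = (\<Sum>i\<in>?B. htr (\<lambda>a. \<Sum>m\<in>?B. T i m (h * U m i a)))"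
    by (simp only: sw_sum htr_sw[symmetric] key)
  also have "\<dots> = (\<Sum>i\<in>?B. \<Sum>m\<in>?B. htr (\<lambda>a. T i m (h * U m i a)))"
    by (simp add: H.trace_sum)
  also have "\<dots> = (\<Sum>i\<in>?B. \<Sum>m\<in>?B. htr (\<lambda>a. h * U m i (T i m a)))"
  proof (intro sum.cong refl)
    fix i m
    show "htr (\<lambda>a. T i m (h * U m i a)) = htr (\<lambda>a. h * U m i (T i m a))"
      by (rule htr_comm[of "T i m" "\<lambda>a. h * U m i a"]; intro T lin_intros lin_comp[OF U])
  qed
  also have "\<dots> = htr (\<lambda>a. h * (\<Sum>i\<in>?B. \<Sum>m\<in>?B. U m i (T i m a)))"
    by (simp add: H.trace_sum sum_distrib_left)
  also have "\<dots> = \<chi> 1 * \<chi> h"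
    by (simp add: UT scale_mult_right H.trace_scale \<chi>_def[of h])
  finally show ?thesis .
qed

lemma antipode_involutive: "S (S x) = x"
proof -
  define n where "n = card (vbasis H)"
  have chi1: "\<chi> 1 = of_nat n" by (simp add: chi_1 n_def)
  have n: "of_nat n \<noteq> (0 :: 'k)"
    using chi_idempotent[of 1] one_neq_zero_H by (metis chi1 mult_1 of_nat_eq_0_iff)
  define \<sigma> where "\<sigma> x = S (S x)" for x
  have \<sigma>: "hlin (scal H) \<sigma>" unfolding \<sigma>_def by (intro lin_intros)
  have \<sigma>\<sigma>: "\<sigma> (\<sigma> x) = x" for x by (simp add: \<sigma>_def antipode_fourth)
  \<comment> \<open>Multiplication by \<open>\<sigma> a\<close> is the conjugate under
    \<open>\<sigma>\<close> of multiplication by \<open>a\<close>.\<close>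
  have chi_\<sigma>: "\<chi> (\<sigma> a) = \<chi> a" for a
  proof -
    have "htr (\<lambda>x. \<sigma> (a * \<sigma> x)) = htr (\<lambda>x. a * \<sigma> (\<sigma> x))"
      by (rule htr_comm[OF \<sigma>]) (intro lin_intros \<sigma>)
    moreover have "\<sigma> (a * \<sigma> x) = \<sigma> a * x" for x
      using \<sigma>\<sigma>[of x] by (simp add: \<sigma>_def antipode_mult)
    ultimately show ?thesis by (simp add: \<chi>_def \<sigma>\<sigma>)
  qed
  define F where "F h = sw (\<lambda>a b. \<chi> a \<odot> b) h" for h
  have F: "hlin (scal H) F" unfolding F_def by (intro lin_intros)
  have FF: "F (F h) = of_nat n \<odot> F h" for h
  proof -
    have "F (F h) = sw (\<lambda>a b. \<chi> a \<odot> F b) h"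
      unfolding F_def[of h] by (subst sw_lin[OF F]) (simp only: lin_scale[OF F])
    also have "\<dots> = sw (\<lambda>a b. sw (\<lambda>c d. (\<chi> a * \<chi> c) \<odot> d) b) h"
      by (simp add: F_def sw_scale[OF vector_space_H])
    also have "\<dots> = sw (\<lambda>z d. sw (\<lambda>a c. (\<chi> a * \<chi> c) \<odot> d) z) h"
      by (rule sw_coassoc[OF vector_space_H]; intro lin_intros)
    also have "\<dots> = sw (\<lambda>z d. of_nat n \<odot> (\<chi> z \<odot> d)) h"
    proof -
      have "sw (\<lambda>a c. (\<chi> a * \<chi> c) \<odot> d) z = of_nat n \<odot> (\<chi> z \<odot> d)" for z d
      proof -
        have "sw (\<lambda>a c. (\<chi> a * \<chi> c) \<odot> d) z = sw (\<lambda>a c. \<chi> a * \<chi> c) z \<odot> d"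
          by (rule sw_lin[symmetric, of "(*)" "scal H" "\<lambda>x. x \<odot> d"]) (intro lin_intros)
        then show ?thesis by (simp add: chi_convolution chi1)
      qed
      then show ?thesis by simp
    qed
    also have "\<dots> = of_nat n \<odot> F h"
      unfolding F_def by (rule sw_scale[OF vector_space_H, symmetric])
    finally show ?thesis .
  qed
  have F\<sigma>: "F (\<sigma> h) = \<sigma> (F h)" for h
  proof -
    have "F (\<sigma> h) = sw (\<lambda>a b. \<chi> (\<sigma> a) \<odot> \<sigma> b) h"
      unfolding F_def \<sigma>_def by (rule sw_antipode_sq[OF vector_space_H]; intro lin_intros)
    then show ?thesis unfolding F_def by (simp add: chi_\<sigma> sw_lin[OF \<sigma>] lin_scale[OF \<sigma>])
  qed
  have tr\<sigma>F: "htr (\<lambda>h. \<sigma> (F h)) = htr \<sigma>"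
  proof -
    have "\<sigma> (F h) = sw (\<lambda>a b. \<chi> a \<odot> \<sigma> b) h" for h
      unfolding F_def by (simp add: sw_lin[OF \<sigma>] lin_scale[OF \<sigma>])
    then show ?thesis
      using trace_convolution_antipode_sq[OF lin_chi] by (simp add: chi_haar flip: \<sigma>_def)
  qed
  define E where "E x = (1 / of_nat n) \<odot> F x" for x
  have E: "hlin (scal H) E" unfolding E_def by (intro lin_intros F)
  have EE: "E (E x) = E x" for x using n by (simp add: E_def lin_scale[OF F] FF)
  have E\<sigma>: "E (\<sigma> x) = \<sigma> (E x)" for x by (simp add: E_def F\<sigma> lin_scale[OF \<sigma>])
  have trE: "of_nat n * htr (\<lambda>h. \<sigma> (E h)) = htr \<sigma>"
  proof -
    have "htr (\<lambda>h. \<sigma> (E h)) = (1 / of_nat n) * htr (\<lambda>h. \<sigma> (F h))"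
      unfolding E_def lin_scale[OF \<sigma>] by (rule H.trace_scale) simp
    with n show ?thesis by (simp add: tr\<sigma>F)
  qed
  \<comment> \<open>\<open>P\<close> and \<open>Q\<close> are the projections onto the eigenspaces
    of \<open>\<sigma>\<close> for 1 and -1. They commute with \<open>E\<close>, so all four traces
    below are ranks.\<close>
  define P where "P x = (1 / 2) \<odot> (x + \<sigma> x)" for x
  define Q where "Q x = (1 / 2) \<odot> (x + (-1) \<odot> \<sigma> x)" for x
  have P: "hlin (scal H) P" and Q: "hlin (scal H) Q"
    unfolding P_def Q_def by (intro lin_intros lin_plus[OF vector_space_H] \<sigma>)+
  have half: "(1 / 2) \<odot> (1 / 2) \<odot> (y + y) = (1 / 2) \<odot> y" for y
  proof -
    have "y + y = 2 \<odot> y" using H.scale_left_distrib[of 1 1 y] by simp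
    then show ?thesis by simp
  qed
  have PP: "P (P x) = P x" for x
    using half[of "x + \<sigma> x"]
    by (simp add: P_def lin_add[OF \<sigma>] lin_scale[OF \<sigma>] \<sigma>\<sigma> H.scale_right_distrib algebra_simps)
  have QQ: "Q (Q x) = Q x" for x
    using half[of "x + (-1) \<odot> \<sigma> x"]
    by (simp add: Q_def lin_add[OF \<sigma>] lin_scale[OF \<sigma>] lin_diff[OF \<sigma>] \<sigma>\<sigma> H.scale_right_distrib
        H.scale_right_diff_distrib algebra_simps)
  have PE: "P (E x) = E (P x)" and QE: "Q (E x) = E (Q x)" for x
    by (simp_all add: P_def Q_def lin_scale[OF E] lin_add[OF E] lin_diff[OF E] E\<sigma>)
  have tr: "htr (\<lambda>x. \<sigma> (f x)) = htr (\<lambda>x. P (f x)) - htr (\<lambda>x. Q (f x))"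
    "htr f = htr (\<lambda>x. P (f x)) + htr (\<lambda>x. Q (f x))" for f
  proof -
    have two: "2 * htr (\<lambda>x. P (f x)) = htr f + htr (\<lambda>x. \<sigma> (f x))"
      unfolding P_def by (simp add: H.trace_scale H.trace_add)
    have two': "2 * htr (\<lambda>x. Q (f x)) = htr f - htr (\<lambda>x. \<sigma> (f x))"
      using H.trace_add[of f "\<lambda>x. (-1) \<odot> \<sigma> (f x)"] H.trace_scale[of "\<lambda>x. \<sigma> (f x)" "-1"]
      unfolding Q_def by (subst H.trace_scale) (simp_all del: H.scale_minus_left)
    have "2 * htr (\<lambda>x. \<sigma> (f x)) = 2 * (htr (\<lambda>x. P (f x)) - htr (\<lambda>x. Q (f x)))"
      "2 * htr f = 2 * (htr (\<lambda>x. P (f x)) + htr (\<lambda>x. Q (f x)))"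
      using two two' by (simp_all add: algebra_simps)
    then show "htr (\<lambda>x. \<sigma> (f x)) = htr (\<lambda>x. P (f x)) - htr (\<lambda>x. Q (f x))"
      "htr f = htr (\<lambda>x. P (f x)) + htr (\<lambda>x. Q (f x))"
      by (metis mult_left_cancel zero_neq_numeral)+
  qed
  obtain a where a: "htr P = of_nat a" "a = 0 \<Longrightarrow> \<forall>x. P x = 0" using htr_idempotent[OF P PP] by metis
  obtain b where b: "htr Q = of_nat b" "b = 0 \<Longrightarrow> \<forall>x. Q x = 0" using htr_idempotent[OF Q QQ] by metis
  obtain a' where a': "htr (\<lambda>x. P (E x)) = of_nat a'"
    using htr_idempotent[OF lin_comp[OF P E]] by (metis PE PP EE)
  obtain b' where b': "htr (\<lambda>x. Q (E x)) = of_nat b'"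
    using htr_idempotent[OF lin_comp[OF Q E]] by (metis QE QQ EE)
  have "(of_nat n :: 'k) = of_nat a + of_nat b"
    using tr(2)[of "\<lambda>x. x"] by (simp add: a b H.trace_id n_def)
  then have nab: "n = a + b" by (metis of_nat_add of_nat_eq_iff)
  have tr\<sigma>: "htr \<sigma> = of_int (int a - int b)" using tr(1)[of "\<lambda>x. x"] by (simp add: a b)
  have "of_int (int n * (int a' - int b')) = (of_int (int a - int b) :: 'k)"
    using trE tr(1)[of E] by (simp add: a' b' tr\<sigma>)
  \<comment> \<open>Here \<open>n = a + b\<close> divides the non-zero integer \<open>a - b\<close>,
    whose absolute value is at most \<open>a + b\<close>; so \<open>a\<close> or \<open>b\<close> is
    0.\<close>
  then have eq: "int n * (int a' - int b') = int a - int b" by (simp only: of_int_eq_iff)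
  have "htr \<sigma> \<noteq> 0" unfolding \<sigma>_def by (rule trace_antipode_sq_nonzero)
  then have "int a - int b \<noteq> 0" by (metis tr\<sigma> of_int_0)
  then have "int a' - int b' \<noteq> 0" using eq by (metis mult_zero_right)
  then have "\<bar>int a' - int b'\<bar> \<ge> 1" by linarith
  then have "int n * 1 \<le> int n * \<bar>int a' - int b'\<bar>" by (intro mult_left_mono) auto
  also have "\<dots> = \<bar>int a - int b\<bar>" by (simp add: abs_mult flip: eq)
  finally have "a = 0 \<or> b = 0" using nab by linarith
  moreover have "a \<noteq> 0"
  proof
    assume "a = 0"
    then have "P 1 = 0" using a by blast
    moreover have "P 1 = 1"
      using half[of "2 \<odot> 1"] H.scale_left_distrib[of "1/2" "1/2" 1]
      by (simp add: P_def \<sigma>_def antipode_1 H.scale_right_distrib)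
    ultimately show False using one_neq_zero_H by simp
  qed
  ultimately have "Q x = 0" using b by blast
  then have "x + (-1) \<odot> \<sigma> x = 0" by (simp add: Q_def)
  then show ?thesis by (simp add: \<sigma>_def)
qed

end

section \<open>Invariant forms on a simple module\<close>

locale twisted_module = semisimple_hopf H
  for H :: "('k::{alg_closed_field,field_char_0}, 'h::ring_1) hopf" +
  fixes \<alpha> :: "'h \<Rightarrow> 'k" and V :: "('k, 'v::ab_group_add, 'h) hmod"
  assumes algebra_map: "algebra_map H \<alpha>"
    and alpha_central: "\<And>h. sw (\<lambda>a b. \<alpha> a \<odot> b) h = sw (\<lambda>a b. \<alpha> b \<odot> a) h"
    and simple: "simple_hmod H V" and fin_dim_V: "fin_dim V"
begin

lemma is_vspace_V: "is_vspace V"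
  using simple by (simp add: simple_hmod_def is_hmod_def)

sublocale V: fd_space V
  using is_vspace_V fin_dim_V by unfold_locales

abbreviation act' (infixr "\<cdot>" 75) where "h \<cdot> v \<equiv> act V h v"

lemma lin_alpha: "hlin (*) \<alpha>"
  using algebra_map by (simp add: algebra_map_def lin_def linear_map_def ground_def)

lemmas lin_alpha_comp [lin_intros] = lin_comp[OF lin_alpha]

lemma alpha_mult: "\<alpha> (x * y) = \<alpha> x * \<alpha> y" and alpha_1: "\<alpha> 1 = 1"
  using algebra_map by (simp_all add: algebra_map_def)

lemma act_bilinear: "bilinear_map H V V (act V)"
  using simple by (simp add: simple_hmod_def is_hmod_def)

lemma act_carr [simp]: "v \<in> carr V \<Longrightarrow> h \<cdot> v \<in> carr V"
  using linear_map_carr[OF bilinear_mapD(2)[OF act_bilinear]] by simp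

lemma act_mult: "v \<in> carr V \<Longrightarrow> (g * h) \<cdot> v = g \<cdot> h \<cdot> v" and act_1: "v \<in> carr V \<Longrightarrow> 1 \<cdot> v = v"
  using simple by (simp_all add: simple_hmod_def is_hmod_def)

lemma linear_act: "linear_map V V (act V h)"
  using bilinear_mapD(2)[OF act_bilinear, of h] by simp

lemma act_lin: "v \<in> carr V \<Longrightarrow> hlin (scal V) (\<lambda>h. h \<cdot> v)"
  using bilinear_mapD(1)[OF act_bilinear] by (simp add: lin_def linear_map_def)

abbreviation form :: "('v \<Rightarrow> 'v \<Rightarrow> 'k) \<Rightarrow> bool" where "form \<beta> \<equiv> bilinear_map V V ground \<beta>"

lemma formI:
  assumes "\<And>u v w. u \<in> carr V \<Longrightarrow> v \<in> carr V \<Longrightarrow> w \<in> carr V \<Longrightarrow> \<beta> (u + v) w = \<beta> u w + \<beta> v w"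
    "\<And>c v w. v \<in> carr V \<Longrightarrow> w \<in> carr V \<Longrightarrow> \<beta> (scal V c v) w = c * \<beta> v w"
    "\<And>u v w. u \<in> carr V \<Longrightarrow> v \<in> carr V \<Longrightarrow> w \<in> carr V \<Longrightarrow> \<beta> w (u + v) = \<beta> w u + \<beta> w v"
    "\<And>c v w. v \<in> carr V \<Longrightarrow> w \<in> carr V \<Longrightarrow> \<beta> w (scal V c v) = c * \<beta> w v"
  shows "form \<beta>"
  using assms by (simp add: bilinear_map_def linear_map_def ground_def)

lemma form_add_left: "form \<beta> \<Longrightarrow> u \<in> carr V \<Longrightarrow> v \<in> carr V \<Longrightarrow> w \<in> carr V \<Longrightarrow> \<beta> (u + v) w = \<beta> u w + \<beta> v w"
  and form_scale_left: "form \<beta> \<Longrightarrow> v \<in> carr V \<Longrightarrow> w \<in> carr V \<Longrightarrow> \<beta> (scal V c v) w = c * \<beta> v w"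
  and form_add_right: "form \<beta> \<Longrightarrow> u \<in> carr V \<Longrightarrow> v \<in> carr V \<Longrightarrow> w \<in> carr V \<Longrightarrow> \<beta> w (u + v) = \<beta> w u + \<beta> w v"
  and form_scale_right: "form \<beta> \<Longrightarrow> v \<in> carr V \<Longrightarrow> w \<in> carr V \<Longrightarrow> \<beta> w (scal V c v) = c * \<beta> w v"
  by (simp_all add: bilinear_map_def linear_map_def ground_def)

lemma lin_form:
  assumes "form \<beta>"
  shows lin_form_left: "v \<in> carr V \<Longrightarrow> w \<in> carr V \<Longrightarrow> hlin (*) (\<lambda>h. \<beta> (h \<cdot> v) w)"
    and lin_form_right: "v \<in> carr V \<Longrightarrow> w \<in> carr V \<Longrightarrow> hlin (*) (\<lambda>h. \<beta> v (h \<cdot> w))"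
proof -
  show "hlin (*) (\<lambda>h. \<beta> (h \<cdot> v) w)" if v: "v \<in> carr V" and w: "w \<in> carr V"
    using lin_add[OF act_lin[OF v]] lin_scale[OF act_lin[OF v]]
    by (simp add: lin_def form_add_left[OF assms _ _ w] form_scale_left[OF assms _ w] v)
  show "hlin (*) (\<lambda>h. \<beta> v (h \<cdot> w))" if v: "v \<in> carr V" and w: "w \<in> carr V"
    using lin_add[OF act_lin[OF w]] lin_scale[OF act_lin[OF w]]
    by (simp add: lin_def form_add_right[OF assms _ _ v] form_scale_right[OF assms _ v] w)
qed

lemma form_expand:
  assumes "form \<beta>" "v \<in> carr V" "w \<in> carr V"
  shows "\<beta> v w = (\<Sum>e\<in>vbasis V. \<Sum>f\<in>vbasis V. vcoord V e v * vcoord V f w * \<beta> e f)"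
proof -
  have 1: "\<beta> v w = (\<Sum>e\<in>vbasis V. vcoord V e v * \<beta> e w)"
    using linear_map_expand[OF V.fd_space_axioms bilinear_mapD(1)[OF assms(1,3)] assms(2)]
    by (simp add: ground_def)
  have 2: "\<beta> e w = (\<Sum>f\<in>vbasis V. vcoord V f w * \<beta> e f)" if "e \<in> vbasis V" for e
    using linear_map_expand[OF V.fd_space_axioms bilinear_mapD(2)[OF assms(1) V.vbasis_carr[OF that]] assms(3)]
    by (simp add: ground_def)
  show ?thesis unfolding 1 by (simp add: 2 sum_distrib_left mult.assoc)
qed

text \<open>\<open>invariant_pairing\<close> without non-degeneracy. Working with functions of two
  vectors keeps tensors out of the argument until the indicator itself is computed.\<close>

definition inv_form :: "('v \<Rightarrow> 'v \<Rightarrow> 'k) \<Rightarrow> bool" where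
  "inv_form \<beta> \<longleftrightarrow> form \<beta> \<and>
    (\<forall>h. \<forall>v\<in>carr V. \<forall>w\<in>carr V. sw (\<lambda>x y. \<beta> (x \<cdot> v) (y \<cdot> w)) h = \<alpha> h * \<beta> v w)"

text \<open>Insert \<open>h\<^sub>2 S(h\<^sub>3)\<close> in the second argument and use invariance.
  The identity expresses that \<open>v \<mapsto> \<beta>(v, _)\<close> is \<open>H\<close>-linear
  into the twisted dual.\<close>

lemma inv_form_act:
  assumes "inv_form \<beta>" and v: "v \<in> carr V" and w: "w \<in> carr V"
  shows "\<beta> (h \<cdot> v) w = sw (\<lambda>a b. \<alpha> a * \<beta> v (S b \<cdot> w)) h"
proof -
  have \<beta>: "form \<beta>" using assms by (simp add: inv_form_def)
  note li = lin_intros lin_comp[OF lin_form_left[OF \<beta>]] lin_comp[OF lin_form_right[OF \<beta>]] v w act_carr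
  have 1: "\<alpha> a * \<beta> v (S b \<cdot> w) = sw (\<lambda>x y. \<beta> (x \<cdot> v) ((y * S b) \<cdot> w)) a" for a b
    using assms by (simp add: inv_form_def act_mult)
  have 2: "sw (\<lambda>a b. sw (\<lambda>x y. \<beta> (x \<cdot> v) ((y * S b) \<cdot> w)) a) h =
    sw (\<lambda>x z. sw (\<lambda>y b. \<beta> (x \<cdot> v) ((y * S b) \<cdot> w)) z) h"
    by (rule sw_coassoc[OF vector_space_mult, symmetric]; intro li)
  have 3: "sw (\<lambda>y b. \<beta> (x \<cdot> v) ((y * S b) \<cdot> w)) z = \<epsilon> z * \<beta> (x \<cdot> v) w" for x z
    using sw_antipode_right[OF lin_form_right[OF \<beta>, of "x \<cdot> v" w], of z] v w by (simp add: act_1)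
  have 4: "sw (\<lambda>x z. \<epsilon> z * \<beta> (x \<cdot> v) w) h = \<beta> (h \<cdot> v) w"
    by (rule sw_counit_right[OF lin_form_left[OF \<beta> v w]])
  show ?thesis unfolding 1 2 3 4 ..
qed

lemma inv_formI:
  assumes \<beta>: "form \<beta>"
    and act: "\<And>h v w. v \<in> carr V \<Longrightarrow> w \<in> carr V \<Longrightarrow> \<beta> (h \<cdot> v) w = sw (\<lambda>a b. \<alpha> a * \<beta> v (S b \<cdot> w)) h"
  shows "inv_form \<beta>"
  unfolding inv_form_def
proof (intro conjI allI ballI \<beta>)
  fix h v w assume v: "v \<in> carr V" and w: "w \<in> carr V"
  note li = lin_intros lin_comp[OF lin_form_left[OF \<beta>]] lin_comp[OF lin_form_right[OF \<beta>]] v w act_carr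
  have 1: "\<beta> (x \<cdot> v) (y \<cdot> w) = sw (\<lambda>a b. \<alpha> a * \<beta> v ((S b * y) \<cdot> w)) x" for x y
    using act[OF v, of "y \<cdot> w" x] w by (simp add: act_mult)
  have 2: "sw (\<lambda>x y. sw (\<lambda>a b. \<alpha> a * \<beta> v ((S b * y) \<cdot> w)) x) h =
    sw (\<lambda>a z. sw (\<lambda>b y. \<alpha> a * \<beta> v ((S b * y) \<cdot> w)) z) h"
    by (rule sw_coassoc[OF vector_space_mult, symmetric]; intro li)
  have 3: "sw (\<lambda>b y. \<alpha> a * \<beta> v ((S b * y) \<cdot> w)) z = \<epsilon> z * (\<alpha> a * \<beta> v w)" for a z
    using sw_antipode_left[of "(*)" "\<lambda>x. \<alpha> a * \<beta> v (x \<cdot> w)" z] lin_form_right[OF \<beta> v w] w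
    by (simp add: act_1 lin_intros)
  have 4: "sw (\<lambda>a z. \<epsilon> z * (\<alpha> a * \<beta> v w)) h = \<alpha> h * \<beta> v w"
    by (rule sw_counit_right) (intro li lin_alpha)
  show "sw (\<lambda>x y. \<beta> (x \<cdot> v) (y \<cdot> w)) h = \<alpha> h * \<beta> v w" unfolding 1 2 3 4 ..
qed

text \<open>This is where centrality of \<open>\<alpha>\<close> and \<open>S\<^sup>2 = id\<close> enter.\<close>

lemma inv_form_swap:
  assumes "inv_form \<beta>"
  shows "inv_form (\<lambda>v w. \<beta> w v)"
proof -
  have \<beta>: "form \<beta>" using assms by (simp add: inv_form_def)
  have form': "form (\<lambda>v w. \<beta> w v)" using \<beta> by (simp add: bilinear_map_def)
  have "sw (\<lambda>x y. \<beta> (y \<cdot> w) (x \<cdot> v)) h = \<alpha> h * \<beta> w v" if v: "v \<in> carr V" and w: "w \<in> carr V" for h v w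
  proof -
    note li = lin_intros lin_comp[OF lin_form_left[OF \<beta>]] lin_comp[OF lin_form_right[OF \<beta>]] v w act_carr
    have 1: "\<beta> (y \<cdot> w) (x \<cdot> v) = sw (\<lambda>a b. \<alpha> a * \<beta> w ((S b * x) \<cdot> v)) y" for x y
      using inv_form_act[OF assms w, of "x \<cdot> v"] v by (simp add: act_mult)
    have 2: "sw (\<lambda>x y. sw (\<lambda>a b. \<alpha> a * \<beta> w ((S b * x) \<cdot> v)) y) h =
      sw (\<lambda>z b. sw (\<lambda>x a. \<alpha> a * \<beta> w ((S b * x) \<cdot> v)) z) h"
      by (rule sw_coassoc[OF vector_space_mult]; intro li)
    \<comment> \<open>The legs stand as
      \<open>\<alpha>(h\<^sub>2) \<beta>(w, S(h\<^sub>3) h\<^sub>1 v)\<close>. Centrality exchanges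
      the first two, which makes the neighbours \<open>h\<^sub>2\<close> and
      \<open>h\<^sub>3\<close> meet.\<close>
    have 3: "sw (\<lambda>x a. \<alpha> a * \<beta> w ((S b * x) \<cdot> v)) z = sw (\<lambda>x a. \<alpha> x * \<beta> w ((S b * a) \<cdot> v)) z" for b z
    proof -
      have lin: "hlin (*) (\<lambda>x. \<beta> w ((S b * x) \<cdot> v))" by (intro li)
      show ?thesis
        using arg_cong[OF alpha_central[of z], of "\<lambda>x. \<beta> w ((S b * x) \<cdot> v)"]
        by (simp only: sw_lin[OF lin] lin_scale[OF lin])
    qed
    have 4: "sw (\<lambda>z b. sw (\<lambda>x a. \<alpha> x * \<beta> w ((S b * a) \<cdot> v)) z) h =
      sw (\<lambda>x y. sw (\<lambda>a b. \<alpha> x * \<beta> w ((S b * a) \<cdot> v)) y) h"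
      by (rule sw_coassoc[OF vector_space_mult, symmetric]; intro li)
    \<comment> \<open>\<open>S(b) a = S(S(a) b)\<close> holds because \<open>S\<^sup>2 = id\<close>,
      and the right side collapses.\<close>
    have 5: "sw (\<lambda>a b. \<alpha> x * \<beta> w ((S b * a) \<cdot> v)) y = \<epsilon> y * (\<alpha> x * \<beta> w v)" for x y
    proof -
      have lin: "hlin (*) (\<lambda>z. \<alpha> x * \<beta> w (S z \<cdot> v))" by (intro li)
      show ?thesis
        using sw_antipode_left[OF lin, of y] v
        by (simp add: antipode_mult antipode_involutive antipode_1 act_1)
    qed
    have 6: "sw (\<lambda>x y. \<epsilon> y * (\<alpha> x * \<beta> w v)) h = \<alpha> h * \<beta> w v"
      by (rule sw_counit_right) (intro li lin_alpha)
    show ?thesis unfolding 1 2 3 4 5 6 ..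
  qed
  with form' show ?thesis by (simp add: inv_form_def)
qed

section \<open>Schur's lemma for invariant forms\<close>

definition nonzero_form :: "('v \<Rightarrow> 'v \<Rightarrow> 'k) \<Rightarrow> bool" where
  "nonzero_form \<beta> \<longleftrightarrow> (\<exists>v\<in>carr V. \<exists>w\<in>carr V. \<beta> v w \<noteq> 0)"

lemma sw_zero: "sw (\<lambda>a b. 0) h = 0"
  by (simp add: sw_cop case_prod_unfold)

text \<open>The left radical is a submodule by \<open>inv_form_act\<close>, and it is not all of the
  simple module.\<close>

lemma left_nondegenerate:
  assumes "inv_form \<beta>" "nonzero_form \<beta>" and v: "v \<in> carr V" "\<And>w. w \<in> carr V \<Longrightarrow> \<beta> v w = 0"
  shows "v = 0"
proof -
  have \<beta>: "form \<beta>" using assms by (simp add: inv_form_def)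
  let ?R = "{v \<in> carr V. \<forall>w\<in>carr V. \<beta> v w = 0}"
  have "submod V ?R"
    unfolding submod_def
  proof (intro conjI allI ballI)
    show "V.subspace ?R"
    proof (rule V.subspaceI)
      have "\<beta> 0 w = 0" if "w \<in> carr V" for w
        using linear_map_zero[OF is_vspace_V bilinear_mapD(1)[OF \<beta> that]] .
      then show "0 \<in> ?R" by simp
    qed (auto simp: form_add_left[OF \<beta>] form_scale_left[OF \<beta>] V.carr_add V.carr_scale)
    show "h \<cdot> x \<in> ?R" if "x \<in> ?R" for h x
      using that by (simp add: inv_form_act[OF assms(1)] sw_zero)
  qed auto
  moreover have "?R \<noteq> carr V" using assms(2) by (auto simp: nonzero_form_def)
  ultimately have "?R = {0}" using simple by (auto simp: simple_hmod_def)
  with v show ?thesis by blast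
qed

lemma nonzero_swap: "nonzero_form \<beta> \<Longrightarrow> nonzero_form (\<lambda>v w. \<beta> w v)"
  by (auto simp: nonzero_form_def)

text \<open>The right radical is the left radical of the swapped form, which is invariant as
  well.\<close>

lemma nondegenerate_inv:
  assumes "inv_form \<beta>" "nonzero_form \<beta>"
  shows "nondegenerate V \<beta>"
  using left_nondegenerate[OF assms] left_nondegenerate[OF inv_form_swap nonzero_swap, OF assms]
  unfolding nondegenerate_def by blast

lemma carr_nontrivial: "\<exists>v\<in>carr V. v \<noteq> 0"
  using simple V.carr_zero by (auto simp: simple_hmod_def)

lemma invariant_pairing_iff: "invariant_pairing H \<alpha> V \<beta> \<longleftrightarrow> inv_form \<beta> \<and> nonzero_form \<beta>"
proof
  assume b: "invariant_pairing H \<alpha> V \<beta>"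
  have "nonzero_form \<beta>"
  proof (rule ccontr)
    assume "\<not> nonzero_form \<beta>"
    then have "v = 0" if "v \<in> carr V" for v
      using b that unfolding invariant_pairing_def nondegenerate_def nonzero_form_def by blast
    then show False using carr_nontrivial by blast
  qed
  with b show "inv_form \<beta> \<and> nonzero_form \<beta>" by (simp add: invariant_pairing_def inv_form_def)
next
  assume "inv_form \<beta> \<and> nonzero_form \<beta>"
  then show "invariant_pairing H \<alpha> V \<beta>"
    using nondegenerate_inv by (simp add: invariant_pairing_def inv_form_def)
qed

text \<open>The functional \<open>\<beta>(v, _)\<close> is stored in \<open>V\<close> through its
  values on the basis, so that injectivity of \<open>v \<mapsto> \<beta>(v, _)\<close> gives
  surjectivity.\<close>

lemma form_represents:
  assumes \<beta>: "inv_form \<beta>" "nonzero_form \<beta>" and \<phi>: "linear_map V ground \<phi>"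
  shows "\<exists>v\<in>carr V. \<forall>w\<in>carr V. \<beta> v w = \<phi> w"
proof -
  have f: "form \<beta>" using \<beta> by (simp add: inv_form_def)
  let ?B = "vbasis V"
  define T where "T v = (\<Sum>b\<in>?B. scal V (\<beta> v b) b)" for v
  note coord = V.vcoord_lincomb and agree = V.linear_eq_on_basis
  have "linear_map V V T"
    by (simp add: linear_map_def T_def V.carr_sum V.carr_scale V.vbasis_carr form_add_left[OF f]
        form_scale_left[OF f] V.scale_left_distrib sum.distrib V.scale_sum_right)
  moreover have "v = 0" if v: "v \<in> carr V" "T v = 0" for v
  proof (rule left_nondegenerate[OF \<beta> v(1)])
    fix w assume w: "w \<in> carr V"
    have "\<beta> v b = 0" if "b \<in> ?B" for b
    proof -
      have "\<beta> v b = vcoord V b (T v)" unfolding T_def by (rule coord[OF that, symmetric])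
      also have "\<dots> = vcoord V b (scal V 0 v)" using v by simp
      also have "\<dots> = 0" using v by (simp only: V.vcoord_scale mult_zero_left)
      finally show ?thesis .
    qed
    then show "\<beta> v w = 0"
      using form_expand[OF f v(1) w] linear_map_expand[OF V.fd_space_axioms bilinear_mapD(2)[OF f v(1)] w]
      by (simp add: ground_def)
  qed
  moreover have "(\<Sum>b\<in>?B. scal V (\<phi> b) b) \<in> carr V"
    by (simp add: V.carr_sum V.carr_scale V.vbasis_carr)
  ultimately obtain v where v: "v \<in> carr V" "T v = (\<Sum>b\<in>?B. scal V (\<phi> b) b)"
    using V.linear_inj_surj by blast
  have "\<beta> v b = \<phi> b" if "b \<in> ?B" for b
    using arg_cong[OF v(2), of "vcoord V b"] by (simp only: T_def coord[OF that])
  then have "\<forall>w\<in>carr V. \<beta> v w = \<phi> w"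
    using agree[OF bilinear_mapD(2)[OF f v(1)] \<phi>] by blast
  with v(1) show ?thesis by blast
qed

text \<open>Write \<open>\<gamma>(v, w) = \<beta>(T v, w)\<close>. An eigenvector of
  \<open>T\<close> for \<open>c\<close> lies in the left radical of the invariant form
  \<open>\<gamma> - c \<beta>\<close>, which must therefore be zero.\<close>

lemma inv_form_unique:
  assumes \<beta>: "inv_form \<beta>" "nonzero_form \<beta>" and \<gamma>: "inv_form \<gamma>"
  shows "\<exists>c. \<forall>v\<in>carr V. \<forall>w\<in>carr V. \<gamma> v w = c * \<beta> v w"
proof -
  have f: "form \<beta>" "form \<gamma>" using \<beta> \<gamma> by (simp_all add: inv_form_def)
  have "\<exists>v'\<in>carr V. \<forall>w\<in>carr V. \<beta> v' w = \<gamma> v w" if "v \<in> carr V" for v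
    by (rule form_represents[OF \<beta> bilinear_mapD(2)[OF f(2) that]])
  then obtain T where T: "\<And>v. v \<in> carr V \<Longrightarrow> T v \<in> carr V"
      "\<And>v w. v \<in> carr V \<Longrightarrow> w \<in> carr V \<Longrightarrow> \<beta> (T v) w = \<gamma> v w" by metis
  have inj: "x = y" if "x \<in> carr V" "y \<in> carr V" "\<And>w. w \<in> carr V \<Longrightarrow> \<beta> x w = \<beta> y w" for x y
  proof -
    have "x - y = 0"
    proof (rule left_nondegenerate[OF \<beta>])
      show "\<beta> (x - y) w = 0" if w: "w \<in> carr V" for w
        using form_add_left[OF f(1), of "x - y" y w] w \<open>x \<in> carr V\<close> \<open>y \<in> carr V\<close>
          \<open>\<And>w. w \<in> carr V \<Longrightarrow> \<beta> x w = \<beta> y w\<close>[OF w] by (simp add: V.carr_diff)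
    qed (use that in auto)
    then show ?thesis by simp
  qed
  have "linear_map V V T"
    unfolding linear_map_def
  proof (intro conjI ballI allI)
    fix x y assume xy: "x \<in> carr V" "y \<in> carr V"
    show "T (x + y) = T x + T y"
      by (rule inj) (use xy in \<open>auto simp: T V.carr_add form_add_left[OF f(1)] form_add_left[OF f(2)]\<close>)
  next
    fix c x assume x: "x \<in> carr V"
    show "T (scal V c x) = scal V c (T x)"
      by (rule inj) (use x in \<open>auto simp: T V.carr_scale form_scale_left[OF f(1)] form_scale_left[OF f(2)]\<close>)
  qed (rule T)
  moreover have "carr V \<noteq> {0}" using simple by (simp add: simple_hmod_def)
  ultimately obtain c x where x: "x \<in> carr V" "x \<noteq> 0" "T x = scal V c x"
    using exists_eigenvector[OF V.fd_space_axioms] by blast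
  define \<delta> where "\<delta> v w = \<gamma> v w - c * \<beta> v w" for v w
  have "form \<delta>"
    by (rule formI) (simp_all add: \<delta>_def form_add_left[OF f(1)] form_add_left[OF f(2)] form_add_right[OF f(1)]
        form_add_right[OF f(2)] form_scale_left[OF f(1)] form_scale_left[OF f(2)] form_scale_right[OF f(1)]
        form_scale_right[OF f(2)] algebra_simps)
  moreover have "sw (\<lambda>a b. \<delta> (a \<cdot> v) (b \<cdot> w)) h = \<alpha> h * \<delta> v w" if "v \<in> carr V" "w \<in> carr V" for v w h
  proof -
    have "sw (\<lambda>a b. \<delta> (a \<cdot> v) (b \<cdot> w)) h =
      sw (\<lambda>a b. \<gamma> (a \<cdot> v) (b \<cdot> w) + (- c) * \<beta> (a \<cdot> v) (b \<cdot> w)) h" by (simp add: \<delta>_def)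
    also have "\<dots> = \<alpha> h * \<gamma> v w + (- c) * (\<alpha> h * \<beta> v w)"
      using \<beta>(1) \<gamma> that by (simp only: sw_add sw_mult_left[symmetric] inv_form_def)
    finally show ?thesis by (simp add: \<delta>_def algebra_simps)
  qed
  ultimately have "inv_form \<delta>" by (simp add: inv_form_def)
  moreover have "\<delta> x w = 0" if "w \<in> carr V" for w
    using T(2)[OF x(1) that] by (simp add: \<delta>_def x form_scale_left[OF f(1) x(1) that])
  ultimately have "\<not> nonzero_form \<delta>" using left_nondegenerate[of \<delta> x] x by blast
  then show ?thesis by (intro exI[of _ c]) (auto simp: nonzero_form_def \<delta>_def)
qed

subsection \<open>Averaging\<close>

text \<open>The diagonal action of the Haar integral on the arguments, weighted by
  \<open>\<alpha> \<circ> S\<close>, the convolution inverse of \<alpha>, to land in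
  \<alpha>-invariant forms.\<close>

definition avg :: "('v \<Rightarrow> 'v \<Rightarrow> 'k) \<Rightarrow> 'v \<Rightarrow> 'v \<Rightarrow> 'k" where
  "avg \<beta> v w = sw (\<lambda>a b. \<alpha> (S a) * sw (\<lambda>c d. \<beta> (c \<cdot> v) (d \<cdot> w)) b) \<Lambda>"

lemma avg_cong:
  "(\<And>v w. v \<in> carr V \<Longrightarrow> w \<in> carr V \<Longrightarrow> \<beta> v w = \<gamma> v w) \<Longrightarrow> v \<in> carr V \<Longrightarrow> w \<in> carr V \<Longrightarrow>
    avg \<beta> v w = avg \<gamma> v w"
  by (simp add: avg_def)

lemma avg_sum: "avg (\<lambda>v w. \<Sum>i\<in>I. c i * \<beta> i v w) v w = (\<Sum>i\<in>I. c i * avg (\<beta> i) v w)"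
  by (simp add: avg_def sw_sum sum_distrib_left sw_mult_left algebra_simps)

lemma avg_inv:
  assumes \<beta>: "form \<beta>"
  shows "inv_form (avg \<beta>)"
proof -
  have add: "act V h (u + v) = act V h u + act V h v" "act V h (scal V c u) = scal V c (act V h u)"
    if "u \<in> carr V" "v \<in> carr V" for h u v c
    using that linear_map_add[OF linear_act] linear_map_scale[OF linear_act] by blast+
  have "form (avg \<beta>)"
    by (rule formI)
      (simp_all add: avg_def add form_add_left[OF \<beta>] form_scale_left[OF \<beta>] form_add_right[OF \<beta>]
        form_scale_right[OF \<beta>] sw_add sw_mult_left distrib_left mult.left_commute)
  moreover have "sw (\<lambda>x y. avg \<beta> (x \<cdot> v) (y \<cdot> w)) h = \<alpha> h * avg \<beta> v w"
    if v: "v \<in> carr V" and w: "w \<in> carr V" for h v w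
  proof -
    note li = lin_intros lin_comp[OF lin_form_left[OF \<beta>]] lin_comp[OF lin_form_right[OF \<beta>]] v w act_carr
    define K where "K z = sw (\<lambda>c d. \<beta> (c \<cdot> v) (d \<cdot> w)) z" for z
    have K: "hlin (*) K" unfolding K_def
      by (rule lin_sw_arg[OF vector_space_mult]) (intro lin_form_left[OF \<beta>] lin_form_right[OF \<beta>] v w act_carr)+
    have Kmult: "sw (\<lambda>x y. sw (\<lambda>c d. \<beta> (c \<cdot> x \<cdot> v) (d \<cdot> y \<cdot> w)) b) h = K (b * h)" for b
    proof -
      have "K (b * h) = sw (\<lambda>c d. sw (\<lambda>x y. \<beta> ((c * x) \<cdot> v) ((d * y) \<cdot> w)) h) b"
        unfolding K_def
        by (rule sw_mult[OF vector_space_mult]) (intro lin_form_left[OF \<beta>] lin_form_right[OF \<beta>] v w act_carr)+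
      then show ?thesis by (subst sw_swap) (simp add: act_mult v w)
    qed
    have "sw (\<lambda>x y. avg \<beta> (x \<cdot> v) (y \<cdot> w)) h =
      sw (\<lambda>a b. \<alpha> (S a) * sw (\<lambda>x y. sw (\<lambda>c d. \<beta> (c \<cdot> x \<cdot> v) (d \<cdot> y \<cdot> w)) b) h) \<Lambda>"
      unfolding avg_def by (subst sw_swap) (simp only: sw_mult_left)
    \<comment> \<open>Written as \<open>S (S h)\<close>, the factor \<open>h\<close> can cross to
      the other leg of \<open>\<Lambda>\<close> as \<open>S h\<close>; there
      \<open>\<alpha> \<circ> S\<close> turns it into the scalar \<open>\<alpha> h\<close>.\<close>
    also have "\<dots> = sw (\<lambda>a b. \<alpha> (S a) * K (b * S (S h))) \<Lambda>"
      by (simp only: Kmult antipode_involutive)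
    also have "\<dots> = sw (\<lambda>a b. \<alpha> (S (a * S h)) * K b) \<Lambda>"
      by (rule haar_casimir_right[OF vector_space_mult, of "\<lambda>a b. \<alpha> (S a) * K b", symmetric];
          intro lin_intros K)
    also have "\<dots> = sw (\<lambda>a b. \<alpha> h * (\<alpha> (S a) * K b)) \<Lambda>"
      by (simp add: antipode_mult antipode_involutive alpha_mult mult.assoc)
    also have "\<dots> = \<alpha> h * avg \<beta> v w" by (simp only: sw_mult_left[symmetric] avg_def K_def)
    finally show ?thesis .
  qed
  ultimately show ?thesis by (simp add: inv_form_def)
qed

text \<open>On invariant forms the weights add up to \<open>\<alpha>(S(\<Lambda>\<^sub>1)
  \<Lambda>\<^sub>2) = \<epsilon>(\<Lambda>) = 1\<close>, so \<open>avg\<close> is a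
  projection.\<close>

lemma avg_id:
  assumes "inv_form \<beta>" "v \<in> carr V" "w \<in> carr V"
  shows "avg \<beta> v w = \<beta> v w"
proof -
  have "avg \<beta> v w = sw (\<lambda>a b. \<alpha> (S a * b)) \<Lambda> * \<beta> v w"
    using assms by (simp add: avg_def inv_form_def alpha_mult sw_mult_right mult.assoc)
  also have "sw (\<lambda>a b. \<alpha> (S a * b)) \<Lambda> = 1"
    using sw_antipode_left[OF lin_alpha, of \<Lambda>] by (simp add: counit_haar alpha_1)
  finally show ?thesis by simp
qed

definition coord_form :: "'v \<Rightarrow> 'v \<Rightarrow> 'v \<Rightarrow> 'v \<Rightarrow> 'k" where
  "coord_form e f v w = vcoord V e v * vcoord V f w"

lemma coord_form: "form (coord_form e f)"
  by (rule formI) (simp_all add: coord_form_def V.vcoord_add V.vcoord_scale algebra_simps)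

definition fs :: 'k where
  "fs = sweedler3 H (\<lambda>a b c. \<alpha> (S a) * character V (b * c)) \<Lambda>"

text \<open>The character of a product is a sum of products of matrix entries, and these are values
  of coordinate forms. With these forms as a basis of all bilinear forms, the right side is the
  trace of swap after \<open>avg\<close>.\<close>

lemma fs_eq: "fs = (\<Sum>e\<in>vbasis V. \<Sum>f\<in>vbasis V. avg (coord_form e f) f e)"
proof -
  have "character V (c * d) = (\<Sum>e\<in>vbasis V. \<Sum>f\<in>vbasis V. coord_form e f (c \<cdot> f) (d \<cdot> e))" for c d
    unfolding character_def linear_trace_eq
  proof (rule sum.cong[OF refl])
    fix e assume e: "e \<in> vbasis V"
    have "linear_map V ground (\<lambda>v. vcoord V e (c \<cdot> v))"
      using linear_act[of c] V.linear_vcoord[of e] by (simp add: linear_map_def)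
    from linear_map_expand[OF V.fd_space_axioms this, of "d \<cdot> e"]
    show "vcoord V e ((c * d) \<cdot> e) = (\<Sum>f\<in>vbasis V. coord_form e f (c \<cdot> f) (d \<cdot> e))"
      using e by (simp add: act_mult V.vbasis_carr coord_form_def ground_def mult.commute)
  qed
  then have "sw (\<lambda>c d. \<alpha> (S a) * character V (c * d)) b =
    (\<Sum>e\<in>vbasis V. \<Sum>f\<in>vbasis V. \<alpha> (S a) * sw (\<lambda>c d. coord_form e f (c \<cdot> f) (d \<cdot> e)) b)" for a b
    by (simp only: sum_distrib_left sw_sum sw_mult_left)
  then have "fs = sw (\<lambda>a b. \<Sum>e\<in>vbasis V. \<Sum>f\<in>vbasis V.
      \<alpha> (S a) * sw (\<lambda>c d. coord_form e f (c \<cdot> f) (d \<cdot> e)) b) \<Lambda>"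
    unfolding fs_def sweedler3_def by (intro arg_cong[where f = "\<lambda>F. sw F \<Lambda>"] ext)
  then show ?thesis
    unfolding avg_def by (simp only: sw_sum)
qed

lemma fs_zero:
  assumes "\<And>\<beta>. inv_form \<beta> \<Longrightarrow> \<not> nonzero_form \<beta>"
  shows "fs = 0"
  unfolding fs_eq
  using assms[OF avg_inv[OF coord_form]] by (intro sum.neutral ballI) (auto simp: nonzero_form_def V.vbasis_carr)

text \<open>Each averaged coordinate form is a multiple of \<open>\<beta>\<close>, measured at a
  pair \<open>x, y\<close> with \<open>\<beta> x y\<close> non-zero. By linearity of
  \<open>avg\<close> the sum becomes the average of the swapped form, that is, of \<open>s\<close>
  times \<open>\<beta>\<close>.\<close>

lemma fs_eq_sign:
  assumes \<beta>: "inv_form \<beta>" "nonzero_form \<beta>"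
    and s: "\<And>v w. v \<in> carr V \<Longrightarrow> w \<in> carr V \<Longrightarrow> \<beta> w v = s * \<beta> v w"
  shows "fs = s"
proof -
  have f: "form \<beta>" using \<beta> by (simp add: inv_form_def)
  obtain x y where xy: "x \<in> carr V" "y \<in> carr V" "\<beta> x y \<noteq> 0" using \<beta>(2) by (auto simp: nonzero_form_def)
  let ?B = "vbasis V"
  have "avg (coord_form e g) g e = \<beta> g e * avg (coord_form e g) x y / \<beta> x y"
    if eg: "e \<in> ?B" "g \<in> ?B" for e g
  proof -
    obtain c where c: "\<And>v w. v \<in> carr V \<Longrightarrow> w \<in> carr V \<Longrightarrow> avg (coord_form e g) v w = c * \<beta> v w"
      using inv_form_unique[OF \<beta> avg_inv[OF coord_form]] by blast
    show ?thesis using c[OF V.vbasis_carr V.vbasis_carr, OF eg(2,1)] c[OF xy(1,2)] xy(3) by simp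
  qed
  then have "fs = (\<Sum>e\<in>?B. \<Sum>g\<in>?B. \<beta> g e * avg (coord_form e g) x y) / \<beta> x y"
    unfolding fs_eq by (simp add: sum_divide_distrib)
  also have "(\<Sum>e\<in>?B. \<Sum>g\<in>?B. \<beta> g e * avg (coord_form e g) x y) =
    avg (\<lambda>v w. \<Sum>p\<in>?B \<times> ?B. \<beta> (snd p) (fst p) * coord_form (fst p) (snd p) v w) x y"
    by (simp add: avg_sum sum.cartesian_product case_prod_unfold)
  \<comment> \<open>The one-element index set brings the scalar \<open>s\<close> into the format of
    \<open>avg_sum\<close>.\<close>
  also have "\<dots> = avg (\<lambda>v w. \<Sum>p\<in>{()}. s * \<beta> v w) x y"
  proof (rule avg_cong[OF _ xy(1,2)])
    fix v w assume vw: "v \<in> carr V" "w \<in> carr V"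
    have "(\<Sum>p\<in>?B \<times> ?B. \<beta> (snd p) (fst p) * coord_form (fst p) (snd p) v w) = 
      (\<Sum>e\<in>?B. \<Sum>g\<in>?B. \<beta> g e * coord_form e g v w)"
      by (simp add: sum.cartesian_product case_prod_unfold)
    also have "\<dots> = (\<Sum>g\<in>?B. \<Sum>e\<in>?B. vcoord V g w * vcoord V e v * \<beta> g e)"
      by (subst sum.swap) (simp add: coord_form_def mult.commute)
    also have "\<dots> = \<beta> w v" by (rule form_expand[OF f vw(2,1), symmetric])
    finally show "(\<Sum>p\<in>?B \<times> ?B. \<beta> (snd p) (fst p) * coord_form (fst p) (snd p) v w) = (\<Sum>p\<in>{()}. s * \<beta> v w)"
      using s[OF vw] by simp
  qed
  also have "\<dots> = s * \<beta> x y"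
    by (subst avg_sum) (simp add: avg_id[OF \<beta>(1) xy(1,2)])
  finally show ?thesis using xy(3) by simp
qed

text \<open>The swapped form is invariant, hence a multiple of the original; swapping twice gives
  \<open>s * s = 1\<close>.\<close>

lemma inv_form_sign:
  assumes \<beta>: "inv_form \<beta>" "nonzero_form \<beta>"
  shows "\<exists>s. (s = 1 \<or> s = -1) \<and> (\<forall>v\<in>carr V. \<forall>w\<in>carr V. \<beta> w v = s * \<beta> v w)"
proof -
  obtain s where s: "\<And>v w. v \<in> carr V \<Longrightarrow> w \<in> carr V \<Longrightarrow> \<beta> w v = s * \<beta> v w"
    using inv_form_unique[OF \<beta> inv_form_swap[OF \<beta>(1)]] by blast
  obtain x y where xy: "x \<in> carr V" "y \<in> carr V" "\<beta> x y \<noteq> 0" using \<beta>(2) by (auto simp: nonzero_form_def)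
  have "\<beta> x y = s * (s * \<beta> x y)" using s[OF xy(1,2)] s[OF xy(2,1)] by simp
  then have "s * s = 1" using xy(3) by simp
  then have "s = 1 \<or> s = -1" by (simp add: square_eq_1_iff)
  with s show ?thesis by blast
qed

subsection \<open>The indicator as a trace\<close>

abbreviation "TV \<equiv> tensor_space V V"
abbreviation "Fm \<equiv> twisted_forms H \<alpha> V"

lemma is_vspace_TV: "is_vspace TV"
  by (rule is_vspace_tensor_space)

lemma act_tens_bilinear:
  "bilinear_map V V TV (\<lambda>u v. sw (\<lambda>a b. tens V V (a \<cdot> u) (b \<cdot> v)) h)"
proof -
  note t = bilinear_mapD[OF bilinear_tens[of V V]]
  note a = linear_map_add[OF linear_act] linear_map_scale[OF linear_act]
  have c: "sw (\<lambda>a b. tens V V (a \<cdot> u) (b \<cdot> v)) h \<in> carr TV" if "u \<in> carr V" "v \<in> carr V" for u v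
    by (rule sw_carr[OF is_vspace_TV]) (simp add: tens_carr that)
  show ?thesis
    using c
    by (simp add: bilinear_map_def linear_map_def a linear_map_add[OF t(1)] linear_map_add[OF t(2)]
        linear_map_scale[OF t(1)] linear_map_scale[OF t(2)] sw_add sw_scale[OF ptscale_vector_space])
qed

lemma tensor_act_tens:
  assumes "u \<in> carr V" "v \<in> carr V"
  shows "act (tensor_hmod H V V) h (tens V V u v) = sw (\<lambda>a b. tens V V (a \<cdot> u) (b \<cdot> v)) h"
  using tensor_lift_tens[OF _ act_tens_bilinear assms] ptscale_vector_space
  by (simp add: tensor_hmod_def)

lemma twisted_formsD:
  assumes "b \<in> carr Fm"
  shows "linear_map TV ground b" and "\<And>t. t \<notin> carr TV \<Longrightarrow> b t = 0"
    and "\<And>h t. t \<in> carr TV \<Longrightarrow> b (act (tensor_hmod H V V) h t) = \<alpha> h * b t"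
  using assms by (auto simp: twisted_forms_def hmod_map_def linear_map_def tensor_hmod_def
      one_dim_hmod_def ground_def)

lemma twisted_form_inv_form:
  assumes b: "b \<in> carr Fm"
  shows "inv_form (\<lambda>v w. b (tens V V v w))"
  unfolding inv_form_def
proof (intro conjI allI ballI)
  note t = bilinear_mapD[OF bilinear_tens[of V V]]
  show "form (\<lambda>v w. b (tens V V v w))"
    using linear_map_add[OF twisted_formsD(1)[OF b]] linear_map_scale[OF twisted_formsD(1)[OF b]]
    by (intro formI) (simp_all add: linear_map_add[OF t(1)] linear_map_add[OF t(2)]
        linear_map_scale[OF t(1)] linear_map_scale[OF t(2)] tens_carr ground_def)
  fix h v w assume vw: "v \<in> carr V" "w \<in> carr V"
  have "b (sw (\<lambda>x y. tens V V (x \<cdot> v) (y \<cdot> w)) h) = sw (\<lambda>x y. b (tens V V (x \<cdot> v) (y \<cdot> w))) h"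
    by (rule sw_linear_map[OF is_vspace_TV twisted_formsD(1)[OF b]]) (simp add: tens_carr vw)
  then show "sw (\<lambda>x y. b (tens V V (x \<cdot> v) (y \<cdot> w))) h = \<alpha> h * b (tens V V v w)"
    using twisted_formsD(3)[OF b tens_carr[OF vw], of h] by (simp add: tensor_act_tens vw)
qed

lemma linear_on_tensor_eqI:
  assumes b: "linear_map TV ground b" and b': "linear_map TV ground b'"
    and eq: "\<And>v w. v \<in> carr V \<Longrightarrow> w \<in> carr V \<Longrightarrow> b (tens V V v w) = b' (tens V V v w)"
    and t: "t \<in> carr TV"
  shows "b t = b' t"
proof -
  obtain ps where ps: "set ps \<subseteq> carr V \<times> carr V" "(\<Sum>(u, v)\<leftarrow>ps. tens V V u v) = t"
    using tensor_decomp[OF is_vspace_V t] by blast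
  have "b (\<Sum>(u, v)\<leftarrow>ps. tens V V u v) = b' (\<Sum>(u, v)\<leftarrow>ps. tens V V u v)"
    using ps(1)
  proof (induction ps)
    case Nil
    show ?case
      by (simp only: list.map sum_list.Nil linear_map_zero[OF is_vspace_TV b] linear_map_zero[OF is_vspace_TV b'])
  next
    case (Cons p ps)
    obtain u v where p: "p = (u, v)" by (cases p)
    have c: "tens V V u v \<in> carr TV" "(\<Sum>(u, v)\<leftarrow>ps. tens V V u v) \<in> carr TV"
      using Cons.prems p by (auto intro: tens_carr tens_list_carr)
    have "b (tens V V u v + (\<Sum>(u, v)\<leftarrow>ps. tens V V u v)) = b' (tens V V u v + (\<Sum>(u, v)\<leftarrow>ps. tens V V u v))"
      unfolding linear_map_add[OF b c] linear_map_add[OF b' c]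
      using Cons p eq by simp
    then show ?case by (simp only: p list.map sum_list.Cons case_prod_conv)
  qed
  then show ?thesis by (simp only: ps(2))
qed

lemma linear_tensor_act: "linear_map TV TV (act (tensor_hmod H V V) h)"
  using linear_tensor_lift[OF is_vspace_V is_vspace_TV act_tens_bilinear] by (simp add: tensor_hmod_def)

text \<open>Inverse to restriction to pure tensors; the value 0 off the tensor space is the
  normalisation demanded by \<open>twisted_forms\<close>.\<close>

definition form_to_twisted :: "('v \<Rightarrow> 'v \<Rightarrow> 'k) \<Rightarrow> ('k, 'v, 'v) tensor \<Rightarrow> 'k" where
  "form_to_twisted \<beta> t = (if t \<in> carr TV then tensor_lift V V \<beta> t else 0)"

lemma form_to_twisted_linear:
  assumes "form \<beta>"
  shows "linear_map TV ground (form_to_twisted \<beta>)"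
proof -
  interpret T: vspace_carrier TV by unfold_locales (rule is_vspace_TV)
  have "linear_map TV ground (tensor_lift V V \<beta>)"
    by (rule linear_tensor_lift[OF is_vspace_V is_vspace_ground assms])
  then show ?thesis using T.carr_add T.carr_scale by (simp add: linear_map_def form_to_twisted_def)
qed

lemma form_to_twisted_tens:
  assumes "form \<beta>" "v \<in> carr V" "w \<in> carr V"
  shows "form_to_twisted \<beta> (tens V V v w) = \<beta> v w"
  using tensor_lift_tens[OF is_vspace_vector_space[OF is_vspace_ground] assms]
  by (simp add: form_to_twisted_def tens_carr assms)

lemma form_to_twisted_mem:
  assumes \<beta>: "inv_form \<beta>"
  shows "form_to_twisted \<beta> \<in> carr Fm"
proof -
  have f: "form \<beta>" using \<beta> by (simp add: inv_form_def)
  note lin = form_to_twisted_linear[OF f]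
  have "form_to_twisted \<beta> (act (tensor_hmod H V V) h t) = \<alpha> h * form_to_twisted \<beta> t" if t: "t \<in> carr TV" for h t
  proof (rule linear_on_tensor_eqI[OF _ _ _ t])
    show "linear_map TV ground (\<lambda>t. form_to_twisted \<beta> (act (tensor_hmod H V V) h t))"
      using lin linear_tensor_act[of h] by (simp add: linear_map_def)
    show "linear_map TV ground (\<lambda>t. \<alpha> h * form_to_twisted \<beta> t)"
      using lin by (simp add: linear_map_def ground_def algebra_simps)
    fix v w assume vw: "v \<in> carr V" "w \<in> carr V"
    have "form_to_twisted \<beta> (sw (\<lambda>a b. tens V V (a \<cdot> v) (b \<cdot> w)) h) =
      sw (\<lambda>a b. form_to_twisted \<beta> (tens V V (a \<cdot> v) (b \<cdot> w))) h"
      by (rule sw_linear_map[OF is_vspace_TV lin]) (simp add: tens_carr vw)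
    then show "form_to_twisted \<beta> (act (tensor_hmod H V V) h (tens V V v w)) = \<alpha> h * form_to_twisted \<beta> (tens V V v w)"
      using \<beta> by (simp add: tensor_act_tens vw form_to_twisted_tens[OF f] inv_form_def)
  qed
  then show ?thesis
    using lin by (simp add: twisted_forms_def hmod_map_def linear_map_def tensor_hmod_def
        one_dim_hmod_def ground_def form_to_twisted_def)
qed

lemma is_vspace_Fm: "is_vspace Fm"
proof -
  interpret P: vector_space ptscale by (rule ptscale_vector_space)
  interpret T: vspace_carrier TV by unfold_locales (rule is_vspace_TV)
  have "P.subspace (carr Fm)"
    by (rule P.subspaceI)
      (auto simp: twisted_forms_def hmod_map_def linear_map_def tensor_hmod_def one_dim_hmod_def
        ptscale_def algebra_simps)
  then show ?thesis
    by (simp add: is_vspace_def twisted_forms_def P.vector_space_axioms)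
qed

text \<open>Both functions vanish off the tensor space, so agreement on pure tensors gives equality
  as functions on the whole type.\<close>

lemma twisted_eqI:
  assumes "b \<in> carr Fm" "b' \<in> carr Fm"
    and "\<And>v w. v \<in> carr V \<Longrightarrow> w \<in> carr V \<Longrightarrow> b (tens V V v w) = b' (tens V V v w)"
  shows "b = b'"
proof
  fix t show "b t = b' t"
    using linear_on_tensor_eqI[OF twisted_formsD(1)[OF assms(1)] twisted_formsD(1)[OF assms(2)] assms(3)]
      twisted_formsD(2)[OF assms(1), of t] twisted_formsD(2)[OF assms(2), of t]
    by (cases "t \<in> carr TV") simp_all
qed

lemma scal_Fm [simp]: "scal Fm = ptscale"
  by (simp add: twisted_forms_def)

text \<open>The space of twisted forms is zero, and a basis cannot contain 0, so the trace is an
  empty sum.\<close>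

lemma twisted_indicator_zero:
  assumes "\<And>\<beta>. inv_form \<beta> \<Longrightarrow> \<not> nonzero_form \<beta>"
  shows "twisted_indicator H \<alpha> V = 0"
proof -
  interpret F: vspace_carrier Fm by unfold_locales (rule is_vspace_Fm)
  have F0: "carr Fm = {0}"
  proof -
    have "b = 0" if b: "b \<in> carr Fm" for b
      by (rule twisted_eqI[OF b F.carr_zero])
        (use assms[OF twisted_form_inv_form[OF b]] in \<open>auto simp: nonzero_form_def\<close>)
    then show ?thesis using F.carr_zero by blast
  qed
  have "fin_dim Fm" unfolding fin_dim_def F0 by (intro exI[of _ "{}"]) (simp del: scal_Fm)
  then interpret F: fd_space Fm by unfold_locales
  have "b \<notin> vbasis Fm" for b
    using F.vbasis_carr[of b] F.independent_vbasis F.dependent_zero F0 by auto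
  then have "vbasis Fm = {}" by blast
  then show ?thesis by (simp add: twisted_indicator_def linear_trace_eq)
qed

text \<open>The space of twisted forms is the line through \<open>b0\<close>. The swap is thus a map
  of rank one, with its coefficient read off at \<open>x, y\<close>.\<close>

lemma twisted_indicator_sign:
  assumes \<beta>: "inv_form \<beta>" "nonzero_form \<beta>"
    and s: "\<And>v w. v \<in> carr V \<Longrightarrow> w \<in> carr V \<Longrightarrow> \<beta> w v = s * \<beta> v w"
  shows "twisted_indicator H \<alpha> V = s"
proof -
  have f: "form \<beta>" using \<beta> by (simp add: inv_form_def)
  obtain x y where xy: "x \<in> carr V" "y \<in> carr V" "\<beta> x y \<noteq> 0" using \<beta>(2) by (auto simp: nonzero_form_def)
  interpret F: vspace_carrier Fm by unfold_locales (rule is_vspace_Fm)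
  define b0 where "b0 = form_to_twisted \<beta>"
  have b0: "b0 \<in> carr Fm" unfolding b0_def by (rule form_to_twisted_mem[OF \<beta>(1)])
  have b0_tens: "b0 (tens V V v w) = \<beta> v w" if "v \<in> carr V" "w \<in> carr V" for v w
    unfolding b0_def by (rule form_to_twisted_tens[OF f that])
  have scale: "b = ptscale (b (tens V V x y) / \<beta> x y) b0" if b: "b \<in> carr Fm" for b
  proof (rule twisted_eqI[OF b])
    show "ptscale (b (tens V V x y) / \<beta> x y) b0 \<in> carr Fm"
      using F.carr_scale[OF b0] by simp
    obtain c where c: "\<And>v w. v \<in> carr V \<Longrightarrow> w \<in> carr V \<Longrightarrow> b (tens V V v w) = c * \<beta> v w"
      using inv_form_unique[OF \<beta> twisted_form_inv_form[OF b]] by blast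
    fix v w assume vw: "v \<in> carr V" "w \<in> carr V"
    show "b (tens V V v w) = ptscale (b (tens V V x y) / \<beta> x y) b0 (tens V V v w)"
      using c[OF vw] c[OF xy(1,2)] xy(3) by (simp add: ptscale_def b0_tens vw)
  qed
  have "fin_dim Fm"
    unfolding fin_dim_def
  proof (intro exI[of _ "{b0}"] conjI subsetI)
    fix b assume "b \<in> carr Fm"
    then show "b \<in> F.span {b0}"
      using scale F.span_scale[OF F.span_base[of b0 "{b0}"]] by (metis insertI1 scal_Fm)
  qed (simp_all add: b0)
  then interpret F: fd_space Fm by unfold_locales
  have swap: "swap_form V b = ptscale (s * (b (tens V V x y) / \<beta> x y)) b0" if b: "b \<in> carr Fm" for b
  proof
    fix t
    have inv: "inv_form (\<lambda>v w. b (tens V V w v))"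
      using inv_form_swap[OF twisted_form_inv_form[OF b]] by simp
    have "swap_form V b = form_to_twisted (\<lambda>v w. b (tens V V w v))"
      by (simp add: swap_form_def form_to_twisted_def fun_eq_iff)
    moreover have "\<dots> = ptscale (s * (b (tens V V x y) / \<beta> x y)) b0"
    proof (rule twisted_eqI[OF form_to_twisted_mem[OF inv]])
      show "ptscale (s * (b (tens V V x y) / \<beta> x y)) b0 \<in> carr Fm"
        using F.carr_scale[OF b0] by simp
      fix v w assume vw: "v \<in> carr V" "w \<in> carr V"
      have "b (tens V V w v) = b (tens V V x y) / \<beta> x y * \<beta> w v"
        using fun_cong[OF scale[OF b], of "tens V V w v"] by (simp add: ptscale_def b0_tens vw)
      then show "form_to_twisted (\<lambda>v w. b (tens V V w v)) (tens V V v w) =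
        ptscale (s * (b (tens V V x y) / \<beta> x y)) b0 (tens V V v w)"
        using inv by (simp add: form_to_twisted_tens vw inv_form_def ptscale_def b0_tens s[OF vw])
    qed
    ultimately show "swap_form V b t = ptscale (s * (b (tens V V x y) / \<beta> x y)) b0 t" by simp
  qed
  have "linear_map Fm ground (\<lambda>b. s * (b (tens V V x y) / \<beta> x y))"
    by (simp add: linear_map_def ground_def ptscale_def algebra_simps add_divide_distrib)
  from F.trace_rank_one[OF this b0]
  have "linear_trace Fm (\<lambda>b. ptscale (s * (b (tens V V x y) / \<beta> x y)) b0) = s"
    using xy by (simp add: b0_tens)
  moreover have "linear_trace Fm (swap_form V) =
    linear_trace Fm (\<lambda>b. ptscale (s * (b (tens V V x y) / \<beta> x y)) b0)"
    by (rule F.trace_cong) (rule swap)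
  ultimately show ?thesis by (simp add: twisted_indicator_def)
qed

subsection \<open>The twisted dual\<close>

abbreviation "Lm \<equiv> one_dim_hmod \<alpha> :: ('k, 'k, 'h) hmod"
abbreviation "Dm \<equiv> dual_hmod H V"
abbreviation "LD \<equiv> tensor_space Lm Dm"
abbreviation "Tw \<equiv> tensor_hmod H Lm Dm"

text \<open>Tensors are functionals on bilinear forms, so \<open>t (ev w)\<close> is the value at
  \<open>w\<close> of the functional on \<open>V\<close> that corresponds to \<open>t\<close> when
  \<open>L \<otimes> V\<^sup>\<or>\<close> is identified with the dual of \<open>V\<close>.\<close>

definition ev :: "'v \<Rightarrow> 'k \<Rightarrow> ('v \<Rightarrow> 'k) \<Rightarrow> 'k" where "ev w c \<phi> = c * \<phi> w"

lemma is_vspace_Lm: "is_vspace Lm"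
  using is_vspace_ground by (simp add: is_vspace_def one_dim_hmod_def ground_def)

lemma carr_Lm [simp]: "carr Lm = UNIV" and scal_Lm [simp]: "scal Lm = (*)"
  and act_Lm [simp]: "act Lm h c = \<alpha> h * c"
  by (simp_all add: one_dim_hmod_def)

lemma scal_Dm [simp]: "scal Dm = ptscale"
  and act_Dm: "act Dm h \<phi> v = (if v \<in> carr V then \<phi> (S h \<cdot> v) else 0)"
  by (simp_all add: dual_hmod_def)

lemma carr_Dm: "\<phi> \<in> carr Dm \<longleftrightarrow> linear_map V ground \<phi> \<and> (\<forall>v. v \<notin> carr V \<longrightarrow> \<phi> v = 0)"
  by (simp add: dual_hmod_def)

lemma is_vspace_Dm: "is_vspace Dm"
proof -
  interpret P: vector_space ptscale by (rule ptscale_vector_space)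
  have "P.subspace (carr Dm)"
    by (rule P.subspaceI) (auto simp: carr_Dm linear_map_def ground_def ptscale_def algebra_simps)
  then show ?thesis by (simp add: is_vspace_def P.vector_space_axioms)
qed

lemma act_Dm_carr: "\<phi> \<in> carr Dm \<Longrightarrow> act Dm h \<phi> \<in> carr Dm"
  using linear_act[of "S h"] by (auto simp: carr_Dm act_Dm linear_map_def V.carr_add V.carr_scale)

lemma ev_bilinear: "bilinear_map Lm Dm ground (ev w)"
  by (simp add: bilinear_map_def linear_map_def ground_def ev_def ptscale_def algebra_simps)

lemma tens_ev: "tens Lm Dm c \<phi> (ev w) = c * \<phi> w"
  by (simp add: tens_def ev_bilinear) (simp add: ev_def)

text \<open>For a pure tensor the scalar moves from the one-dimensional factor to the functional;
  both properties pass to sums.\<close>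

lemma tensor_LD_eq:
  assumes t: "t \<in> carr LD"
  shows "(\<lambda>w. t (ev w)) \<in> carr Dm \<and> t = tens Lm Dm 1 (\<lambda>w. t (ev w))"
proof -
  note tl = bilinear_mapD[OF bilinear_tens[of Lm Dm]]
  interpret D: vspace_carrier Dm by unfold_locales (rule is_vspace_Dm)
  obtain ps where ps: "set ps \<subseteq> carr Lm \<times> carr Dm" "(\<Sum>(u, v)\<leftarrow>ps. tens Lm Dm u v) = t"
    using tensor_decomp[OF is_vspace_Lm t] by blast
  define P where "P t \<longleftrightarrow> (\<lambda>w. t (ev w)) \<in> carr Dm \<and> t = tens Lm Dm 1 (\<lambda>w. t (ev w))" for t
  have P0: "P 0"
  proof -
    have "tens Lm Dm 1 0 = 0"
      using linear_map_zero[OF is_vspace_Dm tl(2)[of 1]] by simp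
    then show ?thesis using D.carr_zero by (simp add: P_def zero_fun_def)
  qed
  have Padd: "P (s + t)" if "P s" "P t" for s t
  proof -
    have eq: "(\<lambda>w. (s + t) (ev w)) = (\<lambda>w. s (ev w)) + (\<lambda>w. t (ev w))" by (simp add: fun_eq_iff)
    have "tens Lm Dm 1 ((\<lambda>w. s (ev w)) + (\<lambda>w. t (ev w))) = s + t"
    proof -
      have "tens Lm Dm 1 ((\<lambda>w. s (ev w)) + (\<lambda>w. t (ev w))) =
          tens Lm Dm 1 (\<lambda>w. s (ev w)) + tens Lm Dm 1 (\<lambda>w. t (ev w))"
        using that by (intro linear_map_add[OF tl(2)]) (simp_all only: P_def carr_Lm UNIV_I)
      then show ?thesis using that unfolding P_def by metis
    qed
    then show ?thesis using that D.carr_add[of "\<lambda>w. s (ev w)" "\<lambda>w. t (ev w)"] unfolding P_def eq by metis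
  qed
  have Ptens: "P (tens Lm Dm c \<phi>)" if \<phi>: "\<phi> \<in> carr Dm" for c \<phi>
  proof -
    have eq: "(\<lambda>w. tens Lm Dm c \<phi> (ev w)) = ptscale c \<phi>" by (simp add: tens_ev ptscale_def)
    have "tens Lm Dm 1 (ptscale c \<phi>) = ptscale c (tens Lm Dm 1 \<phi>)"
      using linear_map_scale[OF tl(2)[of 1], of \<phi> c] \<phi> by simp
    also have "\<dots> = tens Lm Dm c \<phi>"
      using linear_map_scale[OF tl(1)[OF \<phi>], of 1 c] by simp
    finally show ?thesis using D.carr_scale[OF \<phi>, of c] unfolding P_def eq by simp
  qed
  have "P (\<Sum>(u, v)\<leftarrow>ps. tens Lm Dm u v)" using ps(1)
  proof (induction ps)
    case Nil
    show ?case unfolding list.map sum_list.Nil by (rule P0)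
  next
    case (Cons p ps)
    obtain c \<phi> where p: "p = (c, \<phi>)" by (cases p)
    have "\<phi> \<in> carr Dm" "P (\<Sum>(u, v)\<leftarrow>ps. tens Lm Dm u v)" using Cons p by auto
    then show ?case unfolding p list.map sum_list.Cons case_prod_conv by (intro Padd Ptens)
  qed
  then show ?thesis unfolding ps(2) P_def .
qed

lemma LD_eqI:
  assumes "s \<in> carr LD" "t \<in> carr LD" "\<And>w. w \<in> carr V \<Longrightarrow> s (ev w) = t (ev w)"
  shows "s = t"
proof -
  note s = tensor_LD_eq[OF assms(1)] and t = tensor_LD_eq[OF assms(2)]
  have off: "s (ev w) = 0" "t (ev w) = 0" if "w \<notin> carr V" for w
    using s[THEN conjunct1] t[THEN conjunct1] that unfolding carr_Dm by blast+
  have "(\<lambda>w. s (ev w)) = (\<lambda>w. t (ev w))"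
  proof
    fix w show "s (ev w) = t (ev w)"
      using assms(3)[of w] off[of w] by (cases "w \<in> carr V") simp_all
  qed
  then show ?thesis using s[THEN conjunct2] t[THEN conjunct2] by metis
qed

lemma carr_Tw: "carr Tw = carr LD" and scal_Tw: "scal Tw = ptscale"
  by (simp_all add: tensor_hmod_def)

lemma act_Tw_bilinear:
  "bilinear_map Lm Dm LD (\<lambda>c \<phi>. sw (\<lambda>a b. tens Lm Dm (act Lm a c) (act Dm b \<phi>)) h)"
proof -
  note t = bilinear_mapD[OF bilinear_tens[of Lm Dm]]
  have c: "sw (\<lambda>a b. tens Lm Dm (\<alpha> a * c) (act Dm b \<phi>)) h \<in> carr LD" if "\<phi> \<in> carr Dm" for c \<phi>
    by (rule sw_carr[OF is_vspace_tensor_space]) (simp add: tens_carr that act_Dm_carr)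
  have add: "act Dm b (\<phi> + \<psi>) = act Dm b \<phi> + act Dm b \<psi>"
    "act Dm b (ptscale c \<phi>) = ptscale c (act Dm b \<phi>)" for b c \<phi> \<psi>
    by (auto simp: fun_eq_iff act_Dm ptscale_def)
  have scale0: "tens Lm Dm (c * d) \<phi> = ptscale c (tens Lm Dm d \<phi>)" if "\<phi> \<in> carr Dm" for c d \<phi>
    using linear_map_scale[OF t(1)[OF that], of d c] by simp
  have scale1: "tens Lm Dm (\<alpha> a * (c * d)) \<phi> = ptscale c (tens Lm Dm (\<alpha> a * d) \<phi>)"
    if "\<phi> \<in> carr Dm" for a c d \<phi>
    using scale0[OF that, of c "\<alpha> a * d"] by (simp only: mult.left_commute)
  have scale2: "tens Lm Dm c (ptscale d \<phi>) = ptscale d (tens Lm Dm c \<phi>)" if "\<phi> \<in> carr Dm" for c d \<phi>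
    using linear_map_scale[OF t(2)[of c] that, of d] by simp
  have add1: "tens Lm Dm (c + d) \<phi> = tens Lm Dm c \<phi> + tens Lm Dm d \<phi>" if "\<phi> \<in> carr Dm" for c d \<phi>
    using linear_map_add[OF t(1)[OF that], of c d] by simp
  have add2: "tens Lm Dm c (\<phi> + \<psi>) = tens Lm Dm c \<phi> + tens Lm Dm c \<psi>"
    if "\<phi> \<in> carr Dm" "\<psi> \<in> carr Dm" for c \<phi> \<psi>
    using linear_map_add[OF t(2)[of c] that] by simp
  show ?thesis
    by (simp add: bilinear_map_def linear_map_def c add scale1 scale2 add1 add2 act_Dm_carr distrib_left
        sw_add sw_scale[OF ptscale_vector_space])
qed

lemma linear_act_Tw: "linear_map LD LD (act Tw h)"
  using linear_tensor_lift[OF is_vspace_Lm is_vspace_tensor_space act_Tw_bilinear]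
  by (simp add: tensor_hmod_def)

text \<open>Read through \<open>ev\<close>, the action on the twisted dual has the shape of
  \<open>inv_form_act\<close>. This is the link between module maps into it and invariant
  forms.\<close>

lemma act_Tw_ev:
  assumes t: "t \<in> carr LD" and w: "w \<in> carr V"
  shows "act Tw h t (ev w) = sw (\<lambda>a b. \<alpha> a * t (ev (S b \<cdot> w))) h"
proof -
  let ?\<phi> = "\<lambda>w. t (ev w)"
  have \<phi>: "?\<phi> \<in> carr Dm" and teq: "t = tens Lm Dm 1 ?\<phi>" using tensor_LD_eq[OF t] by blast+
  have "act Tw h (tens Lm Dm 1 ?\<phi>) = sw (\<lambda>a b. tens Lm Dm (\<alpha> a) (act Dm b ?\<phi>)) h"
    using tensor_lift_tens[OF _ act_Tw_bilinear, of 1 ?\<phi>] \<phi> ptscale_vector_space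
    by (simp add: tensor_hmod_def)
  then have 1: "act Tw h t = sw (\<lambda>a b. tens Lm Dm (\<alpha> a) (act Dm b ?\<phi>)) h"
    by (simp only: teq[symmetric])
  have "(\<Sum>(a, b)\<leftarrow>ps. f a b) \<psi> = (\<Sum>(a, b)\<leftarrow>ps. f a b \<psi>)" for ps and f :: "'h \<Rightarrow> 'h \<Rightarrow> ('k, 'k, 'v \<Rightarrow> 'k) tensor" and \<psi>
    by (induction ps) auto
  then show ?thesis unfolding 1 by (simp add: sw_cop tens_ev act_Dm w)
qed

text \<open>An isomorphism \<open>f\<close> is read as the form \<open>f v (ev w)\<close>; were this
  form zero, \<open>f\<close> would identify a non-zero vector with 0.\<close>

lemma iso_imp_inv_form:
  assumes "hmod_iso V Tw"
  shows "\<exists>\<beta>. inv_form \<beta> \<and> nonzero_form \<beta>"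
proof -
  obtain f where f: "hmod_map V Tw f" "bij_betw f (carr V) (carr Tw)"
    using assms by (auto simp: hmod_iso_def)
  have lin: "linear_map V LD f" using f(1) by (simp add: hmod_map_def linear_map_def carr_Tw scal_Tw)
  have fc: "f v \<in> carr LD" if "v \<in> carr V" for v using linear_map_carr[OF lin that] .
  define \<beta> where "\<beta> v w = f v (ev w)" for v w
  have lin2: "linear_map V ground (\<beta> v)" if "v \<in> carr V" for v
  proof -
    have "\<beta> v = (\<lambda>w. f v (ev w))" by (simp add: fun_eq_iff \<beta>_def)
    then show ?thesis using tensor_LD_eq[OF fc[OF that], THEN conjunct1] by (simp add: carr_Dm)
  qed
  have "form \<beta>"
    using linear_map_add[OF lin2] linear_map_scale[OF lin2]
    by (intro formI) (simp_all add: \<beta>_def linear_map_add[OF lin] linear_map_scale[OF lin] ptscale_def ground_def)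
  moreover have "\<beta> (h \<cdot> v) w = sw (\<lambda>a b. \<alpha> a * \<beta> v (S b \<cdot> w)) h" if "v \<in> carr V" "w \<in> carr V" for h v w
    using f(1) that act_Tw_ev[OF fc[OF that(1)] that(2), of h] by (simp add: hmod_map_def \<beta>_def)
  ultimately have "inv_form \<beta>" by (rule inv_formI)
  moreover have "nonzero_form \<beta>"
  proof (rule ccontr)
    assume n: "\<not> nonzero_form \<beta>"
    obtain v where v: "v \<in> carr V" "v \<noteq> 0" using carr_nontrivial by blast
    have "f v = f 0"
    proof (rule LD_eqI)
      show "f v \<in> carr LD" "f 0 \<in> carr LD" using fc v by auto
      show "f v (ev w) = f 0 (ev w)" if "w \<in> carr V" for w
        using n v that V.carr_zero unfolding nonzero_form_def \<beta>_def by metis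
    qed
    then show False using f(2) v V.carr_zero by (auto simp: bij_betw_def inj_on_def)
  qed
  ultimately show ?thesis by blast
qed

text \<open>The isomorphism is \<open>v \<mapsto> 1 \<otimes> \<beta>(v, _)\<close>, injective by
  non-degeneracy and surjective by \<open>form_represents\<close>.\<close>

lemma inv_form_imp_iso:
  assumes \<beta>: "inv_form \<beta>" "nonzero_form \<beta>"
  shows "hmod_iso V Tw"
proof -
  have f: "form \<beta>" using \<beta> by (simp add: inv_form_def)
  define g where "g v w = (if w \<in> carr V then \<beta> v w else 0)" for v w
  have g: "g v \<in> carr Dm" if "v \<in> carr V" for v
    using bilinear_mapD(2)[OF f that]
    by (simp add: carr_Dm linear_map_def g_def V.carr_add V.carr_scale)
  define F where "F v = tens Lm Dm 1 (g v)" for v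
  have Fc: "F v \<in> carr LD" if "v \<in> carr V" for v
    unfolding F_def by (rule tens_carr) (simp_all add: g that)
  have Fev: "F v (ev w) = \<beta> v w" if "w \<in> carr V" for v w
    using that by (simp add: F_def tens_ev g_def)
  interpret LD: vspace_carrier LD by unfold_locales (rule is_vspace_tensor_space)
  have "linear_map V LD F"
    unfolding linear_map_def
  proof (intro conjI ballI allI)
    fix x y assume xy: "x \<in> carr V" "y \<in> carr V"
    show "F (x + y) = F x + F y"
      by (rule LD_eqI) (use xy in \<open>auto simp: Fev form_add_left[OF f] intro!: Fc LD.carr_add V.carr_add\<close>)
  next
    fix c x assume x: "x \<in> carr V"
    show "F (scal V c x) = scal LD c (F x)"
    proof (rule LD_eqI)
      show "scal LD c (F x) \<in> carr LD" by (rule LD.carr_scale[OF Fc[OF x]])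
      show "F (scal V c x) (ev w) = scal LD c (F x) (ev w)" if "w \<in> carr V" for w
        using x that by (simp add: Fev form_scale_left[OF f] ptscale_def)
    qed (rule Fc[OF V.carr_scale[OF x]])
  qed (rule Fc)
  then have "linear_map V Tw F" by (simp add: linear_map_def carr_Tw scal_Tw)
  moreover have "F (h \<cdot> v) = act Tw h (F v)" if v: "v \<in> carr V" for h v
  proof (rule LD_eqI)
    show "F (h \<cdot> v) (ev w) = act Tw h (F v) (ev w)" if w: "w \<in> carr V" for w
      using w by (simp add: act_Tw_ev[OF Fc[OF v] w] Fev inv_form_act[OF \<beta>(1) v w])
  qed (use v linear_map_carr[OF linear_act_Tw Fc[OF v]] in \<open>auto intro: Fc\<close>)
  ultimately have "hmod_map V Tw F" by (simp add: hmod_map_def)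
  moreover have "bij_betw F (carr V) (carr Tw)"
    unfolding carr_Tw
  proof (rule bij_betwI')
    fix x y assume xy: "x \<in> carr V" "y \<in> carr V"
    show "F x = F y \<longleftrightarrow> x = y"
    proof
      assume eq: "F x = F y"
      have "x - y = 0"
      proof (rule left_nondegenerate[OF \<beta>])
        show "\<beta> (x - y) w = 0" if w: "w \<in> carr V" for w
          using form_add_left[OF f, of "x - y" y w] w xy Fev[OF w, of x] Fev[OF w, of y] eq
          by (simp add: V.carr_diff)
      qed (use xy in auto)
      then show "x = y" by simp
    qed simp
  next
    fix t assume t: "t \<in> carr LD"
    obtain v where v: "v \<in> carr V" "\<forall>w\<in>carr V. \<beta> v w = t (ev w)"
      using form_represents[OF \<beta>, of "\<lambda>w. t (ev w)"] tensor_LD_eq[OF t] by (auto simp: carr_Dm)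
    have "t = F v" by (rule LD_eqI[OF t Fc[OF v(1)]]) (simp add: Fev v)
    with v(1) show "\<exists>x\<in>carr V. t = F x" by blast
  qed (rule Fc)
  ultimately show ?thesis by (auto simp: hmod_iso_def)
qed

end

theorem theorem2p21:
  fixes H :: "('k::{alg_closed_field,field_char_0}, 'h::ring_1) hopf"
    and \<alpha> :: "'h \<Rightarrow> 'k"
    and V :: "('k, 'v::ab_group_add, 'h) hmod"
  assumes "hopf_algebra H" and "fin_dim H" and "semisimple H"
    and "algebra_map H \<alpha>"
    and "\<forall>h. sweedler H (\<lambda>a b. scal H (\<alpha> a) b) h = sweedler H (\<lambda>a b. scal H (\<alpha> b) a) h"
    and "simple_hmod H V" and "fin_dim V"
  shows "twisted_indicator H \<alpha> V =
           sweedler3 H (\<lambda>a b c. \<alpha> (antipode H a) * character V (b * c)) (haar_integral H) \<and>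
         twisted_indicator H \<alpha> V \<in> {0, 1, -1} \<and>
         (twisted_indicator H \<alpha> V \<noteq> 0 \<longleftrightarrow>
           hmod_iso V (tensor_hmod H (one_dim_hmod \<alpha>) (dual_hmod H V))) \<and>
         (hmod_iso V (tensor_hmod H (one_dim_hmod \<alpha>) (dual_hmod H V)) \<longleftrightarrow>
           (\<exists>b. invariant_pairing H \<alpha> V b)) \<and>
         (twisted_indicator H \<alpha> V \<noteq> 0 \<or>
          hmod_iso V (tensor_hmod H (one_dim_hmod \<alpha>) (dual_hmod H V)) \<or>
          (\<exists>b. invariant_pairing H \<alpha> V b) \<longrightarrow>
           (\<exists>b. invariant_pairing H \<alpha> V b) \<and>
           (\<forall>b b'. invariant_pairing H \<alpha> V b \<longrightarrow> invariant_pairing H \<alpha> V b' \<longrightarrow>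
              (\<exists>c. c \<noteq> 0 \<and> (\<forall>v\<in>carr V. \<forall>w\<in>carr V. b' v w = c * b v w))) \<and>
           (\<forall>b. invariant_pairing H \<alpha> V b \<longrightarrow>
              (\<forall>v\<in>carr V. \<forall>w\<in>carr V. b w v = twisted_indicator H \<alpha> V * b v w)))"
proof -
  interpret twisted_module H \<alpha> V
    using assms by unfold_locales blast+
  show ?thesis
  \<comment> \<open>Each of the three statements amounts to the existence of a non-zero invariant
    form.\<close>
  proof (cases "\<exists>\<beta>. inv_form \<beta> \<and> nonzero_form \<beta>")
    case False
    then have "twisted_indicator H \<alpha> V = 0" "fs = 0" "\<not> hmod_iso V Tw"
      using twisted_indicator_zero fs_zero iso_imp_inv_form by blast+
    moreover have "(inv_form b \<and> nonzero_form b) = False" for b using False by blast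
    ultimately show ?thesis unfolding fs_def[symmetric] invariant_pairing_iff by auto
  next
    case True
    then obtain \<beta> where \<beta>: "inv_form \<beta>" "nonzero_form \<beta>" by blast
    have sign: "b w v = twisted_indicator H \<alpha> V * b v w \<and> twisted_indicator H \<alpha> V \<in> {1, -1} \<and>
        fs = twisted_indicator H \<alpha> V"
      if b: "inv_form b" "nonzero_form b" and vw: "v \<in> carr V" "w \<in> carr V" for b v w
    proof -
      obtain s where s: "s = 1 \<or> s = -1" "\<And>v w. v \<in> carr V \<Longrightarrow> w \<in> carr V \<Longrightarrow> b w v = s * b v w"
        using inv_form_sign[OF b] by blast
      show ?thesis
        using s(1) s(2)[OF vw] twisted_indicator_sign[OF b s(2)] fs_eq_sign[OF b s(2)] by simp
    qed
    \<comment> \<open>The last two claims of \<open>sign\<close> do not involve the vectors, so a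
      single instance suffices and \<open>x\<close> may be zero.\<close>
    obtain x where "x \<in> carr V" using V.carr_zero by blast
    from sign[OF \<beta> this this]
    have 1: "twisted_indicator H \<alpha> V \<in> {1, -1}" "fs = twisted_indicator H \<alpha> V" by simp_all
    have 2: "hmod_iso V Tw" by (rule inv_form_imp_iso[OF \<beta>])
    have 3: "\<exists>c. c \<noteq> 0 \<and> (\<forall>v\<in>carr V. \<forall>w\<in>carr V. b' v w = c * b v w)"
      if b: "inv_form b" "nonzero_form b" and b': "inv_form b'" "nonzero_form b'" for b b'
    proof -
      obtain c where c: "\<forall>v\<in>carr V. \<forall>w\<in>carr V. b' v w = c * b v w"
        using inv_form_unique[OF b b'(1)] by blast
      with b'(2) have "c \<noteq> 0" by (auto simp: nonzero_form_def)
      with c show ?thesis by blast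
    qed
    have 4: "twisted_indicator H \<alpha> V \<noteq> 0" using 1(1) by auto
    have 5: "\<forall>v\<in>carr V. \<forall>w\<in>carr V. b w v = twisted_indicator H \<alpha> V * b v w"
      if "inv_form b" "nonzero_form b" for b using sign[OF that] by blast
    show ?thesis
      unfolding fs_def[symmetric] invariant_pairing_iff
    proof (intro conjI impI iffI allI)
      show "twisted_indicator H \<alpha> V = fs" using 1(2) by simp
      show "twisted_indicator H \<alpha> V \<in> {0, 1, -1}" using 1(1) by blast
    qed (use 2 3 4 5 True in blast)+
  qed
qed

end
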